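(* Let $(M,g)$ be an $N$-dimensional spherically symmetric Riemannian manifold ($N\ge 2$) with radius $R\in(0,\infty]$ and warping function $\phi$, let $p\ge 1$ be real and $k\ge 1$ an integer. Let $u\in W^{k,p}_{\mathrm{rad}}(M)$ and let $v\colon(0,R)\to\mathbb R$ be its radial representation, $u(x)=v(r)$ for $x=(r,\theta)\in(0,R)\times\mathbb S^{N-1}$. Then $v\in W^{k,p}((0,R),\phi^{N-1})$. Moreover, for a.e. $x=(r,\theta)\in M$, $$|\nabla^j u(x)|_g\ge |v^{(j)}(r)|,\qquad \forall j=0,\ldots,k.$$
   Context: A spherically symmetric Riemannian manifold $(M,g)$ of dimension $N\ge2$ is one such that (1) a single chart covers $M$, with image a ball $B_R=\{x\in\mathbb R^N:|x|<R\}$, $R\in(0,\infty]$ ($B_\infty=\mathbb R^N$); the point $o\in M$ corresponding to $0$ is the origin; (2) in polar coordinates $(r,\theta)$ of this chart, $g=\mathrm dr^2+\phi^2(r)\widetilde g$ where $\widetilde g$ is the standard metric of $\mathbb S^{N-1}$ and $\phi$ (the warping function) is a nonnegative smooth function on $[0,R)$, positive on $(0,R)$, with $\phi'(0)=1$ and $\phi^{(i)}(0)=0$ for all even $i\ge0$. One identifies $M=B_R$ and $M\setminus\{o\}=(0,R)\times\mathbb S^{N-1}$. A function $u\colon M\to\mathbb R$ is radial if there is $v\colon(0,R)\to\mathbb R$ with $u(x)=v(r)$ for all $x=(r,\theta)\in M\setminus\{o\}$. $\nabla^j u$ is the $j$-th covariant derivative ($j$-covariant tensor field, $\nabla^0u=u$)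 and $|\nabla^j u|_g$ its pointwise norm: $|\nabla^ju|_g^2=\sum g^{i_1l_1}\cdots g^{i_jl_j}(\nabla^ju)_{i_1\ldots i_j}(\nabla^ju)_{l_1\ldots l_j}$. $W^{k,p}(M)$ is the completion of $\{u\in C^\infty(M):\int_M|\nabla^ju|_g^p\,\mathrm dV_g<\infty,\ j=0,\ldots,k\}$ under $\|u\|_{W^{k,p}(M)}=\sum_{j=0}^k(\int_M|\nabla^ju|_g^p\,\mathrm dV_g)^{1/p}$, regarded as a subspace of $L^p(M)$, with $\nabla^ju$ defined as the $L^p$-limit of $\nabla^ju_n$ for an approximating Cauchy sequence $(u_n)$. $W^{k,p}_{\mathrm{rad}}(M)$ is the subspace of radial functions. $W^{k,p}((0,R),\phi^{N-1})$ is the space of $v\colon(0,R)\to\mathbb R$ having $k$ weak derivatives with $\int_0^R|v^{(j)}(t)|^p\phi^{N-1}(t)\,\mathrm dt<\infty$ for all $j=0,\ldots,k$. *)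

theory Defs
  imports "HOL-Analysis.Analysis"
begin

section \<open>Smooth functions\<close>

definition partial_deriv :: "'n::finite \<Rightarrow> (real^'n \<Rightarrow> real) \<Rightarrow> real^'n \<Rightarrow> real" where
  "partial_deriv i f x = frechet_derivative f (at x) (axis i 1)"

primrec partial_derivs :: "'n::finite list \<Rightarrow> (real^'n \<Rightarrow> real) \<Rightarrow> real^'n \<Rightarrow> real" where
  "partial_derivs [] f = f"
| "partial_derivs (i # I) f = partial_deriv i (partial_derivs I f)"

(* Intended for open B.  Differentiability of every iterated partial derivative makes all of
   them continuous. *)
definition C_infinity :: "(real^'n::finite) set \<Rightarrow> (real^'n \<Rightarrow> real) set" where
  "C_infinity B = {f. \<forall>I. \<forall>x\<in>B. partial_derivs I f differentiable (at x)}"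

(* Derivatives relative to an interval S, hence one-sided at an end point belonging to S. *)
definition nth_deriv :: "real set \<Rightarrow> nat \<Rightarrow> (real \<Rightarrow> real) \<Rightarrow> real \<Rightarrow> real" where
  "nth_deriv S n f = ((\<lambda>h t. vector_derivative h (at t within S)) ^^ n) f"

definition C_infinity1 :: "real set \<Rightarrow> (real \<Rightarrow> real) set" where
  "C_infinity1 S = {f. \<forall>n. \<forall>t\<in>S. nth_deriv S n f differentiable (at t within S)}"


section \<open>Covariant derivatives in a single chart\<close>

text \<open>A Riemannian metric on an open subset of \<open>\<real>\<^sup>N\<close> is given by its matrix \<open>g x\<close> of coordinate
  components. A covariant \<open>j\<close>-tensor at a point is a function on index lists, of which only the
  lists of length \<open>j\<close> are relevant.\<close>

definition christoffel ::
    "(real^'n \<Rightarrow> real^'n^'n) \<Rightarrow> real^'n \<Rightarrow> 'n::finite \<Rightarrow> 'n \<Rightarrow> 'n \<Rightarrow> real" where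
  "christoffel g x m i l =
     (\<Sum>a\<in>UNIV. matrix_inv (g x) $ m $ a *
        (partial_deriv i (\<lambda>y. g y $ l $ a) x + partial_deriv l (\<lambda>y. g y $ i $ a) x
          - partial_deriv a (\<lambda>y. g y $ i $ l) x)) / 2"

(* The direction of differentiation is the first index. *)
definition cov_deriv ::
    "(real^'n \<Rightarrow> real^'n^'n) \<Rightarrow> (real^'n \<Rightarrow> 'n list \<Rightarrow> real) \<Rightarrow> real^'n \<Rightarrow> 'n::finite list \<Rightarrow> real" where
  "cov_deriv g T x J = (case J of [] \<Rightarrow> 0
     | i # I \<Rightarrow> partial_deriv i (\<lambda>y. T y I) x
         - (\<Sum>s<length I. \<Sum>m\<in>UNIV. christoffel g x m i (I ! s) * T x (I[s := m])))"

primrec nabla ::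
    "(real^'n \<Rightarrow> real^'n^'n) \<Rightarrow> nat \<Rightarrow> (real^'n \<Rightarrow> real) \<Rightarrow> real^'n \<Rightarrow> 'n::finite list \<Rightarrow> real" where
  "nabla g 0 u = (\<lambda>x I. u x)"
| "nabla g (Suc j) u = cov_deriv g (nabla g j u)"

definition tensor_norm ::
    "(real^'n \<Rightarrow> real^'n^'n) \<Rightarrow> nat \<Rightarrow> real^'n \<Rightarrow> ('n::finite list \<Rightarrow> real) \<Rightarrow> real" where
  "tensor_norm g j x T = sqrt (\<Sum>I | length I = j. \<Sum>L | length L = j.
     (\<Prod>s<j. matrix_inv (g x) $ (I ! s) $ (L ! s)) * T I * T L)"

definition riemannian_volume :: "(real^'n::finite) set \<Rightarrow> (real^'n \<Rightarrow> real^'n^'n) \<Rightarrow> (real^'n) measure" where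
  "riemannian_volume B g = density (lebesgue_on B) (\<lambda>x. ennreal (sqrt (det (g x))))"


section \<open>Sobolev spaces on a manifold with a single chart\<close>

definition Lp_norm ::
    "(real^'n) set \<Rightarrow> (real^'n \<Rightarrow> real^'n^'n) \<Rightarrow> real \<Rightarrow> nat \<Rightarrow> (real^'n \<Rightarrow> 'n::finite list \<Rightarrow> real) \<Rightarrow> real" where
  "Lp_norm B g p j T =
     (\<integral>x. tensor_norm g j x (T x) powr p \<partial>riemannian_volume B g) powr (1 / p)"

definition Lp_space ::
    "(real^'n) set \<Rightarrow> (real^'n \<Rightarrow> real^'n^'n) \<Rightarrow> real \<Rightarrow> nat \<Rightarrow> (real^'n \<Rightarrow> 'n::finite list \<Rightarrow> real) set" where
  "Lp_space B g p j = {T.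
     (\<forall>I. length I = j \<longrightarrow> (\<lambda>x. T x I) \<in> borel_measurable (riemannian_volume B g)) \<and>
     integrable (riemannian_volume B g) (\<lambda>x. tensor_norm g j x (T x) powr p)}"

definition Lp_limit ::
    "(real^'n) set \<Rightarrow> (real^'n \<Rightarrow> real^'n^'n) \<Rightarrow> real \<Rightarrow> nat \<Rightarrow> (nat \<Rightarrow> real^'n \<Rightarrow> 'n list \<Rightarrow> real) \<Rightarrow>
      (real^'n \<Rightarrow> 'n::finite list \<Rightarrow> real) \<Rightarrow> bool" where
  "Lp_limit B g p j F T \<longleftrightarrow> T \<in> Lp_space B g p j \<and>
     (\<lambda>n. Lp_norm B g p j (\<lambda>x I. F n x I - T x I)) \<longlonglongrightarrow> 0"

definition smooth_sobolev ::
    "(real^'n) set \<Rightarrow> (real^'n \<Rightarrow> real^'n^'n) \<Rightarrow> nat \<Rightarrow> real \<Rightarrow> (real^'n::finite \<Rightarrow> real) set" where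
  "smooth_sobolev B g k p =
     {u \<in> C_infinity B. \<forall>j\<le>k. integrable (riemannian_volume B g)
        (\<lambda>x. tensor_norm g j x (nabla g j u x) powr p)}"

definition sobolev_norm ::
    "(real^'n) set \<Rightarrow> (real^'n \<Rightarrow> real^'n^'n) \<Rightarrow> nat \<Rightarrow> real \<Rightarrow> (real^'n::finite \<Rightarrow> real) \<Rightarrow> real" where
  "sobolev_norm B g k p u = (\<Sum>j\<le>k. Lp_norm B g p j (nabla g j u))"

definition sobolev_approx ::
    "(real^'n) set \<Rightarrow> (real^'n \<Rightarrow> real^'n^'n) \<Rightarrow> nat \<Rightarrow> real \<Rightarrow> (nat \<Rightarrow> real^'n \<Rightarrow> real) \<Rightarrow>
      (real^'n::finite \<Rightarrow> real) \<Rightarrow> bool" where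
  "sobolev_approx B g k p U u \<longleftrightarrow>
     (\<forall>n. U n \<in> smooth_sobolev B g k p) \<and>
     (\<forall>e>0. \<exists>n0. \<forall>m\<ge>n0. \<forall>n\<ge>n0. sobolev_norm B g k p (\<lambda>x. U m x - U n x) < e) \<and>
     Lp_limit B g p 0 (\<lambda>n x I. U n x) (\<lambda>x I. u x)"

(* The completion of the smooth functions of finite norm, realised inside the p-integrable
   functions: the limits there of sequences that are Cauchy in the Sobolev norm.  Functions that
   agree almost everywhere are not identified. *)
definition sobolev_space ::
    "(real^'n) set \<Rightarrow> (real^'n \<Rightarrow> real^'n^'n) \<Rightarrow> nat \<Rightarrow> real \<Rightarrow> (real^'n::finite \<Rightarrow> real) set" where
  "sobolev_space B g k p = {u. \<exists>U. sobolev_approx B g k p U u}"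

definition has_sobolev_nabla ::
    "(real^'n) set \<Rightarrow> (real^'n \<Rightarrow> real^'n^'n) \<Rightarrow> nat \<Rightarrow> real \<Rightarrow> nat \<Rightarrow> (real^'n \<Rightarrow> real) \<Rightarrow>
      (real^'n \<Rightarrow> 'n::finite list \<Rightarrow> real) \<Rightarrow> bool" where
  "has_sobolev_nabla B g k p j u T \<longleftrightarrow>
     (\<exists>U. sobolev_approx B g k p U u \<and> Lp_limit B g p j (\<lambda>n. nabla g j (U n)) T)"

(* For j <= k and u in the Sobolev space such tensor fields exist and agree almost everywhere;
   this is one of them. *)
definition sobolev_nabla ::
    "(real^'n) set \<Rightarrow> (real^'n \<Rightarrow> real^'n^'n) \<Rightarrow> nat \<Rightarrow> real \<Rightarrow> nat \<Rightarrow> (real^'n \<Rightarrow> real) \<Rightarrow>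
      real^'n \<Rightarrow> 'n::finite list \<Rightarrow> real" where
  "sobolev_nabla B g k p j u = (SOME T. has_sobolev_nabla B g k p j u T)"


section \<open>Spherically symmetric manifolds\<close>

definition eball0 :: "ereal \<Rightarrow> (real^'n::finite) set" where
  "eball0 R = {x. ereal (norm x) < R}"

definition warping_function :: "ereal \<Rightarrow> (real \<Rightarrow> real) \<Rightarrow> bool" where
  "warping_function R \<phi> \<longleftrightarrow> (let S = {t. 0 \<le> t \<and> ereal t < R} in
     \<phi> \<in> C_infinity1 S \<and> (\<forall>t\<in>S. \<phi> t \<ge> 0) \<and> (\<forall>t\<in>einterval 0 R. \<phi> t > 0) \<and>
     nth_deriv S 1 \<phi> 0 = 1 \<and> (\<forall>i. even i \<longrightarrow> nth_deriv S i \<phi> 0 = 0))"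

(* Cartesian components of dr^2 + phi(r)^2 (standard metric of the sphere), where r = norm x,
   theta = sgn x = x / norm x, and the metric of the sphere is the restriction of the Euclidean
   inner product.  For a warping function the value at 0 is the one that extends the metric
   smoothly. *)
definition warped_metric :: "(real \<Rightarrow> real) \<Rightarrow> real^'n::finite \<Rightarrow> real^'n^'n" where
  "warped_metric \<phi> x = (if x = 0 then mat 1 else
     (let dr = frechet_derivative norm (at x); d\<theta> = frechet_derivative sgn (at x) in
       \<chi> i l. dr (axis i 1) * dr (axis l 1)
         + (\<phi> (norm x))\<^sup>2 * (d\<theta> (axis i 1) \<bullet> d\<theta> (axis l 1))))"

definition radial_representation ::
    "ereal \<Rightarrow> (real^'n::finite \<Rightarrow> real) \<Rightarrow> (real \<Rightarrow> real) \<Rightarrow> bool" where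
  "radial_representation R u v \<longleftrightarrow> (\<forall>x\<in>eball0 R. x \<noteq> 0 \<longrightarrow> u x = v (norm x))"

definition radial_sobolev_space ::
    "ereal \<Rightarrow> (real \<Rightarrow> real) \<Rightarrow> nat \<Rightarrow> real \<Rightarrow> (real^'n::finite \<Rightarrow> real) set" where
  "radial_sobolev_space R \<phi> k p =
     {u \<in> sobolev_space (eball0 R) (warped_metric \<phi>) k p. \<exists>v. radial_representation R u v}"


section \<open>Weighted Sobolev spaces on \<open>(0, R)\<close>\<close>

definition test_functions :: "ereal \<Rightarrow> (real \<Rightarrow> real) set" where
  "test_functions R = {\<psi> \<in> C_infinity1 UNIV.
     compact (closure {t. \<psi> t \<noteq> 0}) \<and> closure {t. \<psi> t \<noteq> 0} \<subseteq> einterval 0 R}"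

definition locally_integrable :: "ereal \<Rightarrow> (real \<Rightarrow> real) \<Rightarrow> bool" where
  "locally_integrable R v \<longleftrightarrow>
     (\<forall>K. compact K \<and> K \<subseteq> einterval 0 R \<longrightarrow> set_integrable lebesgue K v)"

definition has_weak_deriv :: "ereal \<Rightarrow> nat \<Rightarrow> (real \<Rightarrow> real) \<Rightarrow> (real \<Rightarrow> real) \<Rightarrow> bool" where
  "has_weak_deriv R j v w \<longleftrightarrow> locally_integrable R v \<and> locally_integrable R w \<and>
     (\<forall>\<psi>\<in>test_functions R.
        (LINT t|lebesgue_on (einterval 0 R). v t * nth_deriv UNIV j \<psi> t)
          = (-1) ^ j * (LINT t|lebesgue_on (einterval 0 R). w t * \<psi> t))"

(* Unique up to a null set. *)
definition weak_deriv :: "ereal \<Rightarrow> nat \<Rightarrow> (real \<Rightarrow> real) \<Rightarrow> real \<Rightarrow> real" where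
  "weak_deriv R j v = (SOME w. has_weak_deriv R j v w)"

definition weighted_sobolev_space ::
    "ereal \<Rightarrow> (real \<Rightarrow> real) \<Rightarrow> nat \<Rightarrow> real \<Rightarrow> (real \<Rightarrow> real) set" where
  "weighted_sobolev_space R \<rho> k p = {v. \<forall>j\<le>k. \<exists>w. has_weak_deriv R j v w \<and>
     integrable (lebesgue_on (einterval 0 R)) (\<lambda>t. \<bar>w t\<bar> powr p * \<rho> t)}"

end

(* Rays are geodesics.  Hence, for smooth U, the j-th derivative of U along the ray through x is the
   radial component of its j-th covariant derivative at x, that is its value at j copies of x / |x|,
   and it is dominated by the length of that tensor.  If smooth U_n approximate u and their j-th
   covariant derivatives converge to T in L^p, then on almost every ray, along a subsequence,
   U_n tends to v and its j-th radial derivative tends to the radial component of T, in L^p with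
   weight phi^(N-1).  So this component is the weak j-th derivative of v, on almost every ray.

   Instead of polar coordinates, integrals are averaged over the dilates of an annulus, which takes
   only scaling and Fubini's theorem.  The origin is a null set, so the behaviour of the metric
   there is irrelevant. *)

theory Submission
  imports Defs
begin

section \<open>Integration along rays\<close>

text \<open>The approximants \<open>U n\<close> need not be radial. Convergence is therefore found
  on almost every ray only, and the weak derivative obtained there could a priori differ from ray to
  ray. Uniqueness of weak derivatives removes this dependence; it requires bump functions among the
  \<open>test_functions\<close>. Both \<open>sobolev_nabla\<close> and \<open>weak_deriv\<close> are
  choices, which say something only once existence is known. Hence completeness of the L^p spaces of
  tensor fields is proved, and the approximating sequence behind the chosen tensor may be a
  different one for each order j. Statements on rays are glued to statements at almost every x by
  Fubini. This needs Borel representatives, because a Lebesgue measurable set may meet a line in a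
  nonmeasurable set. Averaging over the whole space would produce the divergent integral of ds / s
  over (0, \<infinity>); over an annulus with radii 1/b and b it is finite. The pointwise estimate
  rests on one algebraic fact: the matrix of the metric at x fixes x, and so does the square root of
  its inverse.\<close>

lemma nn_integral_scaleR:
  fixes f :: "'a::euclidean_space \<Rightarrow> ennreal"
  assumes [measurable]: "f \<in> borel_measurable borel" and "c > 0"
  shows "(\<integral>\<^sup>+x. f x \<partial>lborel) = ennreal (c ^ DIM('a)) * (\<integral>\<^sup>+x. f (c *\<^sub>R x) \<partial>lborel)"
  using \<open>c > 0\<close>
  by (subst lborel_affine[of c 0])
     (simp_all add: nn_integral_density nn_integral_distr nn_integral_cmult)

text \<open>The polar integral along the ray through x in the parameter s = r / |x|. In this form x
  enters through dilations alone, so Fubini and scaling apply when it is integrated over x.\<close>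

abbreviation dilation_integral :: "('a::euclidean_space \<Rightarrow> ennreal) \<Rightarrow> 'a \<Rightarrow> ennreal" where
  "dilation_integral F x \<equiv> \<integral>\<^sup>+s. ennreal (s ^ (DIM('a) - 1)) * F (s *\<^sub>R x) * indicator {0<..} s \<partial>lborel"

abbreviation ray_integral :: "real measure \<Rightarrow> ('a::euclidean_space \<Rightarrow> ennreal) \<Rightarrow> 'a \<Rightarrow> ennreal" where
  "ray_integral M F x \<equiv> \<integral>\<^sup>+r. ennreal (r ^ (DIM('a) - 1)) * F (r *\<^sub>R sgn x) * indicator {0<..} r \<partial>M"

text \<open>Substitution r = |x| s: one power of |x| comes from dr, the other N - 1 from the weight.
  As the factor is positive and finite, finiteness and vanishing can be checked on either
  side.\<close>

lemma nn_integral_along_ray: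
  fixes F :: "'a::euclidean_space \<Rightarrow> ennreal"
  assumes [measurable]: "F \<in> borel_measurable borel" and "x \<noteq> 0"
  shows "ray_integral lborel F x =
    ennreal (norm x ^ DIM('a)) *
      dilation_integral F x"
    (is "?L = ?c * ?R")
proof -
  have nx: "norm x > 0" using assms by simp
  have N: "norm x ^ DIM('a) = norm x * norm x ^ (DIM('a) - 1)"
    by (metis DIM_positive power_eq_if neq0_conv)
  have "?L = ennreal (norm x) * (\<integral>\<^sup>+s. ennreal ((norm x * s) ^ (DIM('a) - 1))
      * F ((norm x * s) *\<^sub>R sgn x) * indicator {0<..} (norm x * s) \<partial>lborel)"
    using nn_integral_real_affine[where c="norm x" and t=0 and
        f="\<lambda>r. ennreal (r ^ (DIM('a) - 1)) * F (r *\<^sub>R sgn x) * indicator {0<..} r"] nx by simp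
  also have "(\<integral>\<^sup>+s. ennreal ((norm x * s) ^ (DIM('a) - 1)) * F ((norm x * s) *\<^sub>R sgn x)
       * indicator {0<..} (norm x * s) \<partial>lborel)
     = (\<integral>\<^sup>+s. ennreal (norm x ^ (DIM('a) - 1)) * (ennreal (s ^ (DIM('a) - 1)) * F (s *\<^sub>R x)
       * indicator {0<..} s) \<partial>lborel)"
    using nx by (intro nn_integral_cong)
      (auto simp: indicator_def sgn_div_norm power_mult_distrib ennreal_mult zero_less_mult_iff mult.assoc field_simps)
  also have "\<dots> = ennreal (norm x ^ (DIM('a) - 1)) * ?R"
    by (rule nn_integral_cmult) simp
  finally show ?thesis
    using nx by (simp add: N ennreal_mult mult.assoc)
qed

text \<open>After Fubini and the substitution y = s x, the point y is weighted by the integral of 1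
  / s over those s > 0 for which y / s lies in the annulus. For y \<noteq> 0 this is 2 log b; the
  cruder bound b^2 suffices.\<close>

lemma nn_integral_rays_annulus_le:
  fixes F :: "'a::euclidean_space \<Rightarrow> ennreal"
  assumes F[measurable]: "F \<in> borel_measurable borel" and b: "b > 1"
  shows "(\<integral>\<^sup>+x. indicator {x. 1/b \<le> norm x \<and> norm x \<le> b} x *
      dilation_integral F x \<partial>lborel)
    \<le> ennreal (b\<^sup>2) * (\<integral>\<^sup>+x. F x \<partial>lborel)"
proof -
  define A where "A = {x::'a. 1/b \<le> norm x \<and> norm x \<le> b}"
  have [measurable]: "A \<in> sets borel" unfolding A_def by measurable
  let ?N = "DIM('a)"
  have N: "s ^ ?N = s * s ^ (?N - 1)" for s :: real
    by (metis DIM_positive power_eq_if neq0_conv)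
  have "(\<integral>\<^sup>+x. indicator A x * (\<integral>\<^sup>+s. ennreal (s ^ (?N - 1)) * F (s *\<^sub>R x) * indicator {0<..} s \<partial>lborel) \<partial>lborel)
     = (\<integral>\<^sup>+x. (\<integral>\<^sup>+s. indicator A x * (ennreal (s ^ (?N - 1)) * F (s *\<^sub>R x) * indicator {0<..} s) \<partial>lborel) \<partial>lborel)"
    by (simp add: nn_integral_cmult)
  also have "\<dots> = (\<integral>\<^sup>+s. (\<integral>\<^sup>+x. indicator A x * (ennreal (s ^ (?N - 1)) * F (s *\<^sub>R x) * indicator {0<..} s) \<partial>lborel) \<partial>lborel)"
    by (rule lborel_pair.Fubini') measurable
  also have "\<dots> = (\<integral>\<^sup>+s. (\<integral>\<^sup>+y. ennreal (1/s) * indicator {0<..} s * indicator A ((1/s) *\<^sub>R y) * F y \<partial>lborel) \<partial>lborel)"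
  proof (rule nn_integral_cong)
    fix s :: real
    show "(\<integral>\<^sup>+x. indicator A x * (ennreal (s ^ (?N - 1)) * F (s *\<^sub>R x) * indicator {0<..} s) \<partial>lborel)
      = (\<integral>\<^sup>+y. ennreal (1/s) * indicator {0<..} s * indicator A ((1/s) *\<^sub>R y) * F y \<partial>lborel)"
    proof (cases "s > 0")
      case True
      have "(\<integral>\<^sup>+y. ennreal (1/s) * indicator {0<..} s * indicator A ((1/s) *\<^sub>R y) * F y \<partial>lborel)
         = ennreal (s ^ ?N) * (\<integral>\<^sup>+x. ennreal (1/s) * indicator A x * F (s *\<^sub>R x) \<partial>lborel)"
        using True by (subst nn_integral_scaleR[of _ s]) auto
      also have "\<dots> = (\<integral>\<^sup>+x. ennreal (s ^ ?N) * (ennreal (1/s) * indicator A x * F (s *\<^sub>R x)) \<partial>lborel)"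
        by (rule nn_integral_cmult[symmetric]) simp
      also have "\<dots> = (\<integral>\<^sup>+x. indicator A x * (ennreal (s ^ (?N - 1)) * F (s *\<^sub>R x)) \<partial>lborel)"
      proof (rule nn_integral_cong)
        fix x
        have "ennreal (s ^ ?N) * ennreal (1/s) = ennreal (s ^ (?N - 1))"
          using True by (simp add: N flip: ennreal_mult)
        then show "ennreal (s ^ ?N) * (ennreal (1/s) * indicator A x * F (s *\<^sub>R x))
          = indicator A x * (ennreal (s ^ (?N - 1)) * F (s *\<^sub>R x))"
          by (metis mult.assoc mult.commute)
      qed
      finally show ?thesis using True by simp
    qed simp
  qed
  also have "\<dots> = (\<integral>\<^sup>+y. (\<integral>\<^sup>+s. ennreal (1/s) * indicator {0<..} s * indicator A ((1/s) *\<^sub>R y) * F y \<partial>lborel) \<partial>lborel)"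
    by (rule lborel_pair.Fubini'[symmetric]) measurable
  also have "\<dots> \<le> (\<integral>\<^sup>+y. ennreal (b\<^sup>2) * F y \<partial>lborel)"
  proof (rule nn_integral_mono)
    fix y :: 'a
    have "(\<integral>\<^sup>+s. ennreal (1/s) * indicator {0<..} s * indicator A ((1/s) *\<^sub>R y) * F y \<partial>lborel)
      = (\<integral>\<^sup>+s. ennreal (1/s) * indicator {0<..} s * indicator A ((1/s) *\<^sub>R y) \<partial>lborel) * F y"
      by (rule nn_integral_multc) measurable
    also have "(\<integral>\<^sup>+s. ennreal (1/s) * indicator {0<..} s * indicator A ((1/s) *\<^sub>R y) \<partial>lborel) \<le> ennreal (b\<^sup>2)"
    proof (cases "y = 0")
      case True
      then have "indicator A ((1/s) *\<^sub>R y) = (0::ennreal)" for s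
        using b by (auto simp: A_def indicator_def)
      then show ?thesis by simp
    next
      case False
      then have ny: "norm y > 0" by simp
      have "(\<integral>\<^sup>+s. ennreal (1/s) * indicator {0<..} s * indicator A ((1/s) *\<^sub>R y) \<partial>lborel)
        \<le> (\<integral>\<^sup>+s. ennreal (b / norm y) * indicator {0..b * norm y} s \<partial>lborel)"
      proof (rule nn_integral_mono)
        fix s :: real
        show "ennreal (1/s) * indicator {0<..} s * indicator A ((1/s) *\<^sub>R y)
          \<le> ennreal (b / norm y) * indicator {0..b * norm y} s"
        proof (cases "s > 0 \<and> (1/s) *\<^sub>R y \<in> A")
          case True
          \<comment> \<open>The admissible s lie in [|y| / b, b |y|]. Hence 1 / s is at most b /
            |y|, on an interval of length at most b |y|, and the product of the two is b^2.\<close>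
          then have "1/b \<le> norm y / s" "norm y / s \<le> b" by (auto simp: A_def)
          then have "s \<le> b * norm y" "1/s \<le> b / norm y" using True b ny by (auto simp: field_simps)
          then show ?thesis using True by (auto simp: indicator_def intro!: ennreal_leI)
        qed (auto simp: indicator_def)
      qed
      also have "\<dots> = ennreal (b / norm y) * ennreal (b * norm y)"
        using b ny by (simp add: nn_integral_cmult_indicator)
      also have "\<dots> = ennreal (b\<^sup>2)"
        using b ny by (simp add: power2_eq_square flip: ennreal_mult)
      finally show ?thesis .
    qed
    finally show "(\<integral>\<^sup>+s. ennreal (1/s) * indicator {0<..} s * indicator A ((1/s) *\<^sub>R y) * F y \<partial>lborel)
      \<le> ennreal (b\<^sup>2) * F y" by (simp add: mult_right_mono)
  qed
  also have "\<dots> = ennreal (b\<^sup>2) * (\<integral>\<^sup>+y. F y \<partial>lborel)"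
    by (rule nn_integral_cmult) simp
  finally show ?thesis by (simp add: A_def)
qed

text \<open>Countably many annuli cover everything except the origin, which is a null set.\<close>

lemma AE_all_annuli:
  fixes P :: "'a::euclidean_space \<Rightarrow> bool"
  assumes "\<And>b. b > 1 \<Longrightarrow> AE x in lborel. 1/b \<le> norm x \<and> norm x \<le> b \<longrightarrow> P x"
  shows "AE x in lborel. P x"
proof -
  have "AE x in lborel. \<forall>n. 1/(2 + real n) \<le> norm x \<and> norm x \<le> 2 + real n \<longrightarrow> P x"
    unfolding AE_all_countable by (intro allI assms) simp
  moreover have "AE x::'a in lborel. x \<noteq> 0"
    by (rule AE_lborel_singleton)
  ultimately show ?thesis
  proof eventually_elim
    case (elim x)
    obtain n where "max (norm x) (1 / norm x) < real n"
      using reals_Archimedean2 by blast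
    then have "norm x \<le> 2 + real n" "1 / norm x \<le> 2 + real n" by auto
    moreover from this(2) have "1/(2 + real n) \<le> norm x" using elim(2)
      by (simp add: field_simps)
    ultimately show ?case using elim(1) by blast
  qed
qed

lemma AE_ray_nn_integral_finite:
  fixes F :: "'a::euclidean_space \<Rightarrow> ennreal"
  assumes F[measurable]: "F \<in> borel_measurable borel" and fin: "(\<integral>\<^sup>+x. F x \<partial>lborel) < \<infinity>"
  shows "AE x in lborel.
    ray_integral lborel F x < \<infinity>"
proof (rule AE_all_annuli)
  fix b :: real assume b: "b > 1"
  have "AE x in lborel. indicator {x. 1/b \<le> norm x \<and> norm x \<le> b} x * dilation_integral F x \<noteq> \<infinity>"
    using nn_integral_rays_annulus_le[OF F b] fin
    by (intro nn_integral_noteq_infinite) (auto simp: top_unique ennreal_mult_eq_top_iff)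
  moreover have "AE x::'a in lborel. x \<noteq> 0"
    by (rule AE_lborel_singleton)
  ultimately show "AE x in lborel. 1/b \<le> norm x \<and> norm x \<le> b \<longrightarrow>
    ray_integral lborel F x < \<infinity>"
  proof eventually_elim
    case (elim x)
    show ?case
    proof
      assume "1/b \<le> norm x \<and> norm x \<le> b"
      then have "dilation_integral F x < \<infinity>" using elim(1) by (simp add: less_top del: One_nat_def)
      then show "ray_integral lborel F x < \<infinity>"
        unfolding nn_integral_along_ray[OF F elim(2)] by (simp add: ennreal_mult_less_top del: One_nat_def)
    qed
  qed
qed

text \<open>For the indicator F of the exceptional set, Fubini and scaling show that the integral of
  \<open>dilation_integral F\<close> is the integral of ds / s over (0, \<infinity>) times the
  integral of F. The first factor is infinite, but what matters is that it is not 0, since 0 times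
  infinity is 0 in \<open>ennreal\<close>. Read from left to right the lemma glues statements on
  rays; read from right to left it restricts a null set to rays.\<close>

lemma AE_ray_iff:
  fixes P :: "'a::euclidean_space \<Rightarrow> bool"
  assumes P[measurable]: "{x. P x} \<in> sets borel"
  shows "(AE x in lborel. AE r in lborel. r > 0 \<longrightarrow> P (r *\<^sub>R sgn x)) \<longleftrightarrow> (AE x in lborel. P x)"
proof -
  define F :: "'a \<Rightarrow> ennreal" where "F = indicator {x. \<not> P x}"
  have [measurable]: "Measurable.pred borel P" using P by (simp add: pred_def)
  have F[measurable]: "F \<in> borel_measurable borel" unfolding F_def by measurable
  have 1: "(AE r in lborel. r > 0 \<longrightarrow> P (r *\<^sub>R sgn x)) \<longleftrightarrow> dilation_integral F x = 0" if "x \<noteq> 0" for x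
  proof -
    have "dilation_integral F x = 0 \<longleftrightarrow>
      ray_integral lborel F x = 0"
      using that by (subst nn_integral_along_ray) auto
    also have "\<dots> \<longleftrightarrow> (AE r in lborel. ennreal (r ^ (DIM('a) - 1)) * F (r *\<^sub>R sgn x) * indicator {0<..} r = 0)"
      by (subst nn_integral_0_iff_AE) measurable
    also have "\<dots> \<longleftrightarrow> (AE r in lborel. r > 0 \<longrightarrow> P (r *\<^sub>R sgn x))"
      by (rule AE_cong) (auto simp: F_def indicator_def)
    finally show ?thesis by simp
  qed
  have "AE x::'a in lborel. x \<noteq> 0" by (rule AE_lborel_singleton)
  then have "AE x in lborel. (AE r in lborel. r > 0 \<longrightarrow> P (r *\<^sub>R sgn x)) \<longleftrightarrow> dilation_integral F x = 0"
    by eventually_elim (rule 1)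
  then have "(AE x in lborel. AE r in lborel. r > 0 \<longrightarrow> P (r *\<^sub>R sgn x)) \<longleftrightarrow> (AE x in lborel. dilation_integral F x = 0)"
    by (auto elim: AE_mp)
  also have "\<dots> \<longleftrightarrow> (\<integral>\<^sup>+x. dilation_integral F x \<partial>lborel) = 0"
    by (subst nn_integral_0_iff_AE) measurable
  also have "(\<integral>\<^sup>+x. dilation_integral F x \<partial>lborel) = (\<integral>\<^sup>+s. (\<integral>\<^sup>+x. ennreal (s ^ (DIM('a) - 1)) * F (s *\<^sub>R x) * indicator {0<..} s \<partial>lborel) \<partial>lborel)"
    by (rule lborel_pair.Fubini') measurable
  also have "\<dots> = (\<integral>\<^sup>+s. ennreal (1/s) * indicator {0<..} s * (\<integral>\<^sup>+x. F x \<partial>lborel) \<partial>lborel)"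
  proof (rule nn_integral_cong)
    fix s :: real
    show "(\<integral>\<^sup>+x. ennreal (s ^ (DIM('a) - 1)) * F (s *\<^sub>R x) * indicator {0<..} s \<partial>lborel)
       = ennreal (1/s) * indicator {0<..} s * (\<integral>\<^sup>+x. F x \<partial>lborel)"
    proof (cases "s > 0")
      case True
      have N: "s ^ DIM('a) = s * s ^ (DIM('a) - 1)"
        by (metis DIM_positive power_eq_if neq0_conv)
      have "ennreal (1/s) * (\<integral>\<^sup>+x. F x \<partial>lborel)
        = ennreal (1/s) * ennreal (s ^ DIM('a)) * (\<integral>\<^sup>+x. F (s *\<^sub>R x) \<partial>lborel)"
        using True by (subst nn_integral_scaleR[of _ s]) (auto simp: mult.assoc)
      also have "ennreal (1/s) * ennreal (s ^ DIM('a)) = ennreal (s ^ (DIM('a) - 1))"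
        using True by (simp add: N flip: ennreal_mult)
      finally show ?thesis using True by (simp add: nn_integral_cmult)
    qed simp
  qed
  also have "\<dots> = (\<integral>\<^sup>+s. ennreal (1/s) * indicator {0<..} s \<partial>lborel) * (\<integral>\<^sup>+x. F x \<partial>lborel)"
    by (rule nn_integral_multc) measurable
  also have "\<dots> = 0 \<longleftrightarrow> (\<integral>\<^sup>+x. F x \<partial>lborel) = 0"
  proof -
    have "(\<integral>\<^sup>+s. ennreal (1/s) * indicator {0<..} (s::real) \<partial>lborel) \<ge> (\<integral>\<^sup>+s. indicator {0<..1::real} s \<partial>lborel)"
      by (rule nn_integral_mono) (auto simp: indicator_def ennreal_ge_1 field_simps)
    then have "(\<integral>\<^sup>+s. ennreal (1/s) * indicator {0<..} (s::real) \<partial>lborel) \<noteq> 0" by auto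
    then show ?thesis by simp
  qed
  also have "\<dots> \<longleftrightarrow> (AE x in lborel. F x = 0)"
    by (subst nn_integral_0_iff_AE) measurable
  also have "\<dots> \<longleftrightarrow> (AE x in lborel. P x)"
    by (rule AE_cong) (auto simp: F_def indicator_def)
  finally show ?thesis .
qed

text \<open>Here P may be any property: its exceptional set is enlarged to a Borel null set before
  \<open>AE_ray_iff\<close> is applied.\<close>

lemma AE_ray:
  fixes P :: "'a::euclidean_space \<Rightarrow> bool"
  assumes "AE x in lebesgue. P x"
  shows "AE x in lborel. AE r in lborel. r > 0 \<longrightarrow> P (r *\<^sub>R sgn x)"
proof -
  have "AE x in lborel. P x" using assms by (simp add: AE_completion_iff)
  then obtain Z where Z: "{x. \<not> P x} \<subseteq> Z" "Z \<in> null_sets lborel"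
    by (auto simp: eventually_ae_filter)
  have "AE x in lborel. x \<notin> Z" using Z by (rule_tac AE_not_in)
  then have "AE x in lborel. AE r in lborel. r > 0 \<longrightarrow> r *\<^sub>R sgn x \<notin> Z"
    using Z by (subst AE_ray_iff) auto
  then show ?thesis
  proof eventually_elim
    case (elim x)
    then show ?case by eventually_elim (use Z(1) in auto)
  qed
qed

lemma ex_borel_AE_lebesgue:
  fixes f :: "'a::euclidean_space \<Rightarrow> real"
  assumes "f \<in> borel_measurable lebesgue"
  obtains f' where "f' \<in> borel_measurable borel" "AE x in lebesgue. f x = f' x"
  using completion_ex_borel_measurable_real[of f lborel] assms by (auto simp: AE_completion_iff)

text \<open>Preimages under the two functions differ within a null set, and the Lebesgue measure is
  complete.\<close>

lemma borel_measurable_lebesgue_cong_AE: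
  fixes f g :: "'a::euclidean_space \<Rightarrow> 'b::topological_space"
  assumes f: "f \<in> borel_measurable lebesgue" and eq: "AE x in lebesgue. f x = g x"
  shows "g \<in> borel_measurable lebesgue"
proof (rule measurableI)
  fix A :: "'b set" assume "A \<in> sets borel"
  then have A: "f -` A \<in> sets lebesgue" using measurable_sets[OF f] by simp
  have "g -` A \<in> sets lebesgue"
    by (rule completion.in_sets_AE[OF _ A])
       (use eq in auto)
  then show "g -` A \<inter> space lebesgue \<in> sets lebesgue" by simp
qed simp

text \<open>On a particular line a Lebesgue measurable function can fail to be measurable. On almost
  every ray, however, it agrees almost everywhere with the restriction of a Borel
  representative.\<close>

lemma AE_ray_borel_measurable:
  fixes f :: "'a::euclidean_space \<Rightarrow> real"
  assumes "f \<in> borel_measurable lebesgue"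
  shows "AE x in lborel. (\<lambda>r. indicator {0<..} r * f (r *\<^sub>R sgn x)) \<in> borel_measurable lebesgue"
proof -
  obtain f' where f'[measurable]: "f' \<in> borel_measurable borel" and eq: "AE x in lebesgue. f x = f' x"
    using ex_borel_AE_lebesgue[OF assms] by blast
  from AE_ray[OF eq] show ?thesis
  proof eventually_elim
    case (elim x)
    have "AE r in lebesgue. indicator {0<..} r * f' (r *\<^sub>R sgn x) = indicator {0<..} r * f (r *\<^sub>R sgn x)"
      using AE_completion[OF elim] by eventually_elim (auto simp: indicator_def)
    moreover have "(\<lambda>r. indicator {0<..} r * f' (r *\<^sub>R sgn x)) \<in> borel_measurable lebesgue"
      by (rule measurable_completion) measurable
    ultimately show ?case
      by (rule borel_measurable_lebesgue_cong_AE[rotated])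
  qed
qed

section \<open>Weak derivatives on an interval\<close>

lemma nth_deriv_0 [simp]: "nth_deriv S 0 f = f"
  by (simp add: nth_deriv_def)

lemma nth_deriv_Suc: "nth_deriv S (Suc n) f t = vector_derivative (nth_deriv S n f) (at t within S)"
  by (simp add: nth_deriv_def)

lemma has_real_derivative_nth_deriv:
  assumes "f \<in> C_infinity1 S" "t \<in> interior S"
  shows "(nth_deriv S n f has_real_derivative nth_deriv S (Suc n) f t) (at t)"
proof -
  have "t \<in> S" using assms(2) interior_subset by auto
  then have "nth_deriv S n f differentiable (at t within S)"
    using assms(1) by (auto simp: C_infinity1_def)
  then show ?thesis
    using at_within_interior[OF assms(2)]
    by (simp add: nth_deriv_Suc has_real_derivative_iff_has_vector_derivative vector_derivative_works)
qed

text \<open>Smoothness is reduced to a family of functions closed under differentiation, so that no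
  higher derivative has to be computed.\<close>

lemma C_infinity1_UNIV_I:
  assumes "f \<in> \<F>"
    and "\<And>h. h \<in> \<F> \<Longrightarrow> \<exists>h'\<in>\<F>. \<forall>t. (h has_real_derivative h' t) (at t)"
  shows "f \<in> C_infinity1 UNIV"
proof -
  have "nth_deriv UNIV n f \<in> \<F>" for n
  proof (induction n)
    case (Suc n)
    from assms(2)[OF this] obtain h' where h': "h' \<in> \<F>"
      "\<And>t. (nth_deriv UNIV n f has_real_derivative h' t) (at t)" by blast
    have "nth_deriv UNIV (Suc n) f = h'"
    proof
      fix t
      show "nth_deriv UNIV (Suc n) f t = h' t"
        using h'(2)[of t] vector_derivative_at
        by (simp add: nth_deriv_Suc has_real_derivative_iff_has_vector_derivative)
    qed
    with h' show ?case by simp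
  qed (simp add: assms)
  then have "\<exists>D. (nth_deriv UNIV n f has_real_derivative D) (at t)" for n t
    using assms(2) by blast
  then show ?thesis
    by (auto simp: C_infinity1_def real_differentiable_def)
qed

text \<open>A family that contains bump functions and is closed under differentiation.\<close>

definition bump_family :: "real \<Rightarrow> real \<Rightarrow> real \<Rightarrow> nat \<Rightarrow> real poly \<Rightarrow> real \<Rightarrow> real" where
  "bump_family m a b k P t = (if a < t \<and> t < b
     then poly P t / ((t - a) * (b - t)) ^ k * exp (- (1 / (m * ((t - a) * (b - t))))) else 0)"

text \<open>Take reciprocals in (1 + x / k)^k \<le> exp x, for x = 1 / y and k = n + 1. Thus the
  exponential beats any power of y near 0.\<close>

lemma exp_minus_inverse_le_power:
  assumes "y > 0"
  shows "exp (- (1 / y)) \<le> (real (Suc n) * y) ^ Suc n"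
proof -
  have "(1 / (real (Suc n) * y)) ^ Suc n \<le> (1 + (1 / y) / of_nat (Suc n)) ^ Suc n"
    using assms by (intro power_mono) (auto simp: field_simps)
  also have "\<dots> \<le> exp (1 / y)"
    using assms by (intro exp_ge_one_plus_x_over_n_power_n) (auto simp: field_simps intro: order_trans[of _ 0])
  finally have "1 / (real (Suc n) * y) ^ Suc n \<le> exp (1 / y)"
    by (simp add: power_one_over)
  then have "1 / exp (1 / y) \<le> (real (Suc n) * y) ^ Suc n"
    using assms zero_less_power[of "real (Suc n) * y" "Suc n"] by (simp add: divide_le_eq le_divide_eq mult.commute del: power_Suc of_nat_Suc)
  then show ?thesis by (simp add: exp_minus divide_inverse)
qed

lemma continuous_on_Icc_bounded:
  fixes f :: "real \<Rightarrow> real"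
  assumes "continuous_on {a..b} f"
  obtains B where "\<And>t. t \<in> {a..b} \<Longrightarrow> \<bar>f t\<bar> \<le> B"
proof -
  have "bounded (f ` {a..b})"
    by (intro compact_imp_bounded compact_continuous_image assms) simp
  then obtain B where "\<forall>y\<in>f ` {a..b}. norm y \<le> B" by (auto simp: bounded_iff)
  then show ?thesis by (intro that[of B]) auto
qed

text \<open>The point c may be an end point or lie further outside, so one bound serves all points
  where the derivative is to be 0. With q = (t - a)(b - t), the exponential yields k + 2 powers of
  q; k of them cancel the denominator, the other two give the square, as q \<le> (b - a) |t -
  c|.\<close>

lemma bump_family_quadratic_bound:
  assumes "m > 0"
  obtains C where "\<And>c t. \<not> (a < c \<and> c < b) \<Longrightarrow> \<bar>bump_family m a b k P t\<bar> \<le> C * (t - c)\<^sup>2"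
proof -
  obtain B where B: "\<And>t. t \<in> {a..b} \<Longrightarrow> \<bar>poly P t\<bar> \<le> B"
    using continuous_on_Icc_bounded[OF continuous_on_poly[OF continuous_on_id]] by blast
  define K where "K = (real (Suc (Suc k)) * m) ^ Suc (Suc k)"
  have K: "K \<ge> 0" using assms by (simp add: K_def)
  show ?thesis
  proof
    fix c t assume c: "\<not> (a < c \<and> c < b)"
    show "\<bar>bump_family m a b k P t\<bar> \<le> (\<bar>B\<bar> * K * (b - a)\<^sup>2) * (t - c)\<^sup>2"
    proof (cases "a < t \<and> t < b")
      case True
      define q where "q = (t - a) * (b - t)"
      have q: "q > 0" using True by (simp add: q_def)
      have "exp (- (1 / (m * q))) \<le> (real (Suc (Suc k)) * (m * q)) ^ Suc (Suc k)"
        using q assms by (intro exp_minus_inverse_le_power) simp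
      also have "\<dots> = K * q\<^sup>2 * q ^ k"
        unfolding K_def power_mult_distrib power_Suc power2_eq_square by (simp only: ac_simps)
      finally have e: "exp (- (1 / (m * q))) \<le> K * q\<^sup>2 * q ^ k" .
      \<comment> \<open>The factor of q that vanishes at the end point on the side of c is at most
        |t - c|, the other one at most b - a.\<close>
      have "q \<le> (b - a) * \<bar>t - c\<bar>"
      proof (cases "c \<le> a")
        case True
        with \<open>a < t \<and> t < b\<close> have "q \<le> \<bar>t - c\<bar> * (b - a)" unfolding q_def
          by (intro mult_mono) auto
        then show ?thesis by (simp add: mult.commute)
      next
        case False
        with c \<open>a < t \<and> t < b\<close> show ?thesis unfolding q_def by (intro mult_mono) auto
      qed
      then have "q\<^sup>2 \<le> ((b - a) * \<bar>t - c\<bar>)\<^sup>2" using q by (intro power_mono) auto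
      then have q2: "q\<^sup>2 \<le> (b - a)\<^sup>2 * (t - c)\<^sup>2" by (simp add: power_mult_distrib)
      have "\<bar>bump_family m a b k P t\<bar> = \<bar>poly P t\<bar> / q ^ k * exp (- (1 / (m * q)))"
        using True q by (simp add: bump_family_def q_def[symmetric] abs_mult)
      also have "\<dots> \<le> \<bar>B\<bar> / q ^ k * (K * q\<^sup>2 * q ^ k)"
        using q B[of t] True e K by (intro mult_mono divide_right_mono) auto
      also have "\<dots> = \<bar>B\<bar> * K * q\<^sup>2" using q by simp
      also have "\<dots> \<le> \<bar>B\<bar> * K * ((b - a)\<^sup>2 * (t - c)\<^sup>2)"
        using q2 K by (intro mult_left_mono) auto
      finally show ?thesis by (simp add: mult_ac)
    next
      case False
      then have "bump_family m a b k P t = 0" by (auto simp: bump_family_def)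
      then show ?thesis using K by simp
    qed
  qed
qed

lemma has_real_derivative_zero_quadratic:
  fixes h :: "real \<Rightarrow> real"
  assumes "h c = 0" "\<And>t. \<bar>h t\<bar> \<le> C * (t - c)\<^sup>2"
  shows "(h has_real_derivative 0) (at c)"
proof -
  have "((\<lambda>t. \<bar>C\<bar> * \<bar>t - c\<bar>) \<longlongrightarrow> \<bar>C\<bar> * \<bar>c - c\<bar>) (at c)" by (intro tendsto_intros)
  then have "((\<lambda>t. \<bar>C\<bar> * \<bar>t - c\<bar>) \<longlongrightarrow> 0) (at c)" by simp
  moreover have "\<forall>\<^sub>F t in at c. norm ((h t - h c) / (t - c)) \<le> \<bar>C\<bar> * \<bar>t - c\<bar>"
  proof (rule eventuallyI)
    fix t
    have "\<bar>h t\<bar> \<le> \<bar>C\<bar> * (t - c)\<^sup>2"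
      using assms(2)[of t] by (rule order_trans) (intro mult_right_mono, auto)
    then show "norm ((h t - h c) / (t - c)) \<le> \<bar>C\<bar> * \<bar>t - c\<bar>"
      using assms(1) by (cases "t = c") (auto simp: field_simps power2_eq_square abs_mult)
  qed
  ultimately have "((\<lambda>t. (h t - h c) / (t - c)) \<longlongrightarrow> 0) (at c)"
    by (rule Lim_null_comparison[rotated])
  then show ?thesis by (simp add: has_field_derivative_iff)
qed

lemma has_real_derivative_bump_family:
  assumes "m > 0"
  shows "\<exists>k' P'. \<forall>t. (bump_family m a b k P has_real_derivative bump_family m a b k' P' t) (at t)"
proof -
  \<comment> \<open>\<open>Q\<close> is (t - a)(b - t) in expanded form, and \<open>P'\<close> is
    the numerator that the quotient rule and the derivative of the exponential leave over
    Q^(k+2).\<close>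
  define Q where "Q = [: - (a * b), a + b, -1 :]"
  define P' where "P' = pderiv P * Q\<^sup>2 - smult (of_nat k) (P * pderiv Q * Q) + smult (1 / m) (P * pderiv Q)"
  have "(bump_family m a b k P has_real_derivative bump_family m a b (k + 2) P' t) (at t)" for t
  proof (cases "a < t \<and> t < b")
    case True
    have Q: "poly Q s = (s - a) * (b - s)" for s by (simp add: Q_def algebra_simps)
    have q: "poly Q t > 0" using True by (simp add: Q)
    let ?E = "(poly (pderiv P) t * poly Q t ^ k - poly P t * (of_nat k * poly Q t ^ (k - 1) * poly (pderiv Q) t)) / (poly Q t ^ k)\<^sup>2
          * exp (- (1 / (m * poly Q t)))
      + poly P t / (poly Q t) ^ k * (exp (- (1 / (m * poly Q t))) * (m * poly (pderiv Q) t / (m * poly Q t)\<^sup>2))"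
    have "((\<lambda>t. poly P t / (poly Q t) ^ k * exp (- (1 / (m * poly Q t)))) has_real_derivative ?E) (at t)"
      using q assms by (auto intro!: derivative_eq_intros simp: power2_eq_square field_simps)
    also have "?E = poly P' t / (poly Q t) ^ (k + 2) * exp (- (1 / (m * poly Q t)))"
      using q assms by (cases k) (simp_all add: P'_def field_simps power2_eq_square)
    finally have "((\<lambda>t. poly P t / ((t - a) * (b - t)) ^ k * exp (- (1 / (m * ((t - a) * (b - t))))))
      has_real_derivative bump_family m a b (k + 2) P' t) (at t)"
      using True by (simp add: Q bump_family_def)
    then show ?thesis
      by (rule has_field_derivative_transform_within_open[of _ _ _ "{a<..<b}"])
         (use True in \<open>auto simp: bump_family_def\<close>)
  next
    case False
    obtain C where C: "\<And>c t. \<not> (a < c \<and> c < b) \<Longrightarrow> \<bar>bump_family m a b k P t\<bar> \<le> C * (t - c)\<^sup>2"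
      using bump_family_quadratic_bound[OF assms] by blast
    have "bump_family m a b k P t = 0" "bump_family m a b (k + 2) P' t = 0"
      using False by (auto simp: bump_family_def)
    then show ?thesis
      using has_real_derivative_zero_quadratic[OF _ C[OF False]] by simp
  qed
  then show ?thesis by blast
qed

lemma bump_family_smooth:
  assumes "m > 0"
  shows "bump_family m a b k P \<in> C_infinity1 UNIV"
proof (rule C_infinity1_UNIV_I)
  show "bump_family m a b k P \<in> range (\<lambda>(k, P). bump_family m a b k P)" by force
  fix h assume "h \<in> range (\<lambda>(k, P). bump_family m a b k P)"
  then show "\<exists>h'\<in>range (\<lambda>(k, P). bump_family m a b k P). \<forall>t. (h has_real_derivative h' t) (at t)"
    using has_real_derivative_bump_family[OF assms] by fastforce
qed

section \<open>Test functions and uniqueness of weak derivatives\<close>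

lemma Icc_subset_einterval: "0 < a \<Longrightarrow> ereal b < R \<Longrightarrow> {a..b} \<subseteq> einterval 0 R"
  by (auto simp: einterval_iff) (metis ereal_less_eq(3) le_less_trans)

lemma bump_test_function:
  assumes "m > 0" "0 < a" "a < b" "ereal b < R"
  shows "bump_family m a b 0 1 \<in> test_functions R"
proof -
  have "{t. bump_family m a b 0 1 t \<noteq> 0} = {a<..<b}"
    by (auto simp: bump_family_def)
  moreover have "{a..b} \<subseteq> einterval 0 R"
    using Icc_subset_einterval assms by blast
  ultimately show ?thesis
    using assms by (simp add: test_functions_def bump_family_smooth)
qed

text \<open>The positive and the negative part of a Borel representative of f are densities of two
  finite measures that agree on all half-lines (x, \<infinity>), hence everywhere. So the two parts
  coincide almost everywhere, and as one of them is 0 at each point, both vanish.\<close>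

lemma AE_zero_of_integrals_Ioc_zero:
  fixes f :: "real \<Rightarrow> real"
  assumes f: "integrable lebesgue f"
    and 0: "\<And>a b. A \<le> a \<Longrightarrow> a < b \<Longrightarrow> b \<le> B \<Longrightarrow> (LINT t|lebesgue. indicator {a<..b} t * f t) = 0"
    and out: "\<And>t. \<not> (A < t \<and> t \<le> B) \<Longrightarrow> f t = 0"
  shows "AE t in lebesgue. f t = 0"
proof -
  obtain f' where f'[measurable]: "f' \<in> borel_measurable lborel" and eq: "AE x in lborel. f x = f' x"
    using completion_ex_borel_measurable_real[of f lborel] f by auto
  have eq': "AE x in lebesgue. f x = f' x" using eq by (rule AE_completion)
  have int': "integrable lebesgue f'"
    using f eq' by (subst integrable_cong_AE[of _ _ f]) (auto intro: measurable_completion simp: eq_commute)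
  then have int: "integrable lborel f'" using integrable_completion[of f' lborel] by simp
  let ?D = "\<lambda>f. density lborel (\<lambda>x. ennreal (f x))"
  have fin: "emeasure (?D f1) {x<..} < \<infinity>" if "integrable lborel f1" for x :: real and f1
  proof -
    have "emeasure (?D f1) {x<..} = (\<integral>\<^sup>+t. ennreal (f1 t) * indicator {x<..} t \<partial>lborel)"
      using borel_measurable_integrable[OF that] by (subst emeasure_density) auto
    also have "\<dots> \<le> (\<integral>\<^sup>+t. ennreal (norm (f1 t)) \<partial>lborel)"
      by (intro nn_integral_mono) (auto simp: indicator_def intro!: ennreal_leI)
    also have "\<dots> < \<infinity>" using that by (simp add: integrable_iff_bounded)
    finally show ?thesis .
  qed
  have z: "(LINT t|lborel. indicator {x<..} t * f' t) = 0" for x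
  proof -
    have "(LINT t|lborel. indicator {x<..} t * f' t) = (LINT t|lebesgue. indicator {x<..} t * f' t)"
      by (rule integral_completion[symmetric]) measurable
    also have "\<dots> = (LINT t|lebesgue. indicator {x<..} t * f t)"
      using f eq' by (intro integral_cong_AE) (auto intro!: borel_measurable_times measurable_completion[OF f'] simp: measurable_completion)
    \<comment> \<open>Since f vanishes outside (A, B], the half-line can be cut down to an interval
      covered by the hypothesis.\<close>
    also have "\<dots> = (LINT t|lebesgue. indicator {max x A<..B} t * f t)"
      using out by (intro Bochner_Integration.integral_cong) (auto simp: indicator_def)
    also have "\<dots> = 0"
      by (cases "max x A < B") (auto intro: 0)
    finally show ?thesis .
  qed
  have "?D (\<lambda>x. max 0 (f' x)) = ?D (\<lambda>x. max 0 (- f' x))"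
  proof (rule measure_eqI_lessThan)
    fix x
    have im: "integrable lborel (\<lambda>t. indicator {x<..} t * max 0 (g t))" if "integrable lborel g" for g :: "real \<Rightarrow> real"
      using integrable_mult_indicator[of "{x<..}" lborel "\<lambda>t. max 0 (g t)"] that by simp
    show "emeasure (?D (\<lambda>x. max 0 (f' x))) {x<..} < \<infinity>" using int by (intro fin) auto
    have "emeasure (?D (\<lambda>x. max 0 (f' x))) {x<..} = (\<integral>\<^sup>+t. ennreal (indicator {x<..} t * max 0 (f' t)) \<partial>lborel)"
      by (subst emeasure_density) (auto intro!: nn_integral_cong simp: indicator_def)
    also have "\<dots> = ennreal (LINT t|lborel. indicator {x<..} t * max 0 (f' t))"
      using im[OF int] by (intro nn_integral_eq_integral) auto
    also have "(LINT t|lborel. indicator {x<..} t * max 0 (f' t)) = (LINT t|lborel. indicator {x<..} t * f' t + indicator {x<..} t * max 0 (- f' t))"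
      by (intro Bochner_Integration.integral_cong) (auto simp: indicator_def)
    also have "\<dots> = (LINT t|lborel. indicator {x<..} t * f' t) + (LINT t|lborel. indicator {x<..} t * max 0 (- f' t))"
      using im[of "\<lambda>t. - f' t"] int integrable_mult_indicator[of "{x<..}" lborel f'] by (intro Bochner_Integration.integral_add) auto
    also have "\<dots> = (LINT t|lborel. indicator {x<..} t * max 0 (- f' t))" by (simp add: z)
    also have "ennreal \<dots> = (\<integral>\<^sup>+t. ennreal (indicator {x<..} t * max 0 (- f' t)) \<partial>lborel)"
      using im[of "\<lambda>t. - f' t"] int by (intro nn_integral_eq_integral[symmetric]) auto
    also have "\<dots> = emeasure (?D (\<lambda>x. max 0 (- f' x))) {x<..}"
      by (subst emeasure_density) (auto intro!: nn_integral_cong simp: indicator_def)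
    finally show "emeasure (?D (\<lambda>x. max 0 (f' x))) {x<..} = emeasure (?D (\<lambda>x. max 0 (- f' x))) {x<..}" .
  qed simp_all
  then have "AE x in lborel. ennreal (max 0 (f' x)) = ennreal (max 0 (- f' x))"
    by (intro sigma_finite_measure.density_unique[OF sigma_finite_lborel]) auto
  then have "AE x in lborel. f' x = 0"
    by eventually_elim (auto simp: max_def split: if_splits)
  with eq have "AE x in lborel. f x = 0" by eventually_elim simp
  then show ?thesis by (rule AE_completion)
qed

text \<open>The interval is chosen larger than the support on both sides, so that all derivatives
  vanish at its end points too and integration by parts leaves no boundary terms.\<close>

lemma test_function_support:
  assumes "\<psi> \<in> test_functions R" "0 < R"
  obtains a b where "0 < a" "a < b" "ereal b < R" "\<And>n t. \<not> (a < t \<and> t < b) \<Longrightarrow> nth_deriv UNIV n \<psi> t = 0"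
proof -
  define K where "K = closure {t. \<psi> t \<noteq> 0}"
  have K: "compact K" "K \<subseteq> einterval 0 R" using assms by (auto simp: K_def test_functions_def)
  obtain c where c: "0 < c" "ereal c < R"
    using einterval_nonempty[OF assms(2)] by (auto simp: einterval_iff)
  \<comment> \<open>The additional point keeps the set nonempty when \<psi> is identically
    0.\<close>
  define K' where "K' = insert c K"
  have K': "compact K'" "K' \<noteq> {}" "K' \<subseteq> einterval 0 R"
    using K c by (auto simp: K'_def einterval_iff)
  obtain s where s: "s \<in> K'" "\<And>t. t \<in> K' \<Longrightarrow> s \<le> t" using compact_attains_inf[OF K'(1,2)] by blast
  obtain u where u: "u \<in> K'" "\<And>t. t \<in> K' \<Longrightarrow> t \<le> u" using compact_attains_sup[OF K'(1,2)] by blast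
  have su: "0 < s" "ereal u < R" using s u K' by (auto simp: einterval_iff)
  obtain b where b: "ereal u < ereal b" "ereal b < R"
    using ereal_dense2[OF su(2)] by auto
  have out: "nth_deriv UNIV n \<psi> t = 0" if "t \<notin> K" for n t
    using that
  proof (induction n arbitrary: t)
    case 0
    then show ?case using closure_subset[of "{t. \<psi> t \<noteq> 0}"] by (auto simp: K_def)
  next
    case (Suc n)
    have "((\<lambda>t. 0) has_vector_derivative 0) (at t)" by simp
    moreover have "open (- K)" using K compact_imp_closed by auto
    ultimately have "(nth_deriv UNIV n \<psi> has_vector_derivative 0) (at t)"
      by (rule has_vector_derivative_transform_within_open) (use Suc in auto)
    then show ?case by (simp add: nth_deriv_Suc vector_derivative_at)
  qed
  show ?thesis
  proof
    show "0 < s / 2" "s / 2 < b" "ereal b < R" using su s(2)[OF u(1)] b by auto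
    fix n t assume "\<not> (s / 2 < t \<and> t < b)"
    then have "t \<notin> K" using s(2)[of t] u(2)[of t] su b by (auto simp: K'_def)
    then show "nth_deriv UNIV n \<psi> t = 0" by (rule out)
  qed
qed

lemma continuous_nth_deriv_UNIV:
  assumes "\<psi> \<in> C_infinity1 UNIV"
  shows "continuous_on A (nth_deriv UNIV n \<psi>)"
  using has_real_derivative_nth_deriv[OF assms]
  by (intro continuous_at_imp_continuous_on ballI) (auto intro: DERIV_isCont)

text \<open>The successive derivatives of \<open>d 0\<close> are given as a sequence. One derivative
  at a time is moved from the test function to this sequence, each time with a change of
  sign.\<close>

lemma integral_by_parts_chain:
  fixes d :: "nat \<Rightarrow> real \<Rightarrow> real"
  assumes "a < b"
    and d: "\<And>i t. i < j \<Longrightarrow> t \<in> {a..b} \<Longrightarrow> (d i has_real_derivative d (Suc i) t) (at t)"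
    and cont: "\<And>i. i \<le> j \<Longrightarrow> continuous_on {a..b} (d i)"
    and \<psi>: "\<psi> \<in> C_infinity1 UNIV" and zero: "\<And>n. nth_deriv UNIV n \<psi> a = 0" "\<And>n. nth_deriv UNIV n \<psi> b = 0"
  shows "integral {a..b} (\<lambda>t. d 0 t * nth_deriv UNIV j \<psi> t) = (-1) ^ j * integral {a..b} (\<lambda>t. d j t * \<psi> t)"
proof -
  have "integral {a..b} (\<lambda>t. d 0 t * nth_deriv UNIV j \<psi> t)
      = (-1) ^ i * integral {a..b} (\<lambda>t. d i t * nth_deriv UNIV (j - i) \<psi> t)" if "i \<le> j" for i
    using that
  proof (induction i)
    case (Suc i)
    define n where "n = j - Suc i"
    have n: "j - i = Suc n" using Suc.prems by (simp add: n_def)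
    have "((\<lambda>t. d (Suc i) t * nth_deriv UNIV n \<psi> t + d i t * nth_deriv UNIV (Suc n) \<psi> t) has_integral
       (d i b * nth_deriv UNIV n \<psi> b - d i a * nth_deriv UNIV n \<psi> a)) {a..b}"
      using \<open>a < b\<close> Suc.prems has_real_derivative_nth_deriv[OF \<psi>]
      by (intro fundamental_theorem_of_calculus)
        (auto simp flip: has_real_derivative_iff_has_vector_derivative
          intro!: derivative_eq_intros d intro: has_field_derivative_at_within)
    then have "integral {a..b} (\<lambda>t. d (Suc i) t * nth_deriv UNIV n \<psi> t + d i t * nth_deriv UNIV (Suc n) \<psi> t) = 0"
      by (simp add: zero integral_unique)
    moreover have "integral {a..b} (\<lambda>t. d (Suc i) t * nth_deriv UNIV n \<psi> t + d i t * nth_deriv UNIV (Suc n) \<psi> t)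
       = integral {a..b} (\<lambda>t. d (Suc i) t * nth_deriv UNIV n \<psi> t) + integral {a..b} (\<lambda>t. d i t * nth_deriv UNIV (Suc n) \<psi> t)"
      using Suc.prems
      by (intro integral_add integrable_continuous_interval continuous_intros cont continuous_nth_deriv_UNIV[OF \<psi>]) auto
    ultimately have "integral {a..b} (\<lambda>t. d i t * nth_deriv UNIV (Suc n) \<psi> t)
       = - integral {a..b} (\<lambda>t. d (Suc i) t * nth_deriv UNIV n \<psi> t)" by linarith
    then show ?case using Suc by (simp add: n n_def[symmetric])
  qed simp
  from this[of j] show ?thesis by simp
qed

lemma borel_measurable_times_indicator_subset:
  fixes g :: "'a::euclidean_space \<Rightarrow> real"
  assumes "g \<in> borel_measurable (lebesgue_on S)" "A \<subseteq> S" "A \<in> sets lebesgue"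
  shows "(\<lambda>t. indicator A t * g t) \<in> borel_measurable lebesgue"
  using measurable_restrict_mono[OF assms(1,2)] assms(3)
  by (subst (asm) borel_measurable_restrict_space_iff) auto

lemma compact_subset_einterval:
  assumes "compact K" "K \<subseteq> einterval 0 R"
  obtains a b where "K \<subseteq> {a..b}" "0 < a" "a \<le> b" "ereal b < R" | "K = {}"
proof (cases "K = {}")
  case False
  obtain s where s: "s \<in> K" "\<And>t. t \<in> K \<Longrightarrow> s \<le> t" using compact_attains_inf[OF assms(1) False] by blast
  obtain u where u: "u \<in> K" "\<And>t. t \<in> K \<Longrightarrow> t \<le> u" using compact_attains_sup[OF assms(1) False] by blast
  show ?thesis by (rule that(1)[of s u]) (use s u assms in \<open>auto simp: einterval_iff\<close>)
qed (use that in blast)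

lemma lebesgue_integral_einterval_Icc:
  assumes "0 < a" "ereal b < R" "\<And>t. t \<notin> {a..b} \<Longrightarrow> f t = (0::real)"
  shows "(LINT t|lebesgue_on (einterval 0 R). f t) = (LINT t|lebesgue. indicator {a..b} t * f t)"
  using Icc_subset_einterval[OF assms(1,2)] assms(3)
  by (subst integral_restrict_space)
    (auto intro!: Bochner_Integration.integral_cong simp: indicator_def borel_einterval subset_iff)

text \<open>Bump functions converging to the indicator of (a, b) turn equality of the pairings with
  test functions into equality of integrals over intervals. Almost everywhere equality follows on
  each interval, and countably many of them exhaust (0, R).\<close>

lemma has_weak_deriv_unique:
  assumes "0 < R" "has_weak_deriv R j v w" "has_weak_deriv R j v w'"
  shows "AE t in lebesgue. t \<in> einterval 0 R \<longrightarrow> w t = w' t"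
proof -
  have int: "integrable lebesgue (\<lambda>t. indicator {a..b} t * (w t - w' t))" if "0 < a" "ereal b < R" for a b
  proof -
    have "set_integrable lebesgue {a..b} w" "set_integrable lebesgue {a..b} w'"
      using assms Icc_subset_einterval[OF that] by (auto simp: has_weak_deriv_def locally_integrable_def)
    from set_integral_diff(1)[OF this] show ?thesis by (simp add: set_integrable_def)
  qed
  have zero: "(LINT t|lebesgue. indicator {a<..b} t * (w t - w' t)) = 0" if ab: "0 < a" "a < b" "ereal b < R" for a b
  proof -
    \<comment> \<open>The parameter m = n + 1 tends to infinity, so exp (- 1 / (m q)) tends to 1 on
      (a, b) while staying between 0 and 1.\<close>
    define \<psi> where "\<psi> = (\<lambda>n. bump_family (real (Suc n)) a b 0 1)"
    have \<psi>: "\<psi> n \<in> test_functions R" for n unfolding \<psi>_def by (intro bump_test_function ab) simp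
    have \<psi>01: "0 \<le> \<psi> n t" "\<psi> n t \<le> 1" "t \<notin> {a..b} \<Longrightarrow> \<psi> n t = 0" for n t
      by (auto simp: \<psi>_def bump_family_def)
    have \<psi>m[measurable]: "\<psi> n \<in> borel_measurable lebesgue" for n
    proof -
      have "continuous_on UNIV (nth_deriv UNIV 0 (\<psi> n))"
        using \<psi>[of n] by (intro continuous_nth_deriv_UNIV) (auto simp: test_functions_def)
      then show ?thesis by (intro measurable_completion) (simp add: borel_measurable_continuous_onI)
    qed
    have m: "(\<lambda>t. indicator J t * (w t - w' t)) \<in> borel_measurable lebesgue" if "J \<subseteq> {a..b}" "J \<in> sets borel" for J
    proof -
      have "(\<lambda>t. indicator J t * (w t - w' t)) = (\<lambda>t. indicator J t * (indicator {a..b} t * (w t - w' t)))"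
        using that(1) by (intro ext) (auto simp: indicator_def)
      also have "\<dots> \<in> borel_measurable lebesgue"
        using that(2) by (intro borel_measurable_times borel_measurable_integrable[OF int[OF ab(1,3)]]) (auto intro: measurable_completion)
      finally show ?thesis .
    qed
    have 1: "(LINT t|lebesgue. indicator {a..b} t * (w t - w' t) * \<psi> n t) = 0" for n
    proof -
      have i: "set_integrable lebesgue {a..b} w" "set_integrable lebesgue {a..b} w'"
        using assms Icc_subset_einterval[OF ab(1,3)] by (auto simp: has_weak_deriv_def locally_integrable_def)
      have ib: "integrable lebesgue (\<lambda>t. indicator {a..b} t * f t * \<psi> n t)" if "set_integrable lebesgue {a..b} f" for f
      proof (rule Bochner_Integration.integrable_bound)
        show i: "integrable lebesgue (\<lambda>t. indicator {a..b} t * f t)"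
          using that by (simp add: set_integrable_def)
        show "(\<lambda>t. indicator {a..b} t * f t * \<psi> n t) \<in> borel_measurable lebesgue"
          by (intro borel_measurable_times borel_measurable_integrable[OF i] \<psi>m)
        show "AE t in lebesgue. norm (indicator {a..b} t * f t * \<psi> n t) \<le> norm (indicator {a..b} t * f t)"
          by (rule AE_I2) (simp add: abs_mult \<psi>01 mult_left_le)
      qed
      have i1: "integrable lebesgue (\<lambda>t. indicator {a..b} t * w t * \<psi> n t)"
        by (rule ib[OF i(1)])
      have i2: "integrable lebesgue (\<lambda>t. indicator {a..b} t * w' t * \<psi> n t)"
        by (rule ib[OF i(2)])
      have e1: "(LINT t|lebesgue_on (einterval 0 R). v t * nth_deriv UNIV j (\<psi> n) t) = (-1) ^ j * (LINT t|lebesgue_on (einterval 0 R). w t * \<psi> n t)"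
        using assms(2) \<psi>[of n] unfolding has_weak_deriv_def by blast
      have e2: "(LINT t|lebesgue_on (einterval 0 R). v t * nth_deriv UNIV j (\<psi> n) t) = (-1) ^ j * (LINT t|lebesgue_on (einterval 0 R). w' t * \<psi> n t)"
        using assms(3) \<psi>[of n] unfolding has_weak_deriv_def by blast
      have e3: "(LINT t|lebesgue_on (einterval 0 R). f t * \<psi> n t) = (LINT t|lebesgue. indicator {a..b} t * f t * \<psi> n t)" for f
        using lebesgue_integral_einterval_Icc[OF ab(1,3), of "\<lambda>t. f t * \<psi> n t"] \<psi>01(3) by (simp add: mult.assoc)
      have "(LINT t|lebesgue. indicator {a..b} t * w t * \<psi> n t) = (LINT t|lebesgue. indicator {a..b} t * w' t * \<psi> n t)"
        using e1 e2 unfolding e3 by simp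
      then show ?thesis using i1 i2 by (simp add: algebra_simps)
    qed
    have "(\<lambda>n. LINT t|lebesgue. indicator {a..b} t * (w t - w' t) * \<psi> n t) \<longlonglongrightarrow>
      (LINT t|lebesgue. indicator {a<..<b} t * (w t - w' t))"
    proof (rule integral_dominated_convergence)
      show "integrable lebesgue (\<lambda>t. norm (indicator {a..b} t * (w t - w' t)))"
        using int[OF ab(1,3)] by (rule integrable_norm)
      show "AE t in lebesgue. norm (indicator {a..b} t * (w t - w' t) * \<psi> n t) \<le> norm (indicator {a..b} t * (w t - w' t))" for n
        by (auto simp: abs_mult \<psi>01 mult_left_le intro!: AE_I2)
      show "AE t in lebesgue. (\<lambda>n. indicator {a..b} t * (w t - w' t) * \<psi> n t) \<longlonglongrightarrow> indicator {a<..<b} t * (w t - w' t)"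
      proof (rule AE_I2)
        fix t
        show "(\<lambda>n. indicator {a..b} t * (w t - w' t) * \<psi> n t) \<longlonglongrightarrow> indicator {a<..<b} t * (w t - w' t)"
        proof (cases "a < t \<and> t < b")
          case True
          have "(\<lambda>n. exp (- (inverse (real (Suc n)) * (1 / ((t - a) * (b - t)))))) \<longlonglongrightarrow> exp (- (0 * (1 / ((t - a) * (b - t)))))"
            by (intro tendsto_intros LIMSEQ_inverse_real_of_nat)
          then have "(\<lambda>n. \<psi> n t) \<longlonglongrightarrow> 1" using True by (simp add: \<psi>_def bump_family_def field_simps)
          then have "(\<lambda>n. (w t - w' t) * \<psi> n t) \<longlonglongrightarrow> (w t - w' t) * 1" by (intro tendsto_intros)
          then show ?thesis using True by simp
        next
          case False
          then show ?thesis by (auto simp: \<psi>_def bump_family_def)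
        qed
      qed
      show "(\<lambda>t. indicator {a..b} t * (w t - w' t) * \<psi> n t) \<in> borel_measurable lebesgue" for n
        using int[OF ab(1,3)] by measurable
      show "(\<lambda>t. indicator {a<..<b} t * (w t - w' t)) \<in> borel_measurable lebesgue" by (rule m) auto
    qed
    then have "(LINT t|lebesgue. indicator {a<..<b} t * (w t - w' t)) = 0"
      unfolding 1 by (simp add: LIMSEQ_const_iff)
    also have "(LINT t|lebesgue. indicator {a<..<b} t * (w t - w' t)) = (LINT t|lebesgue. indicator {a<..b} t * (w t - w' t))"
    proof (rule integral_cong_AE)
      show "(\<lambda>t. indicator {a<..<b} t * (w t - w' t)) \<in> borel_measurable lebesgue"
        "(\<lambda>t. indicator {a<..b} t * (w t - w' t)) \<in> borel_measurable lebesgue" by (auto intro!: m)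
      have "AE t in lebesgue. t \<noteq> b" by (rule AE_completion) (rule AE_lborel_singleton)
      then show "AE t in lebesgue. indicator {a<..<b} t * (w t - w' t) = indicator {a<..b} t * (w t - w' t)"
        by eventually_elim (auto simp: indicator_def)
    qed
    finally show ?thesis .
  qed
  have ae: "AE t in lebesgue. t \<in> {a<..b} \<longrightarrow> w t = w' t" if ab: "0 < a" "a < b" "ereal b < R" for a b
  proof -
    have ii: "indicator {c<..d} t * (indicator {a<..b} t * (w t - w' t)) = indicator {c<..d} t * (w t - w' t)"
      if "a \<le> c" "d \<le> b" for c d t using that by (auto simp: indicator_def)
    have "AE t in lebesgue. indicator {a<..b} t * (w t - w' t) = 0"
    proof (rule AE_zero_of_integrals_Ioc_zero[of _ a b])
      have "integrable lebesgue (\<lambda>t. indicator {a<..b} t *\<^sub>R (indicator {a..b} t * (w t - w' t)))"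
        using int[OF ab(1,3)] by (intro integrable_mult_indicator) auto
      also have "(\<lambda>t. indicator {a<..b} t *\<^sub>R (indicator {a..b} t * (w t - w' t))) = (\<lambda>t. indicator {a<..b} t * (w t - w' t))"
        by (auto simp: indicator_def)
      finally show "integrable lebesgue (\<lambda>t. indicator {a<..b} t * (w t - w' t))" .
      fix c d assume cd: "a \<le> c" "c < d" "d \<le> b"
      then have "ereal d < R" using ab(3) by (meson ereal_less_eq(3) le_less_trans)
      then show "(LINT t|lebesgue. indicator {c<..d} t * (indicator {a<..b} t * (w t - w' t))) = 0"
        using cd ab zero[of c d] by (simp add: ii)
    qed (auto simp: indicator_def)
    then show ?thesis by eventually_elim (auto simp: indicator_def)
  qed
  \<comment> \<open>Right ends in (0, R) that tend to R. The left ends used with them are b n / (m +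
    2): smaller than b n even for m = 0, and tending to 0 as m grows.\<close>
  define b where "b = (\<lambda>n::nat. if R = \<infinity> then real n + 1 else real_of_ereal R * (1 - 1 / (real n + 2)))"
  have b: "ereal (b n) < R \<and> 0 < b n" for n
    using assms(1) by (cases R) (auto simp: b_def field_simps intro!: add_pos_nonneg)
  have "AE t in lebesgue. \<forall>n m::nat. t \<in> {b n / (real m + 2)<..b n} \<longrightarrow> w t = w' t"
    unfolding AE_all_countable
  proof (intro allI ae)
    fix n m :: nat
    have "b n * 1 < b n * (real m + 2)" using b[of n] by (intro mult_strict_left_mono) auto
    then show "b n / (real m + 2) < b n" by (simp add: divide_less_eq)
  qed (use b in auto)
  then show ?thesis
  proof eventually_elim
    case (elim t)
    show ?case
    proof
      assume t: "t \<in> einterval 0 R"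
      have "\<exists>n. t \<le> b n"
      proof (cases "R = \<infinity>")
        case True
        obtain n where "t < real n" using reals_Archimedean2 by blast
        then show ?thesis using True by (intro exI[of _ n]) (auto simp: b_def)
      next
        case False
        then obtain \<rho> where R: "R = ereal \<rho>" using assms(1) by (cases R) auto
        with t have t': "0 < t" "t < \<rho>" by (auto simp: einterval_iff)
        obtain n where "\<rho> / (\<rho> - t) < real n" using reals_Archimedean2 by blast
        then have "\<rho> < (real n + 2) * (\<rho> - t)" using t' by (auto simp: field_simps)
        then have "t \<le> \<rho> * (1 - 1 / (real n + 2))" by (simp add: field_simps)
        then show ?thesis using R by (intro exI[of _ n]) (simp add: b_def)
      qed
      then obtain n where n: "t \<le> b n" by blast
      obtain m where "b n / t < real m" using reals_Archimedean2 by blast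
      then have "b n / (real m + 2) < t" using t by (auto simp: einterval_iff field_simps)
      with n elim show "w t = w' t" by auto
    qed
  qed
qed

section \<open>Weak derivatives of local L^1 limits\<close>

abbreviation L1_dist_Icc :: "real \<Rightarrow> real \<Rightarrow> (real \<Rightarrow> real) \<Rightarrow> (real \<Rightarrow> real) \<Rightarrow> ennreal" where
  "L1_dist_Icc a b f g \<equiv> \<integral>\<^sup>+t. ennreal (\<bar>f t - g t\<bar>) * indicator {a..b} t \<partial>lebesgue"

text \<open>On the compact interval \<rho> has a positive lower bound, and |z| \<le> \<epsilon> +
  \<epsilon>^(1-p) |z|^p: where |z| > \<epsilon>, multiply |z| by (|z| / \<epsilon>)^(p-1) \<ge> 1.
  This elementary inequality takes the place of Hoelder's and treats p = 1 together with p >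
  1.\<close>

lemma tendsto_L1_Icc_of_weighted_Lp:
  fixes v :: "real \<Rightarrow> real"
  assumes p: "p \<ge> 1" and ab: "a \<le> b" "{a..b} \<subseteq> S" and \<rho>: "continuous_on {a..b} \<rho>" "\<And>t. t \<in> {a..b} \<Longrightarrow> \<rho> t > 0"
    and lim: "(\<lambda>n. \<integral>\<^sup>+t. ennreal (\<bar>f n t - v t\<bar> powr p * \<rho> t) * indicator S t \<partial>lebesgue) \<longlonglongrightarrow> 0"
    and meas: "\<And>n. (\<lambda>t. indicator {a..b} t * (f n t - v t)) \<in> borel_measurable lebesgue"
  shows "(\<lambda>n. L1_dist_Icc a b (f n) v) \<longlonglongrightarrow> 0"
proof (rule order_tendstoI)
  fix e :: ennreal assume e: "0 < e"
  define I where "I = (\<lambda>n. \<integral>\<^sup>+t. ennreal (\<bar>f n t - v t\<bar> powr p * \<rho> t) * indicator S t \<partial>lebesgue)"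
  obtain e' :: real where e': "0 < ennreal e'" "ennreal e' < e"
    using dense[OF e] by (metis ennreal_cases less_top_ennreal top.not_eq_extremum less_trans)
  then have e'0: "e' > 0" by simp
  \<comment> \<open>With this choice the constant term contributes at most e' / 2 over the interval;
    the summand 1 avoids a division by 0 when a = b.\<close>
  define \<epsilon> where "\<epsilon> = e' / (2 * (b - a + 1))"
  have \<epsilon>: "\<epsilon> > 0" using e'0 ab by (simp add: \<epsilon>_def)
  obtain c where c: "c > 0" "\<And>t. t \<in> {a..b} \<Longrightarrow> c \<le> \<rho> t"
  proof -
    obtain s where "s \<in> {a..b}" "\<And>t. t \<in> {a..b} \<Longrightarrow> \<rho> s \<le> \<rho> t"
      using continuous_attains_inf[of "{a..b}" \<rho>] \<rho> ab by auto
    then show ?thesis using that[of "\<rho> s"] \<rho>(2) by blast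
  qed
  define C where "C = \<epsilon> powr (1 - p) / c"
  have C: "C > 0" using \<epsilon> c by (simp add: C_def)
  have pt: "\<bar>z\<bar> \<le> \<epsilon> + C * (\<bar>z\<bar> powr p * \<rho> t)" if "t \<in> {a..b}" for z t
  proof -
    have "\<bar>z\<bar> \<le> \<epsilon> + \<epsilon> powr (1 - p) * \<bar>z\<bar> powr p"
    proof (cases "\<bar>z\<bar> \<le> \<epsilon>")
      case False
      then have "1 \<le> (\<bar>z\<bar> / \<epsilon>) powr (p - 1)" using p \<epsilon> by (intro ge_one_powr_ge_zero) auto
      then have "\<bar>z\<bar> \<le> \<bar>z\<bar> * (\<bar>z\<bar> / \<epsilon>) powr (p - 1)" by (simp add: mult_le_cancel_left1)
      also have "\<dots> = \<epsilon> powr (1 - p) * \<bar>z\<bar> powr p"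
        using False \<epsilon> by (simp add: powr_divide powr_diff field_simps)
      finally show ?thesis using \<epsilon> by simp
    qed (simp add: add_increasing2)
    also have "\<epsilon> powr (1 - p) * \<bar>z\<bar> powr p = C * (\<bar>z\<bar> powr p * c)" using c by (simp add: C_def)
    also have "\<dots> \<le> C * (\<bar>z\<bar> powr p * \<rho> t)" using C c(2)[OF that] by (intro mult_left_mono) auto
    finally show ?thesis by simp
  qed
  have bound: "L1_dist_Icc a b (f n) v \<le> ennreal (e' / 2) + ennreal C * I n" for n
  proof -
    \<comment> \<open>Both factors are cut off outside [a, b], the set on which measurability of the
      difference and continuity of \<rho> are given.\<close>
    let ?g = "\<lambda>t. ennreal (\<bar>indicator {a..b} t * (f n t - v t)\<bar> powr p * (if t \<in> {a..b} then \<rho> t else 0))"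
    have [measurable]: "(\<lambda>t. if t \<in> {a..b} then \<rho> t else 0) \<in> borel_measurable lebesgue"
    proof -
      have "(\<lambda>t. if t \<in> {a..b} then \<rho> t else 0) \<in> borel_measurable borel"
        by (rule borel_measurable_continuous_on_if) (use \<rho>(1) in auto)
      then show ?thesis by (intro measurable_completion) simp
    qed
    note meas[of n, measurable]
    have "L1_dist_Icc a b (f n) v
       \<le> (\<integral>\<^sup>+t. ennreal \<epsilon> * indicator {a..b} t + ennreal C * ?g t \<partial>lebesgue)"
    proof (rule nn_integral_mono)
      fix t
      show "ennreal (\<bar>f n t - v t\<bar>) * indicator {a..b} t \<le> ennreal \<epsilon> * indicator {a..b} t + ennreal C * ?g t"
      proof (cases "t \<in> {a..b}")
        case True
        then have "ennreal (\<bar>f n t - v t\<bar>) \<le> ennreal (\<epsilon> + C * (\<bar>f n t - v t\<bar> powr p * \<rho> t))"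
          by (intro ennreal_leI pt)
        also have "\<dots> = ennreal \<epsilon> + ennreal C * ennreal (\<bar>f n t - v t\<bar> powr p * \<rho> t)"
          using True \<epsilon> C \<rho>(2)[of t] by (simp add: ennreal_plus flip: ennreal_mult)
        finally show ?thesis using True by simp
      qed simp
    qed
    also have "\<dots> = ennreal \<epsilon> * ennreal (b - a) + ennreal C * (\<integral>\<^sup>+t. ?g t \<partial>lebesgue)"
    proof -
      have "?g \<in> borel_measurable lebesgue" by measurable
      moreover have "(\<lambda>t. ennreal \<epsilon> * indicator {a..b} t) \<in> borel_measurable lebesgue"
        by (rule measurable_completion) measurable
      ultimately show ?thesis
        using ab by (subst nn_integral_add) (auto simp: nn_integral_cmult nn_integral_cmult_indicator)
    qed
    also have "\<dots> \<le> ennreal (e' / 2) + ennreal C * I n"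
    proof (intro add_mono mult_left_mono)
      have "\<epsilon> * (b - a) \<le> \<epsilon> * (b - a + 1)" using \<epsilon> by simp
      also have "\<dots> = e' / 2"
      proof -
        have "b - a + 1 \<noteq> 0" using ab by linarith
        then show ?thesis unfolding \<epsilon>_def by (metis divide_divide_eq_left nonzero_eq_divide_eq)
      qed
      finally show "ennreal \<epsilon> * ennreal (b - a) \<le> ennreal (e' / 2)"
        using \<epsilon> ab by (simp flip: ennreal_mult add: ennreal_leI)
      show "(\<integral>\<^sup>+t. ?g t \<partial>lebesgue) \<le> I n"
        unfolding I_def using ab(2) by (intro nn_integral_mono) (auto simp: indicator_def)
    qed auto
    finally show ?thesis .
  qed
  have "(\<lambda>n. ennreal C * I n) \<longlonglongrightarrow> ennreal C * 0"
    using lim unfolding I_def by (intro tendsto_mult_ennreal tendsto_const) auto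
  then have "(\<lambda>n. ennreal C * I n) \<longlonglongrightarrow> 0" by simp
  then have "\<forall>\<^sub>F n in sequentially. ennreal C * I n < ennreal (e' / 2)"
    using e'0 by (intro order_tendstoD(2)) auto
  then show "\<forall>\<^sub>F n in sequentially. L1_dist_Icc a b (f n) v < e"
  proof eventually_elim
    case (elim n)
    have "L1_dist_Icc a b (f n) v \<le> ennreal (e' / 2) + ennreal C * I n"
      by (rule bound)
    also have "\<dots> \<le> ennreal (e' / 2) + ennreal (e' / 2)" using elim by (intro add_mono) auto
    also have "\<dots> = ennreal e'" using e'0 by (simp flip: ennreal_plus)
    finally show ?case using e'(2) by (rule le_less_trans)
  qed
qed simp

text \<open>The classical integration by parts for each n passes to the limit, because a test
  function and its derivatives are bounded on the compact interval that carries them. The two sides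
  of the limit identity involve the orders 0 and j, so these are the orders for which convergence is
  assumed.\<close>

lemma has_weak_deriv_L1_limit:
  fixes d :: "nat \<Rightarrow> nat \<Rightarrow> real \<Rightarrow> real"
  assumes R: "0 < R"
    and d: "\<And>n i t. i < j \<Longrightarrow> t \<in> einterval 0 R \<Longrightarrow> (d n i has_real_derivative d n (Suc i) t) (at t)"
    and cont: "\<And>n i. i \<le> j \<Longrightarrow> continuous_on (einterval 0 R) (d n i)"
    and vm: "v \<in> borel_measurable (lebesgue_on (einterval 0 R))"
    and wm: "w \<in> borel_measurable (lebesgue_on (einterval 0 R))"
    and v: "\<And>a b. 0 < a \<Longrightarrow> a \<le> b \<Longrightarrow> ereal b < R \<Longrightarrow>
       (\<lambda>n. L1_dist_Icc a b (d n 0) v) \<longlonglongrightarrow> 0"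
    and w: "\<And>a b. 0 < a \<Longrightarrow> a \<le> b \<Longrightarrow> ereal b < R \<Longrightarrow>
       (\<lambda>n. L1_dist_Icc a b (d n j) w) \<longlonglongrightarrow> 0"
  shows "has_weak_deriv R j v w"
proof -
  define S where "S = einterval 0 R"
  have Sm: "S \<in> sets lebesgue" by (simp add: S_def borel_einterval)
  have main: "\<exists>n. L1_dist_Icc a b (d n i) u < \<infinity>"
    if "(\<lambda>n. L1_dist_Icc a b (d n i) u) \<longlonglongrightarrow> 0" for i u and a b :: real
    using order_tendstoD(2)[OF that, of \<infinity>] by (auto simp: eventually_sequentially)
  have umab: "(\<lambda>t. indicator {a..b} t * u t) \<in> borel_measurable lebesgue"
    if "u \<in> borel_measurable (lebesgue_on S)" "{a..b} \<subseteq> S" for u :: "real \<Rightarrow> real" and a b :: real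
    using that by (rule borel_measurable_times_indicator_subset) simp
  have dint: "integrable lebesgue (\<lambda>t. indicator {a..b} t * d n i t)" if "i \<le> j" "{a..b} \<subseteq> S" for n i a b
    using continuous_imp_integrable_real[of a b "d n i"] continuous_on_subset[OF cont[OF that(1), of n] that(2)[unfolded S_def]]
    by (subst (asm) integrable_restrict_space) auto
  \<comment> \<open>The limit is integrable because it has finite L^1 distance from one of the
    continuous functions \<open>d n i\<close>.\<close>
  have uint: "integrable lebesgue (\<lambda>t. indicator {a..b} t * u t)"
    if "u \<in> borel_measurable (lebesgue_on S)" "i \<le> j" "0 < a" "a \<le> b" "ereal b < R"
      "(\<lambda>n. L1_dist_Icc a b (d n i) u) \<longlonglongrightarrow> 0" for u i a b
  proof -
    note l = that(6)
    have sub: "{a..b} \<subseteq> S" using that(3-5) unfolding S_def by (intro Icc_subset_einterval)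
    obtain n where n: "L1_dist_Icc a b (d n i) u < \<infinity>"
      using main[OF l] by blast
    have "integrable lebesgue (\<lambda>t. indicator {a..b} t * d n i t - indicator {a..b} t * u t)"
    proof (rule integrableI_bounded)
      show "(\<lambda>t. indicator {a..b} t * d n i t - indicator {a..b} t * u t) \<in> borel_measurable lebesgue"
        by (intro borel_measurable_diff borel_measurable_integrable[OF dint[OF that(2) sub]] umab that(1) sub)
      have "(\<integral>\<^sup>+t. ennreal (norm (indicator {a..b} t * d n i t - indicator {a..b} t * u t)) \<partial>lebesgue)
        = L1_dist_Icc a b (d n i) u"
        by (intro nn_integral_cong) (auto simp: indicator_def)
      then show "(\<integral>\<^sup>+t. ennreal (norm (indicator {a..b} t * d n i t - indicator {a..b} t * u t)) \<partial>lebesgue) < \<infinity>"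
        using n by simp
    qed
    from Bochner_Integration.integrable_diff[OF dint[OF that(2) sub, of n] this] show ?thesis by simp
  qed
  have loc: "locally_integrable R u"
    if um: "u \<in> borel_measurable (lebesgue_on S)" and "i \<le> j"
      and l: "\<And>a b. 0 < a \<Longrightarrow> a \<le> b \<Longrightarrow> ereal b < R \<Longrightarrow>
      (\<lambda>n. L1_dist_Icc a b (d n i) u) \<longlonglongrightarrow> 0" for u i
    unfolding locally_integrable_def
  proof (intro allI impI, elim conjE)
    fix K assume K: "compact K" "K \<subseteq> einterval 0 R"
    show "set_integrable lebesgue K u"
    proof (cases rule: compact_subset_einterval[OF K])
      case (1 a b)
      have "set_integrable lebesgue {a..b} u"
        using uint[OF um \<open>i \<le> j\<close> 1(2-4) l[OF 1(2-4)]] by (simp add: set_integrable_def)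
      then show ?thesis by (rule set_integrable_subset) (use 1 K in \<open>auto intro: lmeasurable_compact fmeasurableD\<close>)
    qed (simp add: set_integrable_def)
  qed
  have lim: "(\<lambda>n. LINT t|lebesgue. indicator {a..b} t * (d n i t * \<eta> t)) \<longlonglongrightarrow> (LINT t|lebesgue. indicator {a..b} t * (u t * \<eta> t))"
    if um: "u \<in> borel_measurable (lebesgue_on S)" and ij: "i \<le> j" and ab: "0 < a" "a \<le> b" "ereal b < R"
      and \<eta>: "continuous_on UNIV \<eta>"
      and l: "(\<lambda>n. L1_dist_Icc a b (d n i) u) \<longlonglongrightarrow> 0" for u i a b and \<eta> :: "real \<Rightarrow> real"
  proof -
    have sub: "{a..b} \<subseteq> S" using ab unfolding S_def by (intro Icc_subset_einterval)
    obtain B where B: "\<And>t. t \<in> {a..b} \<Longrightarrow> \<bar>\<eta> t\<bar> \<le> B"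
      using continuous_on_Icc_bounded[OF continuous_on_subset[OF \<eta> subset_UNIV]] by blast
    have \<eta>m: "\<eta> \<in> borel_measurable lebesgue"
      by (intro measurable_completion) (simp add: borel_measurable_continuous_onI \<eta>)
    have prod: "integrable lebesgue (\<lambda>t. indicator {a..b} t * (h t * \<eta> t))" if i: "integrable lebesgue (\<lambda>t. indicator {a..b} t * h t)" for h
    proof (rule Bochner_Integration.integrable_bound)
      show "integrable lebesgue (\<lambda>t. B * (indicator {a..b} t * h t))" using i by simp
      have "(\<lambda>t. (indicator {a..b} t * h t) * \<eta> t) \<in> borel_measurable lebesgue"
        by (intro borel_measurable_times borel_measurable_integrable[OF i] \<eta>m)
      then show "(\<lambda>t. indicator {a..b} t * (h t * \<eta> t)) \<in> borel_measurable lebesgue" by (simp add: mult.assoc)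
      show "AE t in lebesgue. norm (indicator {a..b} t * (h t * \<eta> t)) \<le> norm (B * (indicator {a..b} t * h t))"
      proof (rule AE_I2)
        fix t
        show "norm (indicator {a..b} t * (h t * \<eta> t)) \<le> norm (B * (indicator {a..b} t * h t))"
        proof (cases "t \<in> {a..b}")
          case True
          have "\<bar>h t\<bar> * \<bar>\<eta> t\<bar> \<le> \<bar>h t\<bar> * \<bar>B\<bar>"
            using B[OF True] by (intro mult_left_mono) auto
          then show ?thesis using True by (simp add: abs_mult mult.commute)
        qed simp
      qed
    qed
    let ?I = "\<lambda>n. LINT t|lebesgue. indicator {a..b} t * (d n i t * \<eta> t)"
    let ?I\<^sub>u = "LINT t|lebesgue. indicator {a..b} t * (u t * \<eta> t)"
    have "(\<lambda>n. ennreal \<bar>?I n - ?I\<^sub>u\<bar>) \<longlonglongrightarrow> 0"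
    proof (rule tendsto_sandwich[OF _ _ tendsto_const])
      let ?J = "\<lambda>n. L1_dist_Icc a b (d n i) u"
      have "(\<lambda>n. ennreal \<bar>B\<bar> * ?J n) \<longlonglongrightarrow> ennreal \<bar>B\<bar> * 0"
        by (intro tendsto_mult_ennreal tendsto_const l) auto
      then show "(\<lambda>n. ennreal \<bar>B\<bar> * ?J n) \<longlonglongrightarrow> 0" by simp
      show "\<forall>\<^sub>F n in sequentially. ennreal \<bar>?I n - ?I\<^sub>u\<bar> \<le> ennreal \<bar>B\<bar> * ?J n"
      proof (rule eventuallyI)
        fix n
        note dn = dint[OF ij sub, of n] and un = uint[OF um ij ab l]
        have du: "integrable lebesgue (\<lambda>t. indicator {a..b} t * (d n i t - u t))"
          using Bochner_Integration.integrable_diff[OF dn un] by (simp add: algebra_simps)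
        have "?I n - ?I\<^sub>u
           = (LINT t|lebesgue. indicator {a..b} t * ((d n i t - u t) * \<eta> t))"
          by (subst Bochner_Integration.integral_diff[symmetric, OF prod[OF dn] prod[OF un]]) (simp add: algebra_simps)
        then have "ennreal \<bar>?I n - ?I\<^sub>u\<bar>
          \<le> (\<integral>\<^sup>+t. ennreal (norm (indicator {a..b} t * ((d n i t - u t) * \<eta> t))) \<partial>lebesgue)"
          using integral_norm_bound_ennreal[OF prod[OF du]] by simp
        also have "\<dots> \<le> (\<integral>\<^sup>+t. ennreal \<bar>B\<bar> * ennreal (norm (indicator {a..b} t * (d n i t - u t))) \<partial>lebesgue)"
        proof (rule nn_integral_mono)
          fix t
          show "ennreal (norm (indicator {a..b} t * ((d n i t - u t) * \<eta> t))) \<le> ennreal \<bar>B\<bar> * ennreal (norm (indicator {a..b} t * (d n i t - u t)))"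
          proof (cases "t \<in> {a..b}")
            case True
            have "\<bar>d n i t - u t\<bar> * \<bar>\<eta> t\<bar> \<le> \<bar>d n i t - u t\<bar> * \<bar>B\<bar>"
              using B[OF True] by (intro mult_left_mono) auto
            then show ?thesis using True by (simp add: abs_mult mult.commute ennreal_leI flip: ennreal_mult)
          qed simp
        qed
        also have "\<dots> = ennreal \<bar>B\<bar> * (\<integral>\<^sup>+t. ennreal (norm (indicator {a..b} t * (d n i t - u t))) \<partial>lebesgue)"
          using borel_measurable_integrable[OF du]
          by (intro nn_integral_cmult measurable_compose[OF _ measurable_ennreal] measurable_compose[OF _ borel_measurable_norm])
        also have "(\<integral>\<^sup>+t. ennreal (norm (indicator {a..b} t * (d n i t - u t))) \<partial>lebesgue) = ?J n"
          by (intro nn_integral_cong) (auto simp: indicator_def)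
        finally show "ennreal \<bar>?I n - ?I\<^sub>u\<bar> \<le> ennreal \<bar>B\<bar> * ?J n" .
      qed
    qed simp
    then have "(\<lambda>n. \<bar>?I n - ?I\<^sub>u\<bar>) \<longlonglongrightarrow> 0"
      by (simp flip: ennreal_0)
    then show ?thesis by (simp add: LIM_zero_iff tendsto_rabs_zero_iff)
  qed
  show ?thesis
    unfolding has_weak_deriv_def
  proof (intro conjI ballI)
    show "locally_integrable R v" by (rule loc[of v 0]) (use vm v S_def in auto)
    show "locally_integrable R w" by (rule loc[of w j]) (use wm w S_def in auto)
    fix \<psi> assume \<psi>: "\<psi> \<in> test_functions R"
    obtain a b where ab: "0 < a" "a < b" "ereal b < R" and out: "\<And>n t. \<not> (a < t \<and> t < b) \<Longrightarrow> nth_deriv UNIV n \<psi> t = 0"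
      using test_function_support[OF \<psi> R] by blast
    have sub: "{a..b} \<subseteq> S" using ab unfolding S_def by (intro Icc_subset_einterval)
    have \<psi>C: "\<psi> \<in> C_infinity1 UNIV" using \<psi> by (simp add: test_functions_def)
    note c\<psi> = continuous_nth_deriv_UNIV[OF \<psi>C]
    let ?J = "\<lambda>h. LINT t|lebesgue. indicator {a..b} t * h t"
    have vl: "(\<lambda>n. ?J (\<lambda>t. d n 0 t * nth_deriv UNIV j \<psi> t)) \<longlonglongrightarrow> ?J (\<lambda>t. v t * nth_deriv UNIV j \<psi> t)"
      using vm ab by (intro lim v c\<psi>) (auto simp: S_def)
    have "(\<lambda>n. ?J (\<lambda>t. d n j t * nth_deriv UNIV 0 \<psi> t)) \<longlonglongrightarrow> ?J (\<lambda>t. w t * nth_deriv UNIV 0 \<psi> t)"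
      using wm ab by (intro lim w c\<psi>) (auto simp: S_def)
    then have wl: "(\<lambda>n. (-1) ^ j * ?J (\<lambda>t. d n j t * \<psi> t)) \<longlonglongrightarrow> (-1) ^ j * ?J (\<lambda>t. w t * \<psi> t)"
      by (intro tendsto_intros) simp
    have conv: "?J h = integral {a..b} h" if "continuous_on {a..b} h" for h :: "real \<Rightarrow> real"
    proof -
      have "?J h = integral\<^sup>L (lebesgue_on {a..b}) h"
        by (subst integral_restrict_space) auto
      also have "\<dots> = integral {a..b} h"
        by (rule lebesgue_integral_eq_integral[OF continuous_imp_integrable_real[OF that]]) simp
      finally show ?thesis .
    qed
    have "?J (\<lambda>t. d n 0 t * nth_deriv UNIV j \<psi> t) = (-1) ^ j * ?J (\<lambda>t. d n j t * \<psi> t)" for n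
    proof -
      have cs: "i \<le> j \<Longrightarrow> continuous_on {a..b} (d n i)" for i
        using cont sub unfolding S_def by (metis continuous_on_subset)
      have "integral {a..b} (\<lambda>t. d n 0 t * nth_deriv UNIV j \<psi> t) = (-1) ^ j * integral {a..b} (\<lambda>t. d n j t * \<psi> t)"
        using ab sub by (intro integral_by_parts_chain d cs \<psi>C out) (auto simp: S_def)
      then show ?thesis
        using c\<psi>[of "{a..b}" 0] by (subst (1 2) conv) (auto intro!: continuous_intros cs c\<psi>)
    qed
    then have "?J (\<lambda>t. v t * nth_deriv UNIV j \<psi> t) = (-1) ^ j * ?J (\<lambda>t. w t * \<psi> t)"
      using LIMSEQ_unique[OF vl] wl by simp
    then show "(LINT t|lebesgue_on (einterval 0 R). v t * nth_deriv UNIV j \<psi> t) = (-1) ^ j * (LINT t|lebesgue_on (einterval 0 R). w t * \<psi> t)"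
      using out[of _ j] out[of _ 0] by (subst (1 2) lebesgue_integral_einterval_Icc[OF ab(1,3)]) auto
  qed
qed

section \<open>Functions on a punctured ball and the warped metric\<close>

text \<open>Differentiability is not at issue: \<open>frechet_derivative\<close> chooses among all
  derivatives at the point, and functions that agree near x have the same ones.\<close>

lemma frechet_derivative_cong_open:
  assumes "open S" "x \<in> S" "\<And>y. y \<in> S \<Longrightarrow> f y = g y"
  shows "frechet_derivative f (at x) = frechet_derivative g (at x)"
proof -
  have "(f has_derivative D) (at x) \<longleftrightarrow> (g has_derivative D) (at x)" for D
    using has_derivative_transform_within_open[OF _ assms(1,2)] assms(3) by metis
  then show ?thesis by (simp add: frechet_derivative_def)
qed

lemma partial_deriv_cong_open:
  assumes "open S" "x \<in> S" "\<And>y. y \<in> S \<Longrightarrow> f y = g y"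
  shows "partial_deriv i f x = partial_deriv i g x"
  using frechet_derivative_cong_open[OF assms] by (simp add: partial_deriv_def)

lemma partial_deriv_eqI: "(f has_derivative D) (at x) \<Longrightarrow> partial_deriv i f x = D (axis i 1)"
  using frechet_derivative_at[of f D x] by (simp add: partial_deriv_def)

lemma has_derivative_partial_derivs:
  fixes f :: "real^'n \<Rightarrow> real"
  assumes "f differentiable (at x)"
  shows "(f has_derivative (\<lambda>h. \<Sum>i\<in>UNIV. h $ i * partial_deriv i f x)) (at x)"
proof -
  have D: "(f has_derivative frechet_derivative f (at x)) (at x)"
    using assms by (simp add: frechet_derivative_works)
  interpret bounded_linear "frechet_derivative f (at x)" using D by (rule has_derivative_bounded_linear)
  have "frechet_derivative f (at x) h = (\<Sum>i\<in>UNIV. h $ i * partial_deriv i f x)" for h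
  proof -
    have "h = (\<Sum>i\<in>UNIV. h $ i *\<^sub>R axis i 1)" using basis_expansion[of h] by (simp add: scalar_mult_eq_scaleR)
    then have "frechet_derivative f (at x) h = frechet_derivative f (at x) (\<Sum>i\<in>UNIV. h $ i *\<^sub>R axis i 1)" by simp
    then show ?thesis by (simp add: sum scaleR partial_deriv_def)
  qed
  then have "frechet_derivative f (at x) = (\<lambda>h. \<Sum>i\<in>UNIV. h $ i * partial_deriv i f x)" by (rule ext)
  with D show ?thesis by simp
qed

section \<open>Rules for partial derivatives and differentiability of finite order\<close>

lemma partial_deriv_const [simp]: "partial_deriv i (\<lambda>x. c) x = 0"
  by (rule partial_deriv_eqI[THEN trans]) (rule has_derivative_const, simp)

lemma partial_deriv_add:
  "f differentiable (at x) \<Longrightarrow> g differentiable (at x) \<Longrightarrow>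
    partial_deriv i (\<lambda>x. f x + g x) x = partial_deriv i f x + partial_deriv i g x"
  unfolding frechet_derivative_works
  by (subst partial_deriv_eqI[OF has_derivative_add]) (auto simp: partial_deriv_def)

lemma partial_deriv_diff:
  "f differentiable (at x) \<Longrightarrow> g differentiable (at x) \<Longrightarrow>
    partial_deriv i (\<lambda>x. f x - g x) x = partial_deriv i f x - partial_deriv i g x"
  unfolding frechet_derivative_works
  by (subst partial_deriv_eqI[OF has_derivative_diff]) (auto simp: partial_deriv_def)

lemma partial_deriv_mult:
  "f differentiable (at x) \<Longrightarrow> g differentiable (at x) \<Longrightarrow>
    partial_deriv i (\<lambda>x. f x * g x) x = f x * partial_deriv i g x + partial_deriv i f x * g x"
  unfolding frechet_derivative_works
  by (subst partial_deriv_eqI[OF has_derivative_mult]) (auto simp: partial_deriv_def)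

lemma partial_deriv_sum:
  "finite A \<Longrightarrow> (\<And>a. a \<in> A \<Longrightarrow> f a differentiable (at x)) \<Longrightarrow>
    partial_deriv i (\<lambda>x. \<Sum>a\<in>A. f a x) x = (\<Sum>a\<in>A. partial_deriv i (f a) x)"
  by (induction A rule: finite_induct) (simp_all add: partial_deriv_add differentiable_sum)

text \<open>Differentiability up to order n + 1, a finite-order form of \<open>C_infinity\<close>. A
  derivative is taken first and a lower order is then asked of the result, so that product, quotient
  and chain rule can be used in an induction on n; \<open>partial_derivs\<close> adds new
  derivatives on the outside instead.\<close>

primrec diff_order :: "nat \<Rightarrow> (real^'n::finite) set \<Rightarrow> (real^'n \<Rightarrow> real) \<Rightarrow> bool" where
  "diff_order 0 S f \<longleftrightarrow> (\<forall>x\<in>S. f differentiable (at x))"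
| "diff_order (Suc n) S f \<longleftrightarrow> (\<forall>x\<in>S. f differentiable (at x)) \<and> (\<forall>i. diff_order n S (partial_deriv i f))"

lemma diff_order_differentiable: "diff_order n S f \<Longrightarrow> x \<in> S \<Longrightarrow> f differentiable (at x)"
  by (cases n) auto

text \<open>The formulas for partial derivatives of sums, products, inverses and the norm hold on S
  only. This lemma lets them replace \<open>partial_deriv i f\<close> in the inductions that
  follow.\<close>

lemma diff_order_cong:
  assumes "open S" "\<And>x. x \<in> S \<Longrightarrow> f x = g x"
  shows "diff_order n S f \<longleftrightarrow> diff_order n S g"
  using assms(2)
proof (induction n arbitrary: f g)
  case 0
  have "f differentiable (at x) \<longleftrightarrow> g differentiable (at x)" if "x \<in> S" for x
    using has_derivative_transform_within_open[OF _ assms(1) that] 0 unfolding differentiable_def by metis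
  then show ?case by auto
next
  case (Suc n)
  have "f differentiable (at x) \<longleftrightarrow> g differentiable (at x)" if "x \<in> S" for x
    using has_derivative_transform_within_open[OF _ assms(1) that] Suc.prems unfolding differentiable_def by metis
  moreover have "diff_order n S (partial_deriv i f) \<longleftrightarrow> diff_order n S (partial_deriv i g)" for i
    by (rule Suc.IH) (rule partial_deriv_cong_open[OF assms(1)], use Suc.prems in auto)
  ultimately show ?case by auto
qed

lemma diff_order_SucD: "diff_order (Suc n) S f \<Longrightarrow> diff_order n S f"
  by (induction n arbitrary: f) auto

lemma diff_order_subset: "diff_order n S f \<Longrightarrow> T \<subseteq> S \<Longrightarrow> diff_order n T f"
  by (induction n arbitrary: f) auto

lemma diff_order_C_infinity:
  assumes "f \<in> C_infinity S"
  shows "diff_order n S f"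
proof -
  have "diff_order n S (partial_derivs I f)" for I
  proof (induction n arbitrary: I)
    case (Suc n)
    have "diff_order n S (partial_derivs (i # I) f)" for i by (rule Suc.IH)
    then show ?case using assms by (auto simp: C_infinity_def)
  qed (use assms in \<open>auto simp: C_infinity_def\<close>)
  from this[of "[]"] show ?thesis by simp
qed

lemma diff_order_const: "diff_order n S (\<lambda>x. c)"
proof (induction n arbitrary: c)
  case (Suc n)
  have "partial_deriv i (\<lambda>x. c) = (\<lambda>x. 0)" for i :: 'a by auto
  then show ?case using Suc by auto
qed auto

lemma diff_order_component:
  fixes S :: "(real^'n) set"
  shows "diff_order n S (\<lambda>x. x $ j)"
proof (cases n)
  case (Suc m)
  have D: "((\<lambda>x. x $ j) has_derivative (\<lambda>h. h $ j)) (at x)" for x :: "real^'n"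
    by (rule bounded_linear.has_derivative[OF bounded_linear_vec_nth has_derivative_ident])
  have "partial_deriv i (\<lambda>x. x $ j) = (\<lambda>x. axis i 1 $ j)" for i
    using partial_deriv_eqI[OF D] by auto
  with D show ?thesis unfolding Suc by (auto simp: diff_order_const differentiable_def)
qed (auto simp: differentiable_def intro!: bounded_linear.has_derivative[OF bounded_linear_vec_nth has_derivative_ident])

lemma diff_order_add:
  assumes "open S" "diff_order n S f" "diff_order n S g"
  shows "diff_order n S (\<lambda>x. f x + g x)"
  using assms(2,3)
proof (induction n arbitrary: f g)
  case (Suc n)
  have "diff_order n S (partial_deriv i (\<lambda>x. f x + g x))" for i
  proof -
    have "diff_order n S (\<lambda>x. partial_deriv i f x + partial_deriv i g x)"
      using Suc by auto
    then show ?thesis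
      by (rule diff_order_cong[OF assms(1), THEN iffD1, rotated])
        (use Suc.prems in \<open>auto simp: partial_deriv_add\<close>)
  qed
  then show ?case using Suc.prems by auto
qed auto

lemma diff_order_mult:
  assumes "open S" "diff_order n S f" "diff_order n S g"
  shows "diff_order n S (\<lambda>x. f x * g x)"
  using assms(2,3)
proof (induction n arbitrary: f g)
  case (Suc n)
  have "diff_order n S (partial_deriv i (\<lambda>x. f x * g x))" for i
  proof -
    have "diff_order n S (\<lambda>x. f x * partial_deriv i g x + partial_deriv i f x * g x)"
      using Suc.prems by (intro diff_order_add[OF assms(1)] Suc.IH) (auto intro: diff_order_SucD)
    then show ?thesis
      by (rule diff_order_cong[OF assms(1), THEN iffD1, rotated])
        (use Suc.prems in \<open>auto simp: partial_deriv_mult\<close>)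
  qed
  then show ?case using Suc.prems by auto
qed auto

lemma diff_order_minus: "open S \<Longrightarrow> diff_order n S f \<Longrightarrow> diff_order n S (\<lambda>x. - f x)"
  using diff_order_mult[OF _ diff_order_const[of n S "-1"], of f] by simp

lemma diff_order_diff:
  "open S \<Longrightarrow> diff_order n S f \<Longrightarrow> diff_order n S g \<Longrightarrow> diff_order n S (\<lambda>x. f x - g x)"
  using diff_order_add[OF _ _ diff_order_minus, of S n f g] by simp

lemma diff_order_sum:
  "open S \<Longrightarrow> (\<And>a. a \<in> A \<Longrightarrow> diff_order n S (f a)) \<Longrightarrow> diff_order n S (\<lambda>x. \<Sum>a\<in>A. f a x)"
  by (induction A rule: infinite_finite_induct) (auto intro: diff_order_const diff_order_add)

lemma diff_order_power: "open S \<Longrightarrow> diff_order n S f \<Longrightarrow> diff_order n S (\<lambda>x. f x ^ m)"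
  by (induction m) (auto intro: diff_order_const diff_order_mult)

lemma diff_order_inverse:
  assumes "open S" "diff_order n S f" "\<And>x. x \<in> S \<Longrightarrow> f x \<noteq> 0"
  shows "diff_order n S (\<lambda>x. inverse (f x))"
  using assms(2)
proof (induction n)
  case (Suc n)
  have "diff_order n S (partial_deriv i (\<lambda>x. inverse (f x)))" for i
  proof -
    \<comment> \<open>The derivative of 1 / f contains 1 / f again, but at an order lower by one,
      which the induction hypothesis covers.\<close>
    have "diff_order n S (\<lambda>x. - (inverse (f x) * partial_deriv i f x * inverse (f x)))"
      using Suc by (intro diff_order_minus diff_order_mult assms(1) Suc.IH) (auto intro: diff_order_SucD)
    moreover have "- (inverse (f x) * partial_deriv i f x * inverse (f x)) = partial_deriv i (\<lambda>x. inverse (f x)) x" if "x \<in> S" for x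
    proof -
      have "(f has_derivative frechet_derivative f (at x)) (at x)"
        using Suc.prems that by (auto simp: frechet_derivative_works)
      then have "((\<lambda>x. inverse (f x)) has_derivative
          (\<lambda>h. - (inverse (f x) * frechet_derivative f (at x) h * inverse (f x)))) (at x)"
        using assms(3)[OF that] by (rule Deriv.has_derivative_inverse[rotated])
      from partial_deriv_eqI[OF this] show ?thesis by (simp add: partial_deriv_def)
    qed
    ultimately show ?thesis
      using diff_order_cong[OF assms(1)] by (metis (no_types, lifting))
  qed
  then show ?case using Suc.prems assms(3) by auto
qed (use assms(3) in auto)

lemma partial_deriv_norm:
  assumes "x \<noteq> (0::real^'n)"
  shows "partial_deriv i norm x = x $ i * inverse (norm x)"
  by (subst partial_deriv_eqI[OF has_derivative_norm[OF assms]])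
    (simp add: inner_axis' sgn_div_norm mult.commute)

lemma diff_order_norm:
  fixes S :: "(real^'n) set"
  assumes "open S" "0 \<notin> S"
  shows "diff_order n S norm"
proof (induction n)
  case 0
  have "x \<noteq> 0" if "x \<in> S" for x using assms(2) that by blast
  then show ?case using differentiable_norm_at by auto
next
  case (Suc n)
  have nz: "x \<noteq> 0" if "x \<in> S" for x using assms(2) that by blast
  have "diff_order n S (partial_deriv i norm)" for i
  proof -
    have "diff_order n S (\<lambda>x. x $ i * inverse (norm x))"
      using Suc nz by (intro diff_order_mult diff_order_inverse diff_order_component assms(1)) auto
    then show ?thesis
      by (rule diff_order_cong[OF assms(1), THEN iffD1, rotated]) (simp add: partial_deriv_norm nz)
  qed
  then show ?case using nz differentiable_norm_at by auto
qed

text \<open>The sequence h lists successive derivatives of one function of r. Differentiating in x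
  raises m by one and multiplies by x / |x|, so the induction on n is carried out for all m at
  once.\<close>

lemma diff_order_compose_norm:
  fixes S :: "(real^'n) set"
  assumes S: "open S" "0 \<notin> S" and h: "\<And>m x. x \<in> S \<Longrightarrow> (h m has_real_derivative h (Suc m) (norm x)) (at (norm x))"
  shows "diff_order n S (\<lambda>x. h m (norm x))"
proof (induction n arbitrary: m)
  have nz: "x \<noteq> 0" if "x \<in> S" for x using S(2) that by blast
  have D: "((\<lambda>x. h m (norm x)) has_derivative (\<lambda>y. (y \<bullet> sgn x) * h (Suc m) (norm x))) (at x)" if "x \<in> S" for x m
    using has_derivative_compose[OF has_derivative_norm[OF nz[OF that]], of "h m" "(*) (h (Suc m) (norm x))"] h[OF that, of m]
    by (simp add: has_field_derivative_def mult.commute)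
  {
    case 0
    show ?case using D by (auto simp: differentiable_def)
  next
    case (Suc n)
    have "diff_order n S (partial_deriv i (\<lambda>x. h m (norm x)))" for i
    proof -
      have "diff_order n S (\<lambda>x. x $ i * inverse (norm x) * h (Suc m) (norm x))"
        using Suc nz by (intro diff_order_mult diff_order_inverse diff_order_component diff_order_norm S) auto
      then show ?thesis
        by (rule diff_order_cong[OF S(1), THEN iffD1, rotated])
          (subst partial_deriv_eqI[OF D], simp_all add: inner_axis' sgn_div_norm mult.commute)
    qed
    then show ?case using D by (auto simp: differentiable_def)
  }
qed

text \<open>With u = sgn x of norm 1 this is u u^T + c (I - u u^T): the eigenvalue is 1 along u and
  c on the orthogonal complement. For a fixed x \<noteq> 0 these matrices multiply like the numbers
  c, so inverses and square roots are immediate.\<close>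

definition radial_matrix :: "real \<Rightarrow> real^'n::finite \<Rightarrow> real^'n^'n" where
  "radial_matrix c x = (\<chi> i l. (if i = l then c else 0) + (1 - c) * (sgn x $ i * sgn x $ l))"

lemma sum_sgn_sq: "x \<noteq> 0 \<Longrightarrow> (\<Sum>i\<in>UNIV. sgn (x::real^'n) $ i * sgn x $ i) = 1"
  using norm_sgn[of x] by (simp add: norm_eq_1 inner_vec_def)

lemma radial_matrix_mult:
  assumes "x \<noteq> 0"
  shows "radial_matrix c x ** radial_matrix d x = radial_matrix (c * d) x"
proof -
  define u where "u = sgn x"
  have u: "(\<Sum>i\<in>UNIV. u $ i * u $ i) = 1" using sum_sgn_sq[OF assms] by (simp add: u_def)
  have "(\<Sum>k\<in>UNIV. ((if i = k then c else 0) + (1 - c) * (u $ i * u $ k)) * ((if k = l then d else 0) + (1 - d) * (u $ k * u $ l)))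
    = (if i = l then c * d else 0) + (1 - c * d) * (u $ i * u $ l)" for i l
  proof -
    have "(\<Sum>k\<in>UNIV. ((if i = k then c else 0) + (1 - c) * (u $ i * u $ k)) * ((if k = l then d else 0) + (1 - d) * (u $ k * u $ l)))
      = (\<Sum>k\<in>UNIV. (if i = k then c * (if k = l then d else 0) else 0) + (if i = k then c * ((1 - d) * (u $ k * u $ l)) else 0)
          + (if k = l then (1 - c) * (u $ i * u $ k) * d else 0) + (1 - c) * (1 - d) * (u $ i * u $ l) * (u $ k * u $ k))"
      by (intro sum.cong) (auto simp: algebra_simps)
    also have "\<dots> = c * (if i = l then d else 0) + c * ((1 - d) * (u $ i * u $ l)) + (1 - c) * (u $ i * u $ l) * d
        + (1 - c) * (1 - d) * (u $ i * u $ l)"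
      by (simp add: sum.distrib flip: sum_distrib_left add: u)
    finally show ?thesis by (simp add: algebra_simps)
  qed
  then show ?thesis
    unfolding radial_matrix_def matrix_matrix_mult_def u_def[symmetric] by (simp add: vec_eq_iff)
qed

lemma radial_matrix_1: "radial_matrix 1 x = mat 1"
  by (simp add: radial_matrix_def mat_def vec_eq_iff)

lemma radial_matrix_sgn:
  assumes "x \<noteq> 0"
  shows "(\<Sum>l\<in>UNIV. radial_matrix c x $ i $ l * sgn x $ l) = sgn x $ i"
proof -
  have "(\<Sum>l\<in>UNIV. radial_matrix c x $ i $ l * sgn x $ l)
    = (\<Sum>l\<in>UNIV. (if i = l then c * sgn x $ l else 0) + (1 - c) * sgn x $ i * (sgn x $ l * sgn x $ l))"
    by (intro sum.cong) (auto simp: radial_matrix_def algebra_simps)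
  also have "\<dots> = c * sgn x $ i + (1 - c) * sgn x $ i"
    by (simp add: sum.distrib flip: sum_distrib_left add: sum_sgn_sq[OF assms])
  finally show ?thesis by (simp add: algebra_simps)
qed

lemma radial_matrix_sym: "radial_matrix c x $ i $ l = radial_matrix c x $ l $ i"
  by (simp add: radial_matrix_def mult.commute)

lemma matrix_inv_eqI:
  fixes A :: "real^'n^'n"
  assumes "A ** B = mat 1" "B ** A = mat 1"
  shows "matrix_inv A = B"
proof -
  have "A ** matrix_inv A = mat 1 \<and> matrix_inv A ** A = mat 1"
    unfolding matrix_inv_def by (rule someI[of _ B]) (use assms in blast)
  then show ?thesis by (metis assms(2) matrix_mul_assoc matrix_mul_lid matrix_mul_rid)
qed

lemma matrix_inv_radial_matrix:
  assumes "x \<noteq> 0" "c \<noteq> 0"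
  shows "matrix_inv (radial_matrix c x) = radial_matrix (inverse c) x"
  using assms by (intro matrix_inv_eqI) (simp_all add: radial_matrix_mult radial_matrix_1)

text \<open>The eigenvalue c has multiplicity N - 1. An orthogonal matrix with \<open>sgn x\<close>
  as one of its columns brings the matrix to diagonal form.\<close>

lemma det_radial_matrix:
  fixes x :: "real^'n"
  assumes "x \<noteq> 0"
  shows "det (radial_matrix c x) = c ^ (CARD('n) - 1)"
proof -
  \<comment> \<open>Any index serves; it marks the coordinate axis that is rotated to the radial
    direction.\<close>
  obtain k :: 'n where True by simp
  obtain f :: "real^'n \<Rightarrow> real^'n" where f: "orthogonal_transformation f" "f (axis k 1) = sgn x"
    by (rule orthogonal_transformation_exists_1[of "axis k 1" "sgn x"]) (use assms in \<open>auto simp: norm_sgn\<close>)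
  define Q where "Q = matrix f"
  have Q: "orthogonal_matrix Q" using f(1) unfolding Q_def orthogonal_transformation_matrix by blast
  have Qk: "Q $ i $ k = sgn x $ i" for i
    by (simp only: Q_def matrix_def vec_lambda_beta f(2))
  define D :: "real^'n^'n" where "D = (\<chi> i l. if i = l then (if i = k then 1 else c) else 0)"
  have "radial_matrix c x ** Q = Q ** D"
  proof -
    have qq: "(\<Sum>l\<in>UNIV. sgn x $ l * Q $ l $ m) = (if m = k then 1 else 0)" for m
    proof -
      have "transpose Q ** Q = mat 1" using Q by (simp add: orthogonal_matrix)
      then have "(transpose Q ** Q) $ k $ m = mat 1 $ k $ m" by simp
      then show ?thesis by (auto simp: matrix_matrix_mult_def transpose_def Qk mat_def)
    qed
    have "(\<Sum>l\<in>UNIV. radial_matrix c x $ i $ l * Q $ l $ m) = (\<Sum>l\<in>UNIV. Q $ i $ l * D $ l $ m)" for i m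
    proof -
      have "(\<Sum>l\<in>UNIV. radial_matrix c x $ i $ l * Q $ l $ m)
        = (\<Sum>l\<in>UNIV. (if i = l then c * Q $ l $ m else 0) + (1 - c) * sgn x $ i * (sgn x $ l * Q $ l $ m))"
        by (intro sum.cong) (auto simp: radial_matrix_def algebra_simps)
      also have "\<dots> = c * Q $ i $ m + (1 - c) * sgn x $ i * (if m = k then 1 else 0)"
        by (simp only: sum.distrib sum_distrib_left[symmetric] qq) simp
      also have "\<dots> = (if m = k then 1 else c) * Q $ i $ m" by (auto simp: Qk algebra_simps)
      also have "\<dots> = (\<Sum>l\<in>UNIV. if l = m then Q $ i $ l * (if m = k then 1 else c) else 0)" by simp
      also have "\<dots> = (\<Sum>l\<in>UNIV. Q $ i $ l * D $ l $ m)" by (intro sum.cong) (auto simp: D_def)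
      finally show ?thesis .
    qed
    then show ?thesis by (simp add: matrix_matrix_mult_def vec_eq_iff)
  qed
  then have "det (radial_matrix c x) * det Q = det Q * det D" by (metis det_mul)
  moreover have "det Q \<noteq> 0" using det_orthogonal_matrix[OF Q] by auto
  ultimately have "det (radial_matrix c x) = det D" by simp
  also have "\<dots> = (\<Prod>i\<in>UNIV. D $ i $ i)" by (rule det_diagonal) (simp add: D_def)
  also have "\<dots> = (\<Prod>i\<in>UNIV - {k}. c)"
    by (subst prod.remove[of _ k]) (auto simp: D_def intro!: prod.cong)
  finally show ?thesis by (simp add: card_Diff_singleton)
qed

text \<open>The derivative is the orthogonal projection to the tangent space of the sphere, divided
  by |x|.\<close>

lemma has_derivative_sgn:
  fixes x :: "'a::real_inner"
  assumes "x \<noteq> 0"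
  shows "(sgn has_derivative (\<lambda>h. inverse (norm x) *\<^sub>R (h - (h \<bullet> sgn x) *\<^sub>R sgn x))) (at x)"
proof -
  have "((\<lambda>x. inverse (norm x) *\<^sub>R x) has_derivative
     (\<lambda>h. inverse (norm x) *\<^sub>R h + (- (inverse (norm x) * (h \<bullet> sgn x) * inverse (norm x))) *\<^sub>R x)) (at x)"
    using assms by (intro has_derivative_scaleR Deriv.has_derivative_inverse has_derivative_norm has_derivative_ident) auto
  then show ?thesis
    unfolding sgn_div_norm by (rule has_derivative_eq_rhs) (auto simp: algebra_simps sgn_div_norm)
qed

text \<open>With u = sgn x and r = |x|, dr is the pairing with u, so dr^2 has the matrix u u^T,
  while the metric of the sphere pulls back to (I - u u^T) / r^2. Hence the tangential eigenvalue
  (\<phi>(r) / r)^2.\<close>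

lemma warped_metric_eq_radial_matrix:
  fixes x :: "real^'n"
  assumes "x \<noteq> 0"
  shows "warped_metric \<phi> x = radial_matrix ((\<phi> (norm x) / norm x)\<^sup>2) x"
proof -
  have dr: "frechet_derivative norm (at x) = (\<lambda>h. h \<bullet> sgn x)"
    using frechet_derivative_at[OF has_derivative_norm[OF assms]] by simp
  have ds: "frechet_derivative sgn (at x) = (\<lambda>h. inverse (norm x) *\<^sub>R (h - (h \<bullet> sgn x) *\<^sub>R sgn x))"
    using frechet_derivative_at[OF has_derivative_sgn[OF assms]] by simp
  have ss: "sgn x \<bullet> sgn x = 1" using norm_sgn[of x] assms by (simp add: norm_eq_1)
  have "axis i 1 $ l = (if i = l then 1 else (0::real))" for i l :: 'n
    by (simp add: axis_def)
  then have e: "(inverse (norm x) *\<^sub>R (axis i 1 - (axis i 1 \<bullet> sgn x) *\<^sub>R sgn x)) \<bullet> (inverse (norm x) *\<^sub>R (axis l 1 - (axis l 1 \<bullet> sgn x) *\<^sub>R sgn x))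
    = ((if i = l then 1 else 0) - sgn x $ i * sgn x $ l) / (norm x)\<^sup>2" for i l
    by (simp add: inner_diff_left inner_diff_right inner_axis' inner_axis inner_axis_axis ss power2_eq_square divide_inverse algebra_simps)
  have "warped_metric \<phi> x $ i $ l = sgn x $ i * sgn x $ l + (\<phi> (norm x))\<^sup>2 * (((if i = l then 1 else 0) - sgn x $ i * sgn x $ l) / (norm x)\<^sup>2)" for i l
    using assms by (simp only: warped_metric_def if_False Let_def vec_lambda_beta dr ds e) (simp add: inner_axis')
  then show ?thesis
    by (simp add: vec_eq_iff radial_matrix_def power_divide algebra_simps diff_divide_distrib)
qed

section \<open>The radial component of covariant derivatives\<close>

lemma finite_lists_len [simp]: "finite {I::'n::finite list. length I = j}"
  using finite_lists_length_eq[of "UNIV::'n set" j] by simp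

lemma sum_lists_Suc:
  fixes f :: "'n::finite list \<Rightarrow> 'b::comm_monoid_add"
  shows "(\<Sum>I | length I = Suc j. f I) = (\<Sum>i\<in>UNIV. \<Sum>I | length I = j. f (i # I))"
proof -
  have "(\<Sum>i\<in>UNIV. \<Sum>I | length I = j. f (i # I)) = (\<Sum>(i, I)\<in>UNIV \<times> {I. length I = j}. f (i # I))"
    by (simp add: sum.cartesian_product)
  also have "\<dots> = (\<Sum>I | length I = Suc j. f I)"
    by (rule sum.reindex_bij_witness[of _ "\<lambda>I. (hd I, tl I)" "\<lambda>(i, I). i # I"]) (auto simp: length_Suc_conv)
  finally show ?thesis ..
qed

text \<open>Distributivity: expanding a product of j sums gives one term for each list of length
  j.\<close>

lemma sum_lists_prod:
  fixes f :: "nat \<Rightarrow> 'n::finite \<Rightarrow> 'b::comm_semiring_1"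
  shows "(\<Sum>I | length I = j. \<Prod>s<j. f s (I ! s)) = (\<Prod>s<j. \<Sum>i\<in>UNIV. f s i)"
proof (induction j arbitrary: f)
  case (Suc j)
  have "(\<Sum>I | length I = Suc j. \<Prod>s<Suc j. f s (I ! s))
      = (\<Sum>i\<in>UNIV. \<Sum>I | length I = j. f 0 i * (\<Prod>s<j. f (Suc s) (I ! s)))"
    by (simp add: sum_lists_Suc prod.lessThan_Suc_shift del: prod.lessThan_Suc)
  also have "\<dots> = (\<Sum>i\<in>UNIV. f 0 i) * (\<Prod>s<j. \<Sum>i\<in>UNIV. f (Suc s) i)"
    by (simp only: sum_distrib_left[symmetric] sum_distrib_right[symmetric] Suc.IH[of "\<lambda>s. f (Suc s)"])
  finally show ?case by (simp add: prod.lessThan_Suc_shift del: prod.lessThan_Suc)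
qed simp

text \<open>The map from (I, c) to (I[s := c], I ! s) is its own inverse. Summing all slot sums
  therefore counts every list as often as there are indices, and a positive multiple of the total is
  0.\<close>

lemma sum_lists_eq_0:
  fixes h :: "'n::finite list \<Rightarrow> real"
  assumes "s < j" "\<And>I. length I = j \<Longrightarrow> (\<Sum>c\<in>UNIV. h (I[s := c])) = 0"
  shows "(\<Sum>I | length I = j. h I) = 0"
proof -
  have "(\<Sum>(I, c)\<in>{I. length I = j} \<times> (UNIV::'n set). h (I[s := c])) = (\<Sum>(I, c)\<in>{I. length I = j} \<times> (UNIV::'n set). h I)"
    using assms(1)
    by (intro sum.reindex_bij_witness[of _ "\<lambda>(I, c). (I[s := c], I ! s)" "\<lambda>(I, c). (I[s := c], I ! s)"]) auto
  then have "(\<Sum>I | length I = j. \<Sum>c\<in>UNIV. h (I[s := c])) = (\<Sum>I | length I = j. \<Sum>c\<in>(UNIV::'n set). h I)"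
    by (simp only: sum.cartesian_product)
  then have "real CARD('n) * (\<Sum>I | length I = j. h I) = 0"
    using assms(2) by (simp add: sum_distrib_left)
  then show ?thesis by simp
qed

lemma prod_list_update:
  fixes u :: "'n \<Rightarrow> 'b::comm_monoid_mult"
  assumes "s < length I" "length I = j"
  shows "(\<Prod>k<j. u (I[s := c] ! k)) = u c * (\<Prod>k\<in>{..<j} - {s}. u (I ! k))"
  using assms by (subst prod.remove[of _ s]) (auto intro!: prod.cong)

definition radial_component :: "nat \<Rightarrow> real^'n::finite \<Rightarrow> ('n list \<Rightarrow> real) \<Rightarrow> real" where
  "radial_component j u T = (\<Sum>I | length I = j. (\<Prod>s<j. u $ (I ! s)) * T I)"

text \<open>The component of T in the frame formed by the columns of A, namely T applied to the
  columns numbered by K. If A A^T is the inverse metric, this frame is orthonormal.\<close>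

definition frame_component :: "nat \<Rightarrow> real^'n^'n \<Rightarrow> ('n::finite list \<Rightarrow> real) \<Rightarrow> 'n list \<Rightarrow> real" where
  "frame_component j A T K = (\<Sum>I | length I = j. (\<Prod>s<j. A $ (I ! s) $ (K ! s)) * T I)"

lemma frame_component_compose:
  fixes A B :: "real^'n^'n"
  shows "(\<Sum>K | length K = j. (\<Prod>s<j. B $ (K ! s) $ (L ! s)) * frame_component j A T K) = frame_component j (A ** B) T L"
proof -
  have "(\<Sum>K | length K = j. (\<Prod>s<j. B $ (K ! s) $ (L ! s)) * frame_component j A T K)
    = (\<Sum>I | length I = j. (\<Sum>K | length K = j. \<Prod>s<j. A $ (I ! s) $ (K ! s) * B $ (K ! s) $ (L ! s)) * T I)"
    unfolding frame_component_def sum_distrib_left sum_distrib_right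
    by (subst sum.swap) (simp add: prod.distrib mult_ac)
  also have "\<dots> = (\<Sum>I | length I = j. (\<Prod>s<j. (A ** B) $ (I ! s) $ (L ! s)) * T I)"
    by (simp add: sum_lists_prod[of "\<lambda>s k. A $ (I ! s) $ k * B $ k $ (L ! s)" j for I] matrix_matrix_mult_def)
  finally show ?thesis by (simp add: frame_component_def)
qed

text \<open>If A A^T is the inverse metric, the right-hand side is the radicand in
  \<open>tensor_norm\<close>, which is thereby seen to be a sum of squares.\<close>

lemma sum_frame_component_sq:
  fixes A :: "real^'n^'n"
  shows "(\<Sum>K | length K = j. (frame_component j A T K)\<^sup>2)
    = (\<Sum>I | length I = j. \<Sum>L | length L = j. (\<Prod>s<j. (A ** transpose A) $ (I ! s) $ (L ! s)) * T I * T L)"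
proof -
  have "(\<Sum>K | length K = j. (frame_component j A T K)\<^sup>2)
    = (\<Sum>K | length K = j. \<Sum>I | length I = j. \<Sum>L | length L = j.
        (\<Prod>s<j. A $ (I ! s) $ (K ! s) * A $ (L ! s) $ (K ! s)) * T I * T L)"
    by (simp add: frame_component_def power2_eq_square sum_product prod.distrib mult_ac)
  also have "\<dots> = (\<Sum>I | length I = j. \<Sum>K | length K = j. \<Sum>L | length L = j.
        (\<Prod>s<j. A $ (I ! s) $ (K ! s) * A $ (L ! s) $ (K ! s)) * T I * T L)"
    by (rule sum.swap)
  also have "\<dots> = (\<Sum>I | length I = j. \<Sum>L | length L = j. \<Sum>K | length K = j.
        (\<Prod>s<j. A $ (I ! s) $ (K ! s) * A $ (L ! s) $ (K ! s)) * T I * T L)"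
    by (intro sum.cong refl sum.swap)
  also have "\<dots> = (\<Sum>I | length I = j. \<Sum>L | length L = j.
        (\<Prod>s<j. (A ** transpose A) $ (I ! s) $ (L ! s)) * T I * T L)"
    by (simp add: sum_lists_prod[of "\<lambda>s k. A $ (I ! s) $ k * A $ (L ! s) $ k" j for I L]
        matrix_matrix_mult_def transpose_def flip: sum_distrib_right)
  finally show ?thesis .
qed

section \<open>The warped metric away from the origin\<close>

lemma open_eball0 [simp]: "open (eball0 R :: (real^'n) set)"
  unfolding eball0_def by (intro open_Collect_less continuous_intros)

definition punctured_ball :: "ereal \<Rightarrow> (real^'n::finite) set" where
  "punctured_ball R = eball0 R - {0}"

lemma open_punctured_ball [simp]: "open (punctured_ball R :: (real^'n) set)"
  unfolding punctured_ball_def by (intro open_Diff) auto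

lemma punctured_ballD: "x \<in> punctured_ball R \<Longrightarrow> x \<noteq> 0 \<and> norm x > 0 \<and> ereal (norm x) < R"
  by (auto simp: punctured_ball_def eball0_def)

lemma ray_in_punctured_ball:
  "(x::real^'n) \<noteq> 0 \<Longrightarrow> r \<in> einterval 0 R \<Longrightarrow> r *\<^sub>R sgn x \<in> punctured_ball R"
  by (auto simp: punctured_ball_def eball0_def einterval_iff norm_sgn sgn_zero_iff)

lemma sgn_ray: "x \<noteq> 0 \<Longrightarrow> r > 0 \<Longrightarrow> sgn (r *\<^sub>R sgn x) = sgn (x::'a::real_normed_vector)"
  by (simp add: sgn_scaleR sgn_div_norm[of "sgn x"] norm_sgn)

lemma diff_order_radial_matrix:
  fixes S :: "(real^'n) set"
  assumes "open S" "0 \<notin> S" "diff_order n S h"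
  shows "diff_order n S (\<lambda>x. radial_matrix (h x) x $ i $ l)"
proof -
  have nz: "norm x \<noteq> 0" if "x \<in> S" for x using assms(2) that by auto
  have "diff_order n S (\<lambda>x. sgn x $ k)" for k
  proof -
    have "(\<lambda>x::real^'n. sgn x $ k) = (\<lambda>x. x $ k * inverse (norm x))"
      by (simp add: sgn_div_norm mult.commute)
    then show ?thesis
      using nz by (simp only:) (intro diff_order_mult diff_order_inverse diff_order_component diff_order_norm assms)
  qed
  moreover have "diff_order n S (\<lambda>x. if i = l then h x else 0)"
    using assms(3) diff_order_const[of n S 0] by (cases "i = l") auto
  ultimately show ?thesis
    unfolding radial_matrix_def vec_lambda_beta
    by (intro diff_order_add diff_order_mult diff_order_diff diff_order_const assms)
qed

locale warped_ball =
  fixes R :: ereal and \<phi> :: "real \<Rightarrow> real"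
  assumes R_pos: "0 < R" and warp: "warping_function R \<phi>"
begin

abbreviation \<Omega> :: "(real^'n::finite) set" where
  "\<Omega> \<equiv> punctured_ball R"

abbreviation metric :: "real^'n::finite \<Rightarrow> real^'n^'n" where
  "metric \<equiv> warped_metric \<phi>"

abbreviation cov :: "nat \<Rightarrow> (real^'n::finite \<Rightarrow> real) \<Rightarrow> real^'n \<Rightarrow> 'n list \<Rightarrow> real" where
  "cov \<equiv> nabla metric"

abbreviation tnorm :: "nat \<Rightarrow> real^'n::finite \<Rightarrow> ('n list \<Rightarrow> real) \<Rightarrow> real" where
  "tnorm \<equiv> tensor_norm metric"

abbreviation pnorm :: "real \<Rightarrow> nat \<Rightarrow> (real^'n::finite \<Rightarrow> 'n list \<Rightarrow> real) \<Rightarrow> real" where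
  "pnorm \<equiv> Lp_norm (eball0 R) metric"

text \<open>The ratio by which the metric stretches Euclidean lengths tangent to the spheres about
  the origin. Its power N - 1 is the density of the Riemannian volume.\<close>

definition warp_factor :: "real^'n::finite \<Rightarrow> real" where
  "warp_factor x = \<phi> (norm x) / norm x"

lemma phi_pos: "t \<in> einterval 0 R \<Longrightarrow> \<phi> t > 0"
  using warp by (auto simp: warping_function_def Let_def)

text \<open>The derivatives of \<phi> are taken relative to [0, R); at interior points they are
  ordinary two-sided derivatives.\<close>

lemma phi_derivs:
  assumes "t \<in> einterval 0 R"
  shows "(nth_deriv {t. 0 \<le> t \<and> ereal t < R} m \<phi> has_real_derivative
     nth_deriv {t. 0 \<le> t \<and> ereal t < R} (Suc m) \<phi> t) (at t)"
proof (rule has_real_derivative_nth_deriv)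
  show "\<phi> \<in> C_infinity1 {t. 0 \<le> t \<and> ereal t < R}"
    using warp by (auto simp: warping_function_def Let_def)
  show "t \<in> interior {t. 0 \<le> t \<and> ereal t < R}"
    using assms by (intro interiorI[of "einterval 0 R"]) (auto simp: einterval_iff)
qed

lemma continuous_phi: "continuous_on (einterval 0 R) \<phi>"
  using phi_derivs[of _ 0] by (intro continuous_at_imp_continuous_on ballI) (auto intro: DERIV_isCont)

lemma norm_in_einterval: "x \<in> \<Omega> \<Longrightarrow> norm x \<in> einterval 0 R"
  using punctured_ballD[of x R] by (auto simp: einterval_iff)

lemma warp_factor_pos: "x \<in> \<Omega> \<Longrightarrow> warp_factor x > 0"
  using punctured_ballD[of x R] phi_pos[OF norm_in_einterval, of x] by (simp add: warp_factor_def)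

lemma diff_order_warp_factor: "diff_order n (\<Omega> :: (real^'n) set) warp_factor"
proof -
  have "diff_order n (\<Omega> :: (real^'n) set) (\<lambda>x. nth_deriv {t. 0 \<le> t \<and> ereal t < R} 0 \<phi> (norm x))"
    by (intro diff_order_compose_norm phi_derivs norm_in_einterval) (auto simp: punctured_ball_def)
  then show ?thesis
    unfolding warp_factor_def divide_inverse
    by (intro diff_order_mult diff_order_inverse diff_order_norm) (auto simp: punctured_ball_def)
qed

lemma metric_eq: "x \<in> \<Omega> \<Longrightarrow> metric x = radial_matrix ((warp_factor x)\<^sup>2) x"
  using warped_metric_eq_radial_matrix[of x \<phi>] punctured_ballD[of x R] by (simp add: warp_factor_def)

lemma inverse_metric_eq:
  "x \<in> \<Omega> \<Longrightarrow> matrix_inv (metric x) = radial_matrix (inverse ((warp_factor x)\<^sup>2)) x"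
  using metric_eq[of x] matrix_inv_radial_matrix[of x "(warp_factor x)\<^sup>2"] punctured_ballD[of x R] warp_factor_pos[of x] by simp

lemma sqrt_det_metric:
  fixes x :: "real^'n"
  assumes "x \<in> \<Omega>"
  shows "sqrt (det (metric x)) = warp_factor x ^ (CARD('n) - 1)"
  using assms metric_eq[of x] det_radial_matrix[of x] punctured_ballD[of x R] warp_factor_pos[of x]
  by (simp add: real_sqrt_power)

lemma diff_order_metric: "diff_order n \<Omega> (\<lambda>x. metric x $ i $ l)"
proof -
  have "diff_order n \<Omega> (\<lambda>x. radial_matrix ((warp_factor x)\<^sup>2) x $ i $ l)"
    by (intro diff_order_radial_matrix diff_order_power diff_order_warp_factor) (auto simp: punctured_ball_def)
  then show ?thesis by (rule diff_order_cong[THEN iffD1, rotated 2]) (auto simp: metric_eq)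
qed

lemma diff_order_inverse_metric: "diff_order n \<Omega> (\<lambda>x. matrix_inv (metric x) $ i $ l)"
proof -
  have "warp_factor x \<noteq> 0" if "x \<in> \<Omega>" for x :: "real^'a" using warp_factor_pos[OF that] by simp
  then have "diff_order n \<Omega> (\<lambda>x. radial_matrix (inverse ((warp_factor x)\<^sup>2)) x $ i $ l)"
    by (intro diff_order_radial_matrix diff_order_inverse diff_order_power diff_order_warp_factor) (auto simp: punctured_ball_def)
  then show ?thesis by (rule diff_order_cong[THEN iffD1, rotated 2]) (auto simp: inverse_metric_eq)
qed

lemma diff_order_christoffel: "diff_order n \<Omega> (\<lambda>x. christoffel metric x m i l)"
proof -
  have "diff_order n \<Omega> (partial_deriv a (\<lambda>y. metric y $ b $ c))" for a b c
    using diff_order_metric[of "Suc n" b c] by simp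
  then show ?thesis
    unfolding christoffel_def divide_inverse
    by (intro diff_order_mult diff_order_sum diff_order_diff diff_order_add diff_order_const diff_order_inverse_metric) auto
qed

text \<open>The order n stays arbitrary in the induction on j, since each covariant derivative uses
  up one order of differentiability.\<close>

lemma diff_order_nabla:
  assumes "U \<in> C_infinity (eball0 R)"
  shows "diff_order n \<Omega> (\<lambda>x. cov j U x I)"
proof (induction j arbitrary: n I)
  case 0
  show ?case using diff_order_C_infinity[OF assms, of n] by (auto intro: diff_order_subset simp: punctured_ball_def)
next
  case (Suc j)
  show ?case
  proof (cases I)
    case (Cons i J)
    have "diff_order n \<Omega> (partial_deriv i (\<lambda>x. cov j U x J))"
      using Suc[of "Suc n" J] by simp
    then show ?thesis unfolding nabla.simps cov_deriv_def Cons list.case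
      by (intro diff_order_diff diff_order_sum diff_order_mult diff_order_christoffel Suc) auto
  qed (simp add: cov_deriv_def diff_order_const)
qed

lemma nabla_differentiable:
  "U \<in> C_infinity (eball0 R) \<Longrightarrow> x \<in> \<Omega> \<Longrightarrow> (\<lambda>x. cov j U x I) differentiable (at x)"
  using diff_order_differentiable[OF diff_order_nabla[of U 0]] by blast

text \<open>The Cauchy condition concerns derivatives of differences, the convergence of tensor
  fields differences of derivatives. The identity is proved off the origin, where the components are
  known to be differentiable.\<close>

lemma nabla_diff:
  assumes "U \<in> C_infinity (eball0 R)" "V \<in> C_infinity (eball0 R)" "x \<in> \<Omega>"
  shows "cov j (\<lambda>x. U x - V x) x I = cov j U x I - cov j V x I"
  using assms(3)
proof (induction j arbitrary: I x)
  case (Suc j)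
  show ?case
  proof (cases I)
    case (Cons i J)
    have "partial_deriv i (\<lambda>x. cov j (\<lambda>x. U x - V x) x J) x
      = partial_deriv i (\<lambda>x. cov j U x J - cov j V x J) x"
      by (rule partial_deriv_cong_open[OF open_punctured_ball Suc.prems]) (rule Suc.IH)
    also have "\<dots> = partial_deriv i (\<lambda>x. cov j U x J) x - partial_deriv i (\<lambda>x. cov j V x J) x"
      using Suc.prems assms by (intro partial_deriv_diff nabla_differentiable)
    finally have 1: "partial_deriv i (\<lambda>x. cov j (\<lambda>x. U x - V x) x J) x =
      partial_deriv i (\<lambda>x. cov j U x J) x - partial_deriv i (\<lambda>x. cov j V x J) x" .
    show ?thesis
      by (simp add: Cons cov_deriv_def 1 Suc.IH[OF Suc.prems] right_diff_distrib sum_subtractf)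
  qed (simp add: cov_deriv_def)
qed simp

text \<open>The eigenvalue of the metric in the radial direction is 1. The identity is stated for x
  rather than \<open>sgn x\<close> because x has constant partial derivatives.\<close>

lemma metric_radial:
  assumes "x \<in> \<Omega>"
  shows "(\<Sum>l\<in>UNIV. metric x $ a $ l * x $ l) = x $ a"
proof -
  have x: "x \<noteq> 0" using punctured_ballD[OF assms] by simp
  have "x $ l = norm x * sgn x $ l" for l using x by (simp add: sgn_div_norm)
  then have "(\<Sum>l\<in>UNIV. metric x $ a $ l * x $ l)
     = norm x * (\<Sum>l\<in>UNIV. metric x $ a $ l * sgn x $ l)"
    by (simp add: sum_distrib_left mult_ac)
  also have "\<dots> = norm x * sgn x $ a" using radial_matrix_sgn[OF x] assms by (simp add: metric_eq)
  finally show ?thesis using x by (simp add: sgn_div_norm)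
qed

text \<open>Differentiating \<open>g x = x\<close> shows that the Christoffel symbols vanish on \<open>(x, x)\<close>.\<close>

lemma metric_derivative_radial:
  assumes "x \<in> \<Omega>"
  shows "(\<Sum>l\<in>UNIV. partial_deriv i (\<lambda>y. metric y $ a $ l) x * x $ l)
     = (if a = i then 1 else 0) - metric x $ a $ i"
proof -
  have d: "(\<lambda>y. metric y $ a $ l) differentiable (at x)" for l
    using diff_order_differentiable[OF diff_order_metric assms] by blast
  have c: "(\<lambda>y. y $ l) differentiable (at x)" for l :: 'a
    using diff_order_differentiable[OF diff_order_component assms] by blast
  have p: "partial_deriv i (\<lambda>y. y $ l) x = (if l = i then 1 else 0)" for l
    by (subst partial_deriv_eqI[OF bounded_linear.has_derivative[OF bounded_linear_vec_nth has_derivative_ident]])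
      (auto simp: axis_def)
  have "partial_deriv i (\<lambda>y. \<Sum>l\<in>UNIV. metric y $ a $ l * y $ l) x = partial_deriv i (\<lambda>y. y $ a) x"
    by (rule partial_deriv_cong_open[OF open_punctured_ball assms]) (rule metric_radial)
  moreover have "partial_deriv i (\<lambda>y. \<Sum>l\<in>UNIV. metric y $ a $ l * y $ l) x
    = (\<Sum>l\<in>UNIV. metric x $ a $ l * (if l = i then 1 else 0) + partial_deriv i (\<lambda>y. metric y $ a $ l) x * x $ l)"
    using d c by (subst partial_deriv_sum) (auto simp: partial_deriv_mult p)
  ultimately show ?thesis by (simp add: sum.distrib p if_distrib[of "(*) _"] cong: if_cong)
qed

section \<open>Rays as geodesics, and radial derivatives of covariant derivatives\<close>

lemma metric_sym: "x \<in> \<Omega> \<Longrightarrow> metric x $ a $ l = metric x $ l $ a"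
  by (simp add: metric_eq radial_matrix_sym)

text \<open>This is the geodesic equation for rays. Contracting any of the three derivatives of the
  metric with x twice leads to \<delta> - g contracted with x, which is 0 because g x = x.\<close>

lemma christoffel_radial_radial:
  assumes x: "x \<in> \<Omega>"
  shows "(\<Sum>i\<in>UNIV. \<Sum>l\<in>UNIV. x $ i * x $ l * christoffel metric x m i l) = 0"
proof -
  let ?D = "\<lambda>i a l. partial_deriv i (\<lambda>y. metric y $ a $ l) x"
  have Dsym: "?D i a l = ?D i l a" for i a l
    by (rule partial_deriv_cong_open[OF open_punctured_ball x]) (rule metric_sym)
  have 1: "(\<Sum>l\<in>UNIV. x $ l * ?D i a l) = (if a = i then 1 else 0) - metric x $ a $ i" for i a
    using metric_derivative_radial[OF x, of i a] by (simp add: mult.commute)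
  have 0: "(\<Sum>i\<in>UNIV. x $ i * ((if a = i then 1 else 0) - metric x $ a $ i)) = 0" for a
    using metric_radial[OF x, of a]
    by (simp add: right_diff_distrib sum_subtractf if_distrib[of "(*) _"] mult.commute cong: if_cong)
  then have 2: "(\<Sum>i\<in>UNIV. \<Sum>l\<in>UNIV. x $ i * x $ l * ?D i a l) = 0" for a
    by (simp add: mult.assoc flip: sum_distrib_left add: 1)
  have 3: "(\<Sum>i\<in>UNIV. \<Sum>l\<in>UNIV. x $ i * x $ l * ?D a i l) = 0" for a
  proof -
    have "(\<Sum>i\<in>UNIV. \<Sum>l\<in>UNIV. x $ i * x $ l * ?D a i l) = (\<Sum>i\<in>UNIV. x $ i * ((if i = a then 1 else 0) - metric x $ i $ a))"
      by (simp add: mult.assoc flip: sum_distrib_left add: 1)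
    also have "\<dots> = (\<Sum>i\<in>UNIV. x $ i * ((if a = i then 1 else 0) - metric x $ a $ i))"
      by (intro sum.cong) (auto simp: metric_sym[OF x])
    also have "\<dots> = 0" by (rule 0)
    finally show ?thesis .
  qed
  \<comment> \<open>The second term of the Christoffel symbol arises from the first by interchanging
    the two contracted indices.\<close>
  have 4: "(\<Sum>i\<in>UNIV. \<Sum>l\<in>UNIV. x $ i * x $ l * ?D l i a) = 0" for a
    by (subst sum.swap) (use 2[of a] in \<open>simp add: Dsym[of _ _ a] mult.commute\<close>)
  have "(\<Sum>i\<in>UNIV. \<Sum>l\<in>UNIV. x $ i * x $ l * christoffel metric x m i l)
    = (\<Sum>i\<in>UNIV. \<Sum>l\<in>UNIV. \<Sum>a\<in>UNIV. matrix_inv (metric x) $ m $ a / 2 *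
       (x $ i * x $ l * ?D i a l + x $ i * x $ l * ?D l i a - x $ i * x $ l * ?D a i l))"
  proof (intro sum.cong refl)
    fix i l
    show "x $ i * x $ l * christoffel metric x m i l = (\<Sum>a\<in>UNIV. matrix_inv (metric x) $ m $ a / 2 *
       (x $ i * x $ l * ?D i a l + x $ i * x $ l * ?D l i a - x $ i * x $ l * ?D a i l))"
      unfolding christoffel_def sum_distrib_left sum_divide_distrib
      by (intro sum.cong refl) (subst Dsym[of i l], simp add: field_simps)
  qed
  also have "\<dots> = (\<Sum>i\<in>UNIV. \<Sum>a\<in>UNIV. \<Sum>l\<in>UNIV. matrix_inv (metric x) $ m $ a / 2 *
       (x $ i * x $ l * ?D i a l + x $ i * x $ l * ?D l i a - x $ i * x $ l * ?D a i l))"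
    by (intro sum.cong refl sum.swap)
  also have "\<dots> = (\<Sum>a\<in>UNIV. \<Sum>i\<in>UNIV. \<Sum>l\<in>UNIV. matrix_inv (metric x) $ m $ a / 2 *
       (x $ i * x $ l * ?D i a l + x $ i * x $ l * ?D l i a - x $ i * x $ l * ?D a i l))"
    by (rule sum.swap)
  also have "\<dots> = 0"
    by (simp only: sum_distrib_left[symmetric] sum.distrib sum_subtractf 2 3 4) simp
  finally show ?thesis .
qed

lemma christoffel_sgn_sgn:
  assumes x: "x \<in> \<Omega>"
  shows "(\<Sum>i\<in>UNIV. \<Sum>l\<in>UNIV. sgn x $ i * sgn x $ l * christoffel metric x m i l) = 0"
proof -
  have "sgn x $ i * sgn x $ l * christoffel metric x m i l
     = inverse (norm x) * inverse (norm x) * (x $ i * x $ l * christoffel metric x m i l)" for i l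
    by (simp add: sgn_div_norm)
  then show ?thesis
    using christoffel_radial_radial[OF x, of m] by (simp only: sum_distrib_left[symmetric] mult_zero_right)
qed

text \<open>For each slot s, the correction term contracts a Christoffel symbol with u = sgn x both
  in the direction of differentiation and in slot s, and this double contraction vanishes. Only the
  partial derivatives of the components remain.\<close>

lemma radial_component_cov_deriv:
  assumes x: "x \<in> \<Omega>"
  shows "radial_component (Suc j) (sgn x) (cov_deriv metric T x)
    = (\<Sum>I | length I = j. (\<Prod>s<j. sgn x $ (I ! s)) * (\<Sum>i\<in>UNIV. sgn x $ i * partial_deriv i (\<lambda>y. T y I) x))"
proof -
  define u where "u = sgn x"
  define C where "C = christoffel metric x"
  define X where "X = (\<lambda>i I. (\<Sum>s<j. \<Sum>m\<in>UNIV. C m i (I ! s) * T x (I[s := m])))"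
  have C0: "(\<Sum>c\<in>UNIV. \<Sum>i\<in>UNIV. u $ c * u $ i * C m i c) = 0" for m
    using christoffel_sgn_sgn[OF x, of m] by (subst sum.swap) (simp add: u_def C_def mult.commute)
  have zero: "(\<Sum>I | length I = j. (\<Prod>k<j. u $ (I ! k)) * (\<Sum>i\<in>UNIV. u $ i * C m i (I ! s)) * T x (I[s := m])) = 0"
    if s: "s < j" for s m
  \<comment> \<open>Summing over the entry in slot s alone, together with the direction i, already
    produces the vanishing contraction; the other slots contribute a common factor.\<close>
  proof (rule sum_lists_eq_0[OF s])
    fix I :: "'a list" assume I: "length I = j"
    have "(\<Sum>c\<in>UNIV. (\<Prod>k<j. u $ (I[s := c] ! k)) * (\<Sum>i\<in>UNIV. u $ i * C m i (I[s := c] ! s)) * T x (I[s := c, s := m]))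
      = (\<Prod>k\<in>{..<j} - {s}. u $ (I ! k)) * T x (I[s := m]) * (\<Sum>c\<in>UNIV. \<Sum>i\<in>UNIV. u $ c * u $ i * C m i c)"
      using s I by (simp add: prod_list_update[of s I j "\<lambda>i. u $ i"] sum_distrib_left sum_distrib_right mult_ac)
    also have "\<dots> = 0" by (simp only: C0 mult_zero_right)
    finally show "(\<Sum>c\<in>UNIV. (\<Prod>k<j. u $ (I[s := c] ! k)) * (\<Sum>i\<in>UNIV. u $ i * C m i (I[s := c] ! s)) * T x (I[s := c, s := m])) = 0" .
  qed
  have "(\<Sum>I | length I = j. (\<Prod>k<j. u $ (I ! k)) * (\<Sum>i\<in>UNIV. u $ i * X i I))
    = (\<Sum>I | length I = j. \<Sum>s<j. \<Sum>m\<in>UNIV. (\<Prod>k<j. u $ (I ! k)) * (\<Sum>i\<in>UNIV. u $ i * C m i (I ! s)) * T x (I[s := m]))"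
  proof (rule sum.cong[OF refl])
    fix I :: "'a list"
    have "(\<Sum>i\<in>UNIV. u $ i * X i I)
      = (\<Sum>i\<in>UNIV. \<Sum>s<j. \<Sum>m\<in>UNIV. u $ i * C m i (I ! s) * T x (I[s := m]))"
      by (simp add: X_def sum_distrib_left mult.assoc)
    also have "\<dots> = (\<Sum>s<j. \<Sum>i\<in>UNIV. \<Sum>m\<in>UNIV. u $ i * C m i (I ! s) * T x (I[s := m]))"
      by (rule sum.swap)
    also have "\<dots> = (\<Sum>s<j. \<Sum>m\<in>UNIV. \<Sum>i\<in>UNIV. u $ i * C m i (I ! s) * T x (I[s := m]))"
      by (intro sum.cong refl sum.swap)
    also have "\<dots> = (\<Sum>s<j. \<Sum>m\<in>UNIV. (\<Sum>i\<in>UNIV. u $ i * C m i (I ! s)) * T x (I[s := m]))"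
      by (simp add: sum_distrib_right)
    finally have e: "(\<Sum>i\<in>UNIV. u $ i * X i I)
      = (\<Sum>s<j. \<Sum>m\<in>UNIV. (\<Sum>i\<in>UNIV. u $ i * C m i (I ! s)) * T x (I[s := m]))" .
    show "(\<Prod>k<j. u $ (I ! k)) * (\<Sum>i\<in>UNIV. u $ i * X i I)
      = (\<Sum>s<j. \<Sum>m\<in>UNIV. (\<Prod>k<j. u $ (I ! k)) * (\<Sum>i\<in>UNIV. u $ i * C m i (I ! s)) * T x (I[s := m]))"
      unfolding e by (simp add: sum_distrib_left sum_distrib_right mult_ac)
  qed
  also have "\<dots> = (\<Sum>s<j. \<Sum>I | length I = j. \<Sum>m\<in>UNIV. (\<Prod>k<j. u $ (I ! k)) * (\<Sum>i\<in>UNIV. u $ i * C m i (I ! s)) * T x (I[s := m]))"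
    by (rule sum.swap)
  also have "\<dots> = (\<Sum>s<j. \<Sum>m\<in>UNIV. \<Sum>I | length I = j. (\<Prod>k<j. u $ (I ! k)) * (\<Sum>i\<in>UNIV. u $ i * C m i (I ! s)) * T x (I[s := m]))"
    by (intro sum.cong refl sum.swap)
  also have "\<dots> = 0" by (intro sum.neutral ballI zero) auto
  finally have Z: "(\<Sum>I | length I = j. (\<Prod>k<j. u $ (I ! k)) * (\<Sum>i\<in>UNIV. u $ i * X i I)) = 0" .
  have "radial_component (Suc j) u (cov_deriv metric T x)
    = (\<Sum>i\<in>UNIV. \<Sum>I | length I = j. (\<Prod>s<j. u $ (I ! s)) * (u $ i * (partial_deriv i (\<lambda>y. T y I) x - X i I)))"
    unfolding radial_component_def sum_lists_Suc
    by (intro sum.cong refl) (simp add: prod.lessThan_Suc_shift cov_deriv_def X_def C_def mult_ac del: prod.lessThan_Suc)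
  also have "\<dots> = (\<Sum>I | length I = j. \<Sum>i\<in>UNIV. (\<Prod>s<j. u $ (I ! s)) * (u $ i * (partial_deriv i (\<lambda>y. T y I) x - X i I)))"
    by (rule sum.swap)
  also have "\<dots> = (\<Sum>I | length I = j. (\<Prod>s<j. u $ (I ! s)) * (\<Sum>i\<in>UNIV. u $ i * partial_deriv i (\<lambda>y. T y I) x))
     - (\<Sum>I | length I = j. (\<Prod>k<j. u $ (I ! k)) * (\<Sum>i\<in>UNIV. u $ i * X i I))"
    by (simp only: sum_subtractf[symmetric] right_diff_distrib sum_distrib_left)
  finally show ?thesis unfolding Z by (simp add: u_def)
qed

text \<open>Since \<open>sgn\<close> is constant along a ray, the derivative falls on the components
  of the tensor alone, where it is the contraction of their partial derivatives with the direction
  of the ray.\<close>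

lemma has_real_derivative_radial_nabla:
  fixes x :: "real^'n"
  assumes "U \<in> C_infinity (eball0 R)" "x \<noteq> 0" "r \<in> einterval 0 R"
  shows "((\<lambda>r. radial_component j (sgn x) (cov j U (r *\<^sub>R sgn x))) has_real_derivative
    radial_component (Suc j) (sgn x) (cov (Suc j) U (r *\<^sub>R sgn x))) (at r)"
proof -
  define u where "u = sgn x"
  define y where "y = r *\<^sub>R u"
  have y: "y \<in> \<Omega>" using ray_in_punctured_ball[OF assms(2,3)] by (simp add: y_def u_def)
  have sy: "sgn y = u" using assms(2,3) by (simp add: y_def u_def sgn_ray einterval_iff)
  have D: "((\<lambda>r. cov j U (r *\<^sub>R u) I) has_real_derivative
      (\<Sum>i\<in>UNIV. u $ i * partial_deriv i (\<lambda>y. cov j U y I) y)) (at r)" for I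
  proof -
    have 1: "((\<lambda>y. cov j U y I) has_derivative
      (\<lambda>h. \<Sum>i\<in>UNIV. h $ i * partial_deriv i (\<lambda>y. cov j U y I) y)) (at (r *\<^sub>R u))"
      using has_derivative_partial_derivs[OF nabla_differentiable[OF assms(1) y, of j I]] by (simp add: y_def)
    have 2: "((\<lambda>r. r *\<^sub>R u) has_derivative (\<lambda>h. h *\<^sub>R u)) (at r)"
      by (auto intro!: derivative_eq_intros)
    show ?thesis
      using has_derivative_compose[OF 2 1]
      unfolding has_field_derivative_def
      by (rule has_derivative_eq_rhs) (simp add: fun_eq_iff sum_distrib_left mult_ac)
  qed
  have "((\<lambda>r. radial_component j u (cov j U (r *\<^sub>R u))) has_real_derivative
    (\<Sum>I | length I = j. (\<Prod>s<j. u $ (I ! s)) * (\<Sum>i\<in>UNIV. u $ i * partial_deriv i (\<lambda>y. cov j U y I) y))) (at r)"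
    unfolding radial_component_def by (intro DERIV_sum DERIV_cmult D)
  also have "(\<Sum>I | length I = j. (\<Prod>s<j. u $ (I ! s)) * (\<Sum>i\<in>UNIV. u $ i * partial_deriv i (\<lambda>y. cov j U y I) y))
    = radial_component (Suc j) u (cov (Suc j) U y)"
    using radial_component_cov_deriv[OF y, of j "cov j U"] by (simp add: sy)
  finally show ?thesis by (simp add: u_def y_def)
qed

lemma continuous_on_radial_nabla:
  fixes x :: "real^'n"
  assumes "U \<in> C_infinity (eball0 R)" "x \<noteq> 0"
  shows "continuous_on (einterval 0 R) (\<lambda>r. radial_component j (sgn x) (cov j U (r *\<^sub>R sgn x)))"
  using has_real_derivative_radial_nabla[OF assms]
  by (intro continuous_at_imp_continuous_on ballI) (auto intro: DERIV_isCont)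

text \<open>The matrix with tangential eigenvalue 1 / \<open>warp_factor\<close> is the symmetric
  square root of the inverse metric, so its columns form an orthonormal frame. Nonnegativity, the
  triangle inequality and Cauchy-Schwarz for tensors are then inherited from
  \<open>L2_set\<close>.\<close>

lemma tensor_norm_eq_frame:
  assumes "x \<in> \<Omega>"
  shows "tnorm j x T
    = L2_set (frame_component j (radial_matrix (inverse (warp_factor x)) x) T) {K. length K = j}"
proof -
  have x: "x \<noteq> 0" using punctured_ballD[OF assms] by simp
  let ?A = "radial_matrix (inverse (warp_factor x)) x"
  have "transpose ?A = ?A" by (simp add: transpose_def vec_eq_iff radial_matrix_sym)
  then have "?A ** transpose ?A = matrix_inv (metric x)"
    by (simp add: inverse_metric_eq[OF assms] radial_matrix_mult[OF x] power2_eq_square)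
  then show ?thesis
    using sum_frame_component_sq[of j ?A T] by (simp add: tensor_norm_def L2_set_def)
qed

lemma tensor_norm_nonneg:
  "x \<in> \<Omega> \<Longrightarrow> tnorm j x T \<ge> 0"
  by (simp add: tensor_norm_eq_frame)

lemma tensor_norm_cong:
  "(\<And>I. length I = j \<Longrightarrow> T I = T' I) \<Longrightarrow> tensor_norm g j x T = tensor_norm g j x T'"
  by (simp add: tensor_norm_def)

lemma tensor_norm_triangle:
  assumes "x \<in> \<Omega>"
  shows "tnorm j x (\<lambda>I. T I + T' I)
    \<le> tnorm j x T + tnorm j x T'"
proof -
  have "frame_component j A (\<lambda>I. T I + T' I) = (\<lambda>K. frame_component j A T K + frame_component j A T' K)" for A
    by (simp add: fun_eq_iff frame_component_def distrib_left sum.distrib)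
  then show ?thesis using L2_set_triangle_ineq by (simp add: tensor_norm_eq_frame[OF assms])
qed

lemma tensor_norm_minus: "tensor_norm g j x (\<lambda>I. - T I) = tensor_norm g j x T"
  by (simp add: tensor_norm_def)

text \<open>The frame matrix fixes \<open>sgn x\<close>. The radial component is therefore the
  Euclidean pairing of the frame components of T with the j-th tensor power of a unit vector, which
  has norm 1; apply Cauchy-Schwarz.\<close>

lemma radial_component_le_tensor_norm:
  assumes "x \<in> \<Omega>"
  shows "\<bar>radial_component j (sgn x) T\<bar> \<le> tnorm j x T"
proof -
  have x: "x \<noteq> 0" using punctured_ballD[OF assms] by simp
  define A where "A = radial_matrix (inverse (warp_factor x)) x"
  let ?P = "\<lambda>K. \<Prod>s<j. sgn x $ (K ! s)"
  have "(\<Sum>K | length K = j. ?P K * frame_component j A T K)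
    = (\<Sum>I | length I = j. (\<Sum>K | length K = j. \<Prod>s<j. A $ (I ! s) $ (K ! s) * sgn x $ (K ! s)) * T I)"
    unfolding frame_component_def sum_distrib_left sum_distrib_right
    by (subst sum.swap) (simp add: prod.distrib mult_ac)
  also have "\<dots> = radial_component j (sgn x) T"
  proof -
    have "(\<Sum>K | length K = j. \<Prod>s<j. A $ (I ! s) $ (K ! s) * sgn x $ (K ! s)) = (\<Prod>s<j. sgn x $ (I ! s))" for I
      using sum_lists_prod[of "\<lambda>s k. A $ (I ! s) $ k * sgn x $ k" j] by (simp add: A_def radial_matrix_sgn[OF x])
    then show ?thesis by (simp add: radial_component_def)
  qed
  finally have "\<bar>radial_component j (sgn x) T\<bar> = \<bar>\<Sum>K | length K = j. ?P K * frame_component j A T K\<bar>" by simp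
  also have "\<dots> \<le> (\<Sum>K | length K = j. \<bar>?P K\<bar> * \<bar>frame_component j A T K\<bar>)"
    by (rule order_trans[OF sum_abs]) (simp add: abs_mult)
  also have "\<dots> \<le> L2_set ?P {K. length K = j} * L2_set (frame_component j A T) {K. length K = j}"
    by (rule L2_set_mult_ineq)
  also have "L2_set ?P {K. length K = j} = 1"
  proof -
    have "(\<Sum>K | length K = j. (?P K)\<^sup>2) = (\<Prod>s<j. \<Sum>k\<in>UNIV. sgn x $ k * sgn x $ k)"
      by (subst sum_lists_prod[symmetric]) (simp add: power2_eq_square prod.distrib)
    also have "\<dots> = 1" by (simp add: sum_sgn_sq[OF x])
    finally show ?thesis by (simp add: L2_set_def)
  qed
  finally show ?thesis by (simp add: tensor_norm_eq_frame[OF assms] A_def)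
qed

text \<open>The inverse B of the frame matrix recovers the coordinate components. The constant may
  depend on x, as it is used to pass from convergence in norm to convergence of components at one
  point at a time.\<close>

lemma component_le_tensor_norm:
  assumes "x \<in> \<Omega>"
  obtains C where "\<And>T I. length I = j \<Longrightarrow> \<bar>T I\<bar> \<le> C * tnorm j x T"
proof -
  have x: "x \<noteq> 0" using punctured_ballD[OF assms] by simp
  define A where "A = radial_matrix (inverse (warp_factor x)) x"
  define B where "B = radial_matrix (warp_factor x) x"
  have AB: "A ** B = mat 1"
    using radial_matrix_mult[OF x] warp_factor_pos[OF assms] by (simp add: A_def B_def radial_matrix_1)
  have id: "frame_component j (mat 1) T L = T L" if "length L = j" for T and L :: "'a list"
  proof -
    have "(\<Prod>s<j. (mat 1 :: real^'a^'a) $ (I ! s) $ (L ! s)) = (if I = L then 1 else 0)" if lI: "length I = j" for I :: "'a list"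
    proof (cases "I = L")
      case False
      then obtain s where "s < j" "I ! s \<noteq> L ! s" using \<open>length L = j\<close> lI by (metis nth_equalityI)
      then show ?thesis using False by (auto simp: mat_def intro!: prod_zero)
    qed (simp add: mat_def)
    then have "frame_component j (mat 1) T L = (\<Sum>I | length I = j. (if I = L then 1 else 0) * T I)"
      unfolding frame_component_def by (intro sum.cong) auto
    also have "\<dots> = (\<Sum>I | length I = j. if I = L then T I else 0)"
      by (intro sum.cong) auto
    also have "\<dots> = T L" using that by (subst sum.delta) auto
    finally show ?thesis .
  qed
  define C where "C = (\<Sum>L | length L = j. L2_set (\<lambda>K. \<Prod>s<j. B $ (K ! s) $ (L ! s)) {K. length K = j})"
  show ?thesis
  proof
    fix T and I :: "'a list" assume I: "length I = j"
    have "\<bar>T I\<bar> = \<bar>\<Sum>K | length K = j. (\<Prod>s<j. B $ (K ! s) $ (I ! s)) * frame_component j A T K\<bar>"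
      using id[OF I, of T] by (simp add: frame_component_compose AB)
    also have "\<dots> \<le> (\<Sum>K | length K = j. \<bar>\<Prod>s<j. B $ (K ! s) $ (I ! s)\<bar> * \<bar>frame_component j A T K\<bar>)"
      by (rule order_trans[OF sum_abs]) (simp add: abs_mult)
    also have "\<dots> \<le> L2_set (\<lambda>K. \<Prod>s<j. B $ (K ! s) $ (I ! s)) {K. length K = j} * L2_set (frame_component j A T) {K. length K = j}"
      by (rule L2_set_mult_ineq)
    also have "\<dots> \<le> C * L2_set (frame_component j A T) {K. length K = j}"
      unfolding C_def using I by (intro mult_right_mono member_le_sum) auto
    finally show "\<bar>T I\<bar> \<le> C * tnorm j x T"
      by (simp add: tensor_norm_eq_frame[OF assms] A_def)
  qed
qed

end

section \<open>Completeness of the tensor-valued Lebesgue spaces\<close>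

lemma diff_order_continuous_on:
  assumes "diff_order n S f"
  shows "continuous_on S f"
proof (rule continuous_at_imp_continuous_on, rule ballI)
  fix x assume "x \<in> S"
  then have "f differentiable (at x)" by (rule diff_order_differentiable[OF assms])
  then show "isCont f x" by (rule differentiable_imp_continuous_within)
qed

context warped_ball
begin

section \<open>The Riemannian volume measure\<close>

definition vol :: "(real^'n::finite) measure" where
  "vol = riemannian_volume (eball0 R) metric"

lemma eball0_sets [simp]: "(eball0 R :: (real^'n) set) \<in> sets lebesgue"
  by (simp add: borel_open)

lemma punctured_ball_sets [simp]: "(\<Omega> :: (real^'n) set) \<in> sets lebesgue"
  by (simp add: borel_open)

lemma space_vol [simp]: "space vol = eball0 R"
  by (simp add: vol_def riemannian_volume_def)

lemma sets_vol: "sets vol = sets (lebesgue_on (eball0 R))"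
  by (simp add: vol_def riemannian_volume_def)

lemma measurable_vol: "borel_measurable vol = borel_measurable (lebesgue_on (eball0 R))"
  by (rule measurable_cong_sets) (simp_all add: sets_vol)

lemma AE_nonzero: "AE x::real^'n in lebesgue. x \<noteq> 0"
  by (rule AE_completion) (rule AE_lborel_singleton)

text \<open>The origin is a null set and the Lebesgue measure is complete, so measurability can be
  tested away from the origin, where regularity has been established.\<close>

lemma borel_measurable_vol_iff:
  fixes f :: "real^'n \<Rightarrow> real"
  shows "f \<in> borel_measurable vol \<longleftrightarrow> (\<lambda>x. indicator \<Omega> x * f x) \<in> borel_measurable lebesgue"
proof -
  have eq: "AE x::real^'n in lebesgue. indicator (eball0 R) x * f x = indicator \<Omega> x * f x"
    using AE_nonzero by eventually_elim (auto simp: indicator_def punctured_ball_def)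
  have "f \<in> borel_measurable vol \<longleftrightarrow> (\<lambda>x. indicator (eball0 R) x * f x) \<in> borel_measurable lebesgue"
    unfolding measurable_vol by (subst borel_measurable_restrict_space_iff) auto
  also have "\<dots> \<longleftrightarrow> (\<lambda>x. indicator \<Omega> x * f x) \<in> borel_measurable lebesgue"
  proof
    assume "(\<lambda>x. indicator (eball0 R) x * f x) \<in> borel_measurable lebesgue"
    then show "(\<lambda>x. indicator \<Omega> x * f x) \<in> borel_measurable lebesgue"
      using eq by (rule borel_measurable_lebesgue_cong_AE)
  next
    assume m: "(\<lambda>x. indicator \<Omega> x * f x) \<in> borel_measurable lebesgue"
    have "AE x::real^'n in lebesgue. indicator \<Omega> x * f x = indicator (eball0 R) x * f x"
      using eq by eventually_elim (rule sym)
    with m show "(\<lambda>x. indicator (eball0 R) x * f x) \<in> borel_measurable lebesgue"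
      by (rule borel_measurable_lebesgue_cong_AE)
  qed
  finally show ?thesis .
qed

lemma continuous_measurable_vol:
  fixes f :: "real^'n \<Rightarrow> real"
  assumes "continuous_on \<Omega> f"
  shows "f \<in> borel_measurable vol"
proof -
  have "(\<lambda>x. indicator \<Omega> x *\<^sub>R f x) \<in> borel_measurable borel"
    using assms by (intro borel_measurable_continuous_on_indicator) (simp_all add: borel_open)
  then have "(\<lambda>x. indicator \<Omega> x *\<^sub>R f x) \<in> borel_measurable lebesgue"
    by (intro measurable_completion) simp
  then show ?thesis by (simp add: borel_measurable_vol_iff)
qed

lemma diff_order_measurable_vol:
  "diff_order n \<Omega> f \<Longrightarrow> f \<in> borel_measurable vol"
  by (rule continuous_measurable_vol) (rule diff_order_continuous_on)

lemma det_measurable: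
  "(\<lambda>x::real^'n. ennreal (sqrt (det (metric x)))) \<in> borel_measurable (lebesgue_on (eball0 R))"
proof -
  have "(\<lambda>x::real^'n. sqrt (det (metric x))) \<in> borel_measurable vol"
  proof (rule continuous_measurable_vol)
    have "continuous_on \<Omega> (\<lambda>x::real^'n. warp_factor x ^ (CARD('n) - 1))"
      by (intro continuous_on_power diff_order_continuous_on[OF diff_order_warp_factor[of 0]])
    then show "continuous_on \<Omega> (\<lambda>x::real^'n. sqrt (det (metric x)))"
      by (rule continuous_on_eq) (simp add: sqrt_det_metric)
  qed
  then show ?thesis unfolding measurable_vol by (rule measurable_compose[OF _ measurable_ennreal])
qed

lemma AE_volI:
  fixes P :: "real^'n \<Rightarrow> bool"
  assumes "AE x in lebesgue. x \<in> \<Omega> \<longrightarrow> P x"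
  shows "AE x in vol. P x"
proof -
  have "AE x in lebesgue. x \<in> eball0 R \<longrightarrow> P x"
    using assms AE_nonzero by eventually_elim (auto simp: punctured_ball_def)
  then have "AE x in lebesgue_on (eball0 R). P x"
    by (subst AE_restrict_space_iff) auto
  then show ?thesis
    unfolding vol_def riemannian_volume_def by (subst AE_density[OF det_measurable]) auto
qed

lemma AE_vol_punctured: "AE x in vol. x \<in> \<Omega>"
  by (rule AE_volI) auto

lemma warp_factor_measurable: "warp_factor \<in> borel_measurable vol"
  by (rule diff_order_measurable_vol) (rule diff_order_warp_factor)

text \<open>The density is the (N-1)-st power of \<phi>(r) / r; on a ray it combines with the polar
  weight r^(N-1) to \<phi>^(N-1).\<close>

lemma nn_integral_vol:
  fixes f :: "real^'n \<Rightarrow> ennreal"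
  assumes "f \<in> borel_measurable vol"
  shows "(\<integral>\<^sup>+x. f x \<partial>vol) = (\<integral>\<^sup>+x. ennreal (warp_factor x ^ (CARD('n) - 1)) * f x * indicator \<Omega> x \<partial>lebesgue)"
proof -
  have "(\<integral>\<^sup>+x. f x \<partial>vol) = (\<integral>\<^sup>+x. ennreal (sqrt (det (metric x))) * f x \<partial>lebesgue_on (eball0 R))"
    unfolding vol_def riemannian_volume_def
    using assms by (subst nn_integral_density[OF det_measurable]) (auto simp: measurable_vol)
  also have "\<dots> = (\<integral>\<^sup>+x. ennreal (sqrt (det (metric x))) * f x * indicator (eball0 R) x \<partial>lebesgue)"
    by (subst nn_integral_restrict_space) auto
  also have "\<dots> = (\<integral>\<^sup>+x. ennreal (warp_factor x ^ (CARD('n) - 1)) * f x * indicator \<Omega> x \<partial>lebesgue)"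
  proof (rule nn_integral_cong_AE)
    show "AE x in lebesgue. ennreal (sqrt (det (metric x))) * f x * indicator (eball0 R) x
      = ennreal (warp_factor x ^ (CARD('n) - 1)) * f x * indicator \<Omega> x"
      using AE_nonzero
    proof eventually_elim
      case (elim x)
      then show ?case
        by (cases "x \<in> \<Omega>") (auto simp: sqrt_det_metric indicator_def punctured_ball_def)
    qed
  qed
  finally show ?thesis .
qed

lemma tensor_norm_measurable:
  assumes "\<And>I. length I = j \<Longrightarrow> (\<lambda>x. T x I) \<in> borel_measurable vol"
  shows "(\<lambda>x. tnorm j x (T x)) \<in> borel_measurable vol"
proof -
  have "(\<lambda>x. matrix_inv (metric x) $ i $ l) \<in> borel_measurable vol" for i l :: 'a
    by (rule diff_order_measurable_vol[of 0]) (rule diff_order_inverse_metric)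
  then have "(\<lambda>x. \<Sum>I | length I = j. \<Sum>L | length L = j.
      (\<Prod>s<j. matrix_inv (metric x) $ (I ! s) $ (L ! s)) * T x I * T x L) \<in> borel_measurable vol"
    using assms by (intro borel_measurable_sum borel_measurable_times borel_measurable_prod) auto
  then show ?thesis unfolding tensor_norm_def by measurable
qed

lemma nabla_measurable:
  "U \<in> C_infinity (eball0 R) \<Longrightarrow> (\<lambda>x. cov j U x I) \<in> borel_measurable vol"
  by (rule diff_order_measurable_vol[of 0]) (rule diff_order_nabla)

end

lemma powr_add_le:
  assumes "0 \<le> a" "0 \<le> b" "p \<ge> (1::real)"
  shows "(a + b) powr p \<le> 2 powr p * (a powr p + b powr p)"
proof -
  have "(a + b) powr p \<le> (2 * max a b) powr p" using assms by (intro powr_mono2) auto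
  also have "\<dots> = 2 powr p * (max a b) powr p" using assms by (simp add: powr_mult)
  also have "\<dots> \<le> 2 powr p * (a powr p + b powr p)"
    using assms by (intro mult_left_mono) (auto simp: max_def)
  finally show ?thesis .
qed

section \<open>The Riesz-Fischer theorem for tensor fields\<close>

lemma convergent_of_geometric_increments:
  fixes a :: "nat \<Rightarrow> real"
  assumes "\<forall>\<^sub>F k in sequentially. \<bar>a (Suc k) - a k\<bar> \<le> C * (1/2) ^ k"
  shows "convergent a"
proof -
  have "summable (\<lambda>k. C * (1/2::real) ^ k)" by (intro summable_mult summable_geometric) simp
  then have "summable (\<lambda>k. a (Suc k) - a k)"
    by (rule summable_comparison_test_ev[rotated]) (use assms in simp)
  then have "convergent (\<lambda>n. \<Sum>k<n. a (Suc k) - a k)" by (simp add: summable_iff_convergent)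
  then have "convergent (\<lambda>n. a n - a 0)" by (simp only: sum_lessThan_telescope)
  then have "convergent (\<lambda>n. a n - a 0 + a 0)" by (intro convergent_add convergent_const)
  then show ?thesis by simp
qed

context warped_ball
begin

definition Lp_field :: "real \<Rightarrow> nat \<Rightarrow> (real^'n::finite \<Rightarrow> 'n list \<Rightarrow> real) \<Rightarrow> bool" where
  "Lp_field p j T \<longleftrightarrow> (\<forall>I. length I = j \<longrightarrow> (\<lambda>x. T x I) \<in> borel_measurable vol) \<and>
     integrable vol (\<lambda>x. tnorm j x (T x) powr p)"

lemma Lp_field_iff: "T \<in> Lp_space (eball0 R) metric p j \<longleftrightarrow> Lp_field p j T"
  by (simp add: Lp_space_def Lp_field_def vol_def)

text \<open>Translates the Bochner integral inside \<open>Lp_norm\<close>, which is 0 by convention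
  for functions that are not integrable, into the nonnegative integral to which Fatou's lemma
  applies.\<close>

lemma Lp_field_nn_integral:
  assumes "p \<ge> 1" "Lp_field p j T"
  shows "(\<integral>\<^sup>+x. ennreal (tnorm j x (T x) powr p) \<partial>vol)
     = ennreal (pnorm p j T powr p)"
proof -
  have "(\<integral>\<^sup>+x. ennreal (tnorm j x (T x) powr p) \<partial>vol) = ennreal (\<integral>x. tnorm j x (T x) powr p \<partial>vol)"
    using assms by (intro nn_integral_eq_integral) (auto simp: Lp_field_def)
  moreover have "0 \<le> (\<integral>x. tnorm j x (T x) powr p \<partial>vol)" by (intro integral_nonneg_AE) auto
  ultimately show ?thesis using assms(1)
    by (simp add: Lp_norm_def powr_powr vol_def[symmetric])
qed

lemma Lp_fieldI:
  assumes "\<And>I. length I = j \<Longrightarrow> (\<lambda>x. T x I) \<in> borel_measurable vol"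
    "(\<integral>\<^sup>+x. ennreal (tnorm j x (T x) powr p) \<partial>vol) < \<infinity>"
  shows "Lp_field p j T"
  using assms tensor_norm_measurable[of j T] by (auto simp: Lp_field_def intro!: integrableI_bounded)

lemma Lp_norm_nonneg: "Lp_norm B g p j T \<ge> 0"
  by (simp add: Lp_norm_def)

lemma Lp_field_add:
  assumes p: "p \<ge> 1" and T: "Lp_field p j T" "Lp_field p j T'"
  shows "Lp_field p j (\<lambda>x I. T x I + T' x I)"
  unfolding Lp_field_def
proof (intro conjI allI impI)
  show m: "(\<lambda>x. T x I + T' x I) \<in> borel_measurable vol" if "length I = j" for I
    using T that by (intro borel_measurable_add) (simp_all add: Lp_field_def)
  show "integrable vol (\<lambda>x. tnorm j x (\<lambda>I. T x I + T' x I) powr p)"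
  proof (rule Bochner_Integration.integrable_bound)
    show "integrable vol (\<lambda>x. 2 powr p * (tnorm j x (T x) powr p + tnorm j x (T' x) powr p))"
      using T by (auto simp: Lp_field_def)
    have "(\<lambda>x. tnorm j x (\<lambda>I. T x I + T' x I)) \<in> borel_measurable vol"
      using m by (rule tensor_norm_measurable)
    then show "(\<lambda>x. tnorm j x (\<lambda>I. T x I + T' x I) powr p) \<in> borel_measurable vol" by measurable
    show "AE x in vol. norm (tnorm j x (\<lambda>I. T x I + T' x I) powr p) \<le> norm (2 powr p * (tnorm j x (T x) powr p + tnorm j x (T' x) powr p))"
      using AE_vol_punctured
    proof eventually_elim
      case (elim x)
      have "tnorm j x (\<lambda>I. T x I + T' x I) powr p \<le> (tnorm j x (T x) + tnorm j x (T' x)) powr p"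
        using p tensor_norm_triangle[OF elim, of j "T x" "T' x"] tensor_norm_nonneg[OF elim] by (intro powr_mono2) auto
      also have "\<dots> \<le> 2 powr p * (tnorm j x (T x) powr p + tnorm j x (T' x) powr p)"
        using p tensor_norm_nonneg[OF elim] by (intro powr_add_le) auto
      finally show ?case by simp
    qed
  qed
qed

lemma Lp_field_minus: "Lp_field p j T \<Longrightarrow> Lp_field p j (\<lambda>x I. - T x I)"
  by (auto simp: Lp_field_def tensor_norm_minus)

lemma Lp_field_diff:
  "p \<ge> 1 \<Longrightarrow> Lp_field p j T \<Longrightarrow> Lp_field p j T' \<Longrightarrow> Lp_field p j (\<lambda>x I. T x I - T' x I)"
  using Lp_field_add[OF _ _ Lp_field_minus, of p j T T'] by simp

text \<open>The Riesz-Fischer argument. A rapidly Cauchy subsequence converges almost everywhere in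
  every component, and Fatou's lemma turns the Cauchy bound into a bound for the distance to the
  pointwise limit.\<close>

theorem Lp_complete:
  fixes F :: "nat \<Rightarrow> real^'n::finite \<Rightarrow> 'n list \<Rightarrow> real"
  assumes p: "p \<ge> 1" and F: "\<And>n. Lp_field p j (F n)"
    and Cauchy: "\<And>e. e > 0 \<Longrightarrow> \<exists>n0. \<forall>m\<ge>n0. \<forall>n\<ge>n0.
       pnorm p j (\<lambda>x I. F m x I - F n x I) < e"
  shows "\<exists>T. Lp_limit (eball0 R) metric p j F T"
proof -
  have Fm: "length I = j \<Longrightarrow> (\<lambda>x. F n x I) \<in> borel_measurable vol" for n I
    using F by (auto simp: Lp_field_def)
  have nn: "(\<integral>\<^sup>+x. ennreal (tnorm j x (\<lambda>I. F m x I - F n x I) powr p) \<partial>vol) \<le> ennreal (e powr p)"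
    if "pnorm p j (\<lambda>x I. F m x I - F n x I) < e" for m n e
    unfolding Lp_field_nn_integral[OF p Lp_field_diff[OF p F F]]
    using that p by (intro ennreal_leI powr_mono2) (auto simp: Lp_norm_nonneg)
  \<comment> \<open>Of the base 1/4, one factor 1/2 pays for the weight 2^k in \<open>Dint\<close>
    and the other makes the resulting series summable.\<close>
  have "\<forall>k. \<exists>n0. \<forall>m\<ge>n0. \<forall>n\<ge>n0. pnorm p j (\<lambda>x I. F m x I - F n x I) < (1/4) ^ k"
    using Cauchy by simp
  then obtain n0 where n0: "\<And>k m n. m \<ge> n0 k \<Longrightarrow> n \<ge> n0 k \<Longrightarrow> pnorm p j (\<lambda>x I. F m x I - F n x I) < (1/4) ^ k"
    by metis
  \<comment> \<open>Summation makes r monotone and at least \<open>n0 k\<close>; the summand k makes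
    it unbounded.\<close>
  define r where "r = (\<lambda>k. (\<Sum>i\<le>k. n0 i) + k)"
  have r0: "r k \<ge> n0 k" for k unfolding r_def by (simp add: trans_le_add1 member_le_sum)
  have r1: "r k \<le> r (Suc k)" for k unfolding r_def by simp
  have rk: "r k \<ge> k" for k by (simp add: r_def)
  define D where "D = (\<lambda>k x. tnorm j x (\<lambda>I. F (r (Suc k)) x I - F (r k) x I))"
  have Dm[measurable]: "D k \<in> borel_measurable vol" for k
    unfolding D_def by (intro tensor_norm_measurable borel_measurable_diff Fm)
  have Dint: "(\<integral>\<^sup>+x. ennreal ((2 ^ k * D k x) powr p) \<partial>vol) \<le> ennreal ((1/2) ^ k)" for k
  proof -
    have "(\<integral>\<^sup>+x. ennreal ((2 ^ k * D k x) powr p) \<partial>vol) = (\<integral>\<^sup>+x. ennreal ((2 ^ k) powr p) * ennreal (D k x powr p) \<partial>vol)"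
    proof (rule nn_integral_cong_AE)
      show "AE x in vol. ennreal ((2 ^ k * D k x) powr p) = ennreal ((2 ^ k) powr p) * ennreal (D k x powr p)"
        using AE_vol_punctured
      proof eventually_elim
        case (elim x)
        then show ?case using tensor_norm_nonneg[OF elim] by (simp add: D_def powr_mult flip: ennreal_mult)
      qed
    qed
    also have "\<dots> = ennreal ((2 ^ k) powr p) * (\<integral>\<^sup>+x. ennreal (D k x powr p) \<partial>vol)"
      by (rule nn_integral_cmult) measurable
    also have "\<dots> \<le> ennreal ((2 ^ k) powr p) * ennreal (((1/4) ^ k) powr p)"
      unfolding D_def using r0[of k] r1[of k] by (intro mult_left_mono nn n0) auto
    also have "\<dots> = ennreal (((1/2) ^ k) powr p)"
      by (simp add: powr_mult[symmetric] power_mult_distrib[symmetric] flip: ennreal_mult)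
    also have "\<dots> \<le> ennreal (((1/2) ^ k) powr 1)"
      using p by (intro ennreal_leI powr_mono') (auto simp: power_le_one)
    finally show ?thesis by simp
  qed
  have "(\<integral>\<^sup>+x. (\<Sum>k. ennreal ((2 ^ k * D k x) powr p)) \<partial>vol) = (\<Sum>k. \<integral>\<^sup>+x. ennreal ((2 ^ k * D k x) powr p) \<partial>vol)"
    by (rule nn_integral_suminf) measurable
  also have "\<dots> \<le> (\<Sum>k. ennreal ((1/2) ^ k))" by (intro suminf_le Dint) auto
  also have "\<dots> = ennreal (\<Sum>k. (1/2) ^ k)"
    by (intro suminf_ennreal2) (auto intro: summable_geometric)
  finally have "(\<integral>\<^sup>+x. (\<Sum>k. ennreal ((2 ^ k * D k x) powr p)) \<partial>vol) \<noteq> \<infinity>"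
    by (auto simp: top_unique)
  then have "AE x in vol. (\<Sum>k. ennreal ((2 ^ k * D k x) powr p)) \<noteq> \<infinity>"
    by (intro nn_integral_noteq_infinite) auto
  then have conv: "AE x in vol. \<forall>I. length I = j \<longrightarrow> convergent (\<lambda>k. F (r k) x I)"
    using AE_vol_punctured
  proof eventually_elim
    case (elim x)
    obtain C where C: "\<And>T I. length I = j \<Longrightarrow> \<bar>T I\<bar> \<le> C * tnorm j x T"
      using component_le_tensor_norm[OF elim(2)] by blast
    have D0: "D k x \<ge> 0" for k using tensor_norm_nonneg[OF elim(2)] by (simp add: D_def)
    have "summable (\<lambda>k. (2 ^ k * D k x) powr p)"
      using elim(1) by (intro summable_suminf_not_top) auto
    then have "(\<lambda>k. (2 ^ k * D k x) powr p) \<longlonglongrightarrow> 0" by (rule summable_LIMSEQ_zero)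
    then have "\<forall>\<^sub>F k in sequentially. (2 ^ k * D k x) powr p < 1"
      by (rule order_tendstoD) simp
    then have ev: "\<forall>\<^sub>F k in sequentially. D k x \<le> (1/2) ^ k"
    proof eventually_elim
      case (elim k)
      have "2 ^ k * D k x \<le> 1"
      proof (rule ccontr)
        assume "\<not> 2 ^ k * D k x \<le> 1"
        then have "(2 ^ k * D k x) powr p \<ge> 1" using p by (intro ge_one_powr_ge_zero) auto
        with elim show False by simp
      qed
      then show ?case by (simp add: power_one_over field_simps)
    qed
    show ?case
    proof (intro allI impI)
      fix I :: "'n list" assume I: "length I = j"
      show "convergent (\<lambda>k. F (r k) x I)"
      proof (rule convergent_of_geometric_increments)
        show "\<forall>\<^sub>F k in sequentially. \<bar>F (r (Suc k)) x I - F (r k) x I\<bar> \<le> \<bar>C\<bar> * (1/2) ^ k"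
          using ev
        proof eventually_elim
          case (elim k)
          have "\<bar>F (r (Suc k)) x I - F (r k) x I\<bar> \<le> C * D k x"
            using C[OF I, of "\<lambda>I. F (r (Suc k)) x I - F (r k) x I"] by (simp add: D_def)
          also have "\<dots> \<le> \<bar>C\<bar> * (1/2) ^ k" using elim D0[of k] by (intro mult_mono) auto
          finally show ?case .
        qed
      qed
    qed
  qed
  \<comment> \<open>Where the subsequence diverges \<open>lim\<close> gives an unspecified value; by
    \<open>conv\<close> this happens on a null set.\<close>
  define T where "T = (\<lambda>x I. lim (\<lambda>k. F (r k) x I))"
  have Tm: "(\<lambda>x. T x I) \<in> borel_measurable vol" if "length I = j" for I
    unfolding T_def using that by (intro borel_measurable_lim_metric Fm)
  have dist: "(\<integral>\<^sup>+x. ennreal (tnorm j x (\<lambda>I. F m x I - T x I) powr p) \<partial>vol) \<le> ennreal (e powr p)"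
    if e: "\<And>n. n \<ge> n1 \<Longrightarrow> pnorm p j (\<lambda>x I. F m x I - F n x I) < e" for e m n1
  proof -
    have "(\<integral>\<^sup>+x. ennreal (tnorm j x (\<lambda>I. F m x I - T x I) powr p) \<partial>vol)
      = (\<integral>\<^sup>+x. liminf (\<lambda>k. ennreal (tnorm j x (\<lambda>I. F m x I - F (r k) x I) powr p)) \<partial>vol)"
    proof (rule nn_integral_cong_AE)
     show "AE x in vol. ennreal (tnorm j x (\<lambda>I. F m x I - T x I) powr p)
       = liminf (\<lambda>k. ennreal (tnorm j x (\<lambda>I. F m x I - F (r k) x I) powr p))"
      using conv AE_vol_punctured
     proof eventually_elim
      case (elim x)
      have "(\<lambda>k. F (r k) x I) \<longlonglongrightarrow> T x I" if "length I = j" for I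
        using elim(1) that by (simp add: T_def convergent_LIMSEQ_iff)
      then have "(\<lambda>k. tnorm j x (\<lambda>I. F m x I - F (r k) x I)) \<longlonglongrightarrow> tnorm j x (\<lambda>I. F m x I - T x I)"
        unfolding tensor_norm_def by (intro tendsto_intros) auto
      then have "(\<lambda>k. tnorm j x (\<lambda>I. F m x I - F (r k) x I) powr p) \<longlonglongrightarrow> tnorm j x (\<lambda>I. F m x I - T x I) powr p"
        using p tensor_norm_nonneg[OF elim(2)] by (intro tendsto_powr' tendsto_const) auto
      then have l: "(\<lambda>k. ennreal (tnorm j x (\<lambda>I. F m x I - F (r k) x I) powr p)) \<longlonglongrightarrow> ennreal (tnorm j x (\<lambda>I. F m x I - T x I) powr p)"
        by (rule tendsto_ennrealI)
      show ?case by (rule lim_imp_Liminf[OF trivial_limit_sequentially l, symmetric])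
     qed
    qed
    also have "\<dots> \<le> liminf (\<lambda>k. \<integral>\<^sup>+x. ennreal (tnorm j x (\<lambda>I. F m x I - F (r k) x I) powr p) \<partial>vol)"
    proof (rule nn_integral_liminf)
      fix k
      have "(\<lambda>x. tnorm j x (\<lambda>I. F m x I - F (r k) x I)) \<in> borel_measurable vol"
        by (intro tensor_norm_measurable borel_measurable_diff Fm)
      then show "(\<lambda>x. ennreal (tnorm j x (\<lambda>I. F m x I - F (r k) x I) powr p)) \<in> borel_measurable vol"
        by measurable
    qed
    also have "\<dots> \<le> ennreal (e powr p)"
    proof -
      have "\<forall>\<^sub>F k in sequentially. (\<integral>\<^sup>+x. ennreal (tnorm j x (\<lambda>I. F m x I - F (r k) x I) powr p) \<partial>vol) \<le> ennreal (e powr p)"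
        using eventually_ge_at_top[of n1] by eventually_elim (intro nn e, use rk in \<open>meson order_trans\<close>)
      then have "liminf (\<lambda>k. \<integral>\<^sup>+x. ennreal (tnorm j x (\<lambda>I. F m x I - F (r k) x I) powr p) \<partial>vol) \<le> liminf (\<lambda>k::nat. ennreal (e powr p))"
        by (rule Liminf_mono)
      then show ?thesis by (simp add: Liminf_const)
    qed
    finally show ?thesis .
  qed
  have FT: "Lp_field p j (\<lambda>x I. F m x I - T x I) \<and> pnorm p j (\<lambda>x I. F m x I - T x I) \<le> e"
    if e: "e > 0" "\<And>n. n \<ge> n1 \<Longrightarrow> pnorm p j (\<lambda>x I. F m x I - F n x I) < e" for e m n1
  proof -
    have d: "(\<integral>\<^sup>+x. ennreal (tnorm j x (\<lambda>I. F m x I - T x I) powr p) \<partial>vol) \<le> ennreal (e powr p)"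
      by (rule dist[of n1]) (rule e(2))
    have L: "Lp_field p j (\<lambda>x I. F m x I - T x I)"
      by (rule Lp_fieldI) (use d Fm Tm in \<open>auto intro: le_less_trans\<close>)
    have "pnorm p j (\<lambda>x I. F m x I - T x I) powr p \<le> e powr p"
      using d unfolding Lp_field_nn_integral[OF p L] by simp
    moreover have "e powr p < pnorm p j (\<lambda>x I. F m x I - T x I) powr p" if "e < pnorm p j (\<lambda>x I. F m x I - T x I)"
      using p e(1) that by (intro powr_less_mono2) auto
    ultimately have "pnorm p j (\<lambda>x I. F m x I - T x I) \<le> e" by (meson not_le)
    with L show ?thesis by simp
  qed
  have "Lp_field p j T"
  proof -
    obtain n1 where n1: "\<forall>m\<ge>n1. \<forall>n\<ge>n1. pnorm p j (\<lambda>x I. F m x I - F n x I) < 1" using Cauchy[of 1] by auto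
    then have "Lp_field p j (\<lambda>x I. F n1 x I - T x I)" using FT[of 1 n1 n1] by auto
    \<comment> \<open>T is the difference of \<open>F n1\<close> and \<open>F n1\<close> - T, which
      are both p-integrable.\<close>
    from Lp_field_diff[OF p F[of n1] this] show ?thesis by simp
  qed
  moreover have "(\<lambda>n. pnorm p j (\<lambda>x I. F n x I - T x I)) \<longlonglongrightarrow> 0"
  proof (rule LIMSEQ_I)
    fix e :: real assume "e > 0"
    then obtain n1 where n1: "\<forall>m\<ge>n1. \<forall>n\<ge>n1. pnorm p j (\<lambda>x I. F m x I - F n x I) < e / 2" using Cauchy[of "e / 2"] by auto
    have "norm (pnorm p j (\<lambda>x I. F m x I - T x I) - 0) < e" if "m \<ge> n1" for m
    proof -
      have "pnorm p j (\<lambda>x I. F m x I - T x I) \<le> e / 2" using FT[of "e / 2" n1 m] n1 that \<open>e > 0\<close> by simp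
      then have "\<bar>pnorm p j (\<lambda>x I. F m x I - T x I)\<bar> \<le> e / 2" by (simp only: abs_of_nonneg[OF Lp_norm_nonneg])
      with \<open>e > 0\<close> show ?thesis by simp
    qed
    then show "\<exists>n1. \<forall>m\<ge>n1. norm (pnorm p j (\<lambda>x I. F m x I - T x I) - 0) < e" by blast
  qed
  ultimately show ?thesis by (auto simp: Lp_limit_def Lp_field_iff)
qed

end

section \<open>Descent to almost every ray\<close>

text \<open>On almost every ray G agrees almost everywhere with a Borel representative, so the ray
  integrals of the two coincide there.\<close>

lemma AE_ray_nn_integral_finite_lebesgue:
  fixes G :: "'a::euclidean_space \<Rightarrow> ennreal"
  assumes G: "G \<in> borel_measurable lebesgue" and fin: "(\<integral>\<^sup>+x. G x \<partial>lebesgue) < \<infinity>"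
  shows "AE x in lborel.
    ray_integral lebesgue G x < \<infinity>"
proof -
  obtain G' where G': "G' \<in> borel_measurable lborel" and eq: "AE x in lborel. G x = G' x"
    using completion_ex_borel_measurable[OF G] by auto
  have "(\<integral>\<^sup>+x. G' x \<partial>lborel) = (\<integral>\<^sup>+x. G x \<partial>lborel)"
    using eq by (intro nn_integral_cong_AE) (auto simp: eq_commute)
  with fin have "(\<integral>\<^sup>+x. G' x \<partial>lborel) < \<infinity>" by (simp add: nn_integral_completion)
  moreover have "G' \<in> borel_measurable borel" using G' by simp
  ultimately have "AE x in lborel.
    ray_integral lborel G' x < \<infinity>"
    by (intro AE_ray_nn_integral_finite)
  moreover have "AE x in lborel. AE r in lborel. r > 0 \<longrightarrow> G (r *\<^sub>R sgn x) = G' (r *\<^sub>R sgn x)"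
    by (rule AE_ray) (rule AE_completion[OF eq])
  ultimately show ?thesis
  proof eventually_elim
    case (elim x)
    have "ray_integral lborel G x
      = ray_integral lborel G' x"
    proof (rule nn_integral_cong_AE)
      show "AE r in lborel. ennreal (r ^ (DIM('a) - 1)) * G (r *\<^sub>R sgn x) * indicator {0<..} r
        = ennreal (r ^ (DIM('a) - 1)) * G' (r *\<^sub>R sgn x) * indicator {0<..} r"
        using elim(2) by eventually_elim (auto simp: indicator_def)
    qed
    with elim(1) show ?case by (simp add: nn_integral_completion)
  qed
qed

lemma tendsto_0_of_suminf_ennreal_finite:
  fixes a :: "nat \<Rightarrow> ennreal"
  assumes "(\<Sum>k. a k) < \<infinity>"
  shows "a \<longlonglongrightarrow> 0"
proof -
  have fin: "a k < \<infinity>" for k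
  proof -
    have "a k \<le> (\<Sum>k. a k)" using sum_le_suminf[of a "{k}"] by simp
    with assms show ?thesis by (rule_tac le_less_trans)
  qed
  define b where "b = (\<lambda>k. enn2real (a k))"
  have ab: "a = (\<lambda>k. ennreal (b k))" using fin by (auto simp: b_def less_top)
  have "summable b"
  proof (rule summable_suminf_not_top)
    have "(\<Sum>k. ennreal (b k)) = (\<Sum>k. a k)" by (simp only: ab)
    then show "(\<Sum>k. ennreal (b k)) \<noteq> top" using assms by simp
  qed (simp add: b_def)
  then have "b \<longlonglongrightarrow> 0" by (rule summable_LIMSEQ_zero)
  then have "(\<lambda>k. ennreal (b k)) \<longlonglongrightarrow> ennreal 0" by (rule tendsto_ennrealI)
  then show ?thesis by (simp add: ab)
qed

text \<open>Along a subsequence with integrals below (1/2)^k the functions have an integrable sum,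
  whose ray integral is finite on almost every ray. There the individual ray integrals form a
  convergent series and tend to 0.\<close>

lemma AE_ray_tendsto_subseq:
  fixes f :: "nat \<Rightarrow> 'a::euclidean_space \<Rightarrow> real"
  assumes f: "\<And>n. f n \<in> borel_measurable lebesgue"
    and lim: "(\<lambda>n. \<integral>\<^sup>+x. ennreal (f n x) \<partial>lebesgue) \<longlonglongrightarrow> 0"
  obtains s where "strict_mono (s :: nat \<Rightarrow> nat)"
    "AE x in lborel. (\<lambda>n. ray_integral lebesgue (\<lambda>y. ennreal (f (s n) y)) x) \<longlonglongrightarrow> 0"
proof -
  have ex: "\<exists>n>m. (\<integral>\<^sup>+x. ennreal (f n x) \<partial>lebesgue) < ennreal ((1/2) ^ k)" for m k
  proof -
    have "\<forall>\<^sub>F n in sequentially. (\<integral>\<^sup>+x. ennreal (f n x) \<partial>lebesgue) < ennreal ((1/2) ^ k)"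
      using lim by (rule order_tendstoD) simp
    then have "\<forall>\<^sub>F n in sequentially. n > m \<and> (\<integral>\<^sup>+x. ennreal (f n x) \<partial>lebesgue) < ennreal ((1/2) ^ k)"
      using eventually_gt_at_top[of m] by eventually_elim simp
    then show ?thesis by (auto simp: eventually_sequentially)
  qed
  have "\<exists>s. \<forall>k. (\<integral>\<^sup>+x. ennreal (f (s k) x) \<partial>lebesgue) < ennreal ((1/2) ^ k) \<and> s k < s (Suc k)"
  proof (rule dependent_nat_choice)
    show "\<exists>n. (\<integral>\<^sup>+x. ennreal (f n x) \<partial>lebesgue) < ennreal ((1/2) ^ 0)" using ex[of 0 0] by blast
    show "\<exists>n. (\<integral>\<^sup>+x. ennreal (f n x) \<partial>lebesgue) < ennreal ((1/2) ^ Suc k) \<and> m < n" for m k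
      using ex[of m "Suc k"] by blast
  qed
  then obtain s :: "nat \<Rightarrow> nat" where s: "\<And>k. (\<integral>\<^sup>+x. ennreal (f (s k) x) \<partial>lebesgue) < ennreal ((1/2) ^ k)" "\<And>k. s k < s (Suc k)"
    by blast
  have fm: "(\<lambda>x. ennreal (f n x)) \<in> borel_measurable lebesgue" for n
    by (rule measurable_compose[OF f measurable_ennreal])
  define G where "G = (\<lambda>x. \<Sum>k. ennreal (f (s k) x))"
  have "(\<integral>\<^sup>+x. G x \<partial>lebesgue) = (\<Sum>k. \<integral>\<^sup>+x. ennreal (f (s k) x) \<partial>lebesgue)"
    unfolding G_def by (rule nn_integral_suminf) (rule fm)
  also have "\<dots> \<le> (\<Sum>k. ennreal ((1/2) ^ k))" using s(1) by (intro suminf_le) (auto intro: less_imp_le)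
  also have "\<dots> = ennreal (\<Sum>k. (1/2) ^ k)"
    by (intro suminf_ennreal2) (auto intro: summable_geometric)
  finally have "(\<integral>\<^sup>+x. G x \<partial>lebesgue) < \<infinity>" by (rule le_less_trans) simp
  moreover have "G \<in> borel_measurable lebesgue"
    unfolding G_def by (rule borel_measurable_suminf_order) (rule fm)
  ultimately have 1: "AE x in lborel.
    ray_integral lebesgue G x < \<infinity>"
    by (intro AE_ray_nn_integral_finite_lebesgue)
  \<comment> \<open>Measurability along the ray is what permits the exchange of sum and integral on
    it.\<close>
  have 2: "AE x in lborel. \<forall>n. (\<lambda>r. indicator {0<..} r * f (s n) (r *\<^sub>R sgn x)) \<in> borel_measurable lebesgue"
    unfolding AE_all_countable by (intro allI AE_ray_borel_measurable f)
  have "AE x in lborel. (\<lambda>n. ray_integral lebesgue (\<lambda>y. ennreal (f (s n) y)) x) \<longlonglongrightarrow> 0"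
    using 1 2
  proof eventually_elim
    case (elim x)
    have m: "(\<lambda>r. ennreal (r ^ (DIM('a) - 1)) * ennreal (f (s n) (r *\<^sub>R sgn x)) * indicator {0<..} r) \<in> borel_measurable lebesgue" for n
    proof -
      have [measurable]: "(\<lambda>r. indicator {0<..} r * f (s n) (r *\<^sub>R sgn x)) \<in> borel_measurable lebesgue" using elim(2) by blast
      have [measurable]: "(\<lambda>r. ennreal (r ^ (DIM('a) - 1))) \<in> borel_measurable lebesgue"
        by (rule measurable_completion) measurable
      have "(\<lambda>r. ennreal (r ^ (DIM('a) - 1)) * ennreal (indicator {0<..} r * f (s n) (r *\<^sub>R sgn x))) \<in> borel_measurable lebesgue"
        by measurable
      also have "(\<lambda>r. ennreal (r ^ (DIM('a) - 1)) * ennreal (indicator {0<..} r * f (s n) (r *\<^sub>R sgn x)))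
        = (\<lambda>r. ennreal (r ^ (DIM('a) - 1)) * ennreal (f (s n) (r *\<^sub>R sgn x)) * indicator {0<..} r)"
        by (auto simp: indicator_def)
      finally show ?thesis .
    qed
    have "ray_integral lebesgue G x
       = (\<integral>\<^sup>+r. (\<Sum>n. ennreal (r ^ (DIM('a) - 1)) * ennreal (f (s n) (r *\<^sub>R sgn x)) * indicator {0<..} r) \<partial>lebesgue)"
      by (intro nn_integral_cong) (simp add: G_def ennreal_suminf_cmult ennreal_suminf_multc)
    also have "\<dots> = (\<Sum>n. ray_integral lebesgue (\<lambda>y. ennreal (f (s n) y)) x)"
      by (rule nn_integral_suminf) (rule m)
    finally show ?case using elim(1) by (intro tendsto_0_of_suminf_ennreal_finite) simp
  qed
  moreover have "strict_mono s" using s(2) by (simp add: strict_mono_Suc_iff)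
  ultimately show ?thesis using that by blast
qed

text \<open>Since |r sgn x| = r, every ray meets the preimage of a null set of radii in a copy of
  that null set. Gluing over the rays shows that the preimage is null.\<close>

lemma AE_lebesgue_norm:
  assumes "AE t in lebesgue. P (t::real)"
  shows "AE x::'a::euclidean_space in lborel. P (norm x)"
proof -
  have "AE t in lborel. P t" using assms by (simp add: AE_completion_iff)
  then obtain Z where Z: "{t. \<not> P t} \<subseteq> Z" "Z \<in> null_sets lborel"
    by (auto simp: eventually_ae_filter)
  have [measurable]: "Z \<in> sets borel" using Z(2) by auto
  have "AE x::'a in lborel. x \<noteq> 0" by (rule AE_lborel_singleton)
  then have "AE x::'a in lborel. AE r in lborel. r > 0 \<longrightarrow> norm (r *\<^sub>R sgn x) \<notin> Z"
  proof eventually_elim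
    case (elim x)
    have "AE r in lborel. r \<notin> Z" using Z(2) by (rule AE_not_in)
    then show ?case by eventually_elim (use elim in \<open>simp add: norm_sgn\<close>)
  qed
  then have "AE x::'a in lborel. norm x \<notin> Z"
    by (subst (asm) AE_ray_iff) (auto intro: measurable_sets)
  then show ?thesis by eventually_elim (use Z(1) in auto)
qed

lemma C_infinity_diff:
  assumes "open S" "U \<in> C_infinity S" "V \<in> C_infinity S"
  shows "(\<lambda>x. U x - V x) \<in> C_infinity S"
proof -
  have eq: "x \<in> S \<Longrightarrow> partial_derivs I (\<lambda>x. U x - V x) x = partial_derivs I U x - partial_derivs I V x" for I x
  proof (induction I arbitrary: x)
    case (Cons i I)
    have "partial_deriv i (partial_derivs I (\<lambda>x. U x - V x)) x = partial_deriv i (\<lambda>x. partial_derivs I U x - partial_derivs I V x) x"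
      by (rule partial_deriv_cong_open[OF assms(1) Cons.prems]) (rule Cons.IH)
    then show ?case using assms(2,3) Cons.prems by (simp add: partial_deriv_diff C_infinity_def)
  qed simp
  show ?thesis
    unfolding C_infinity_def
  proof (intro CollectI allI ballI)
    fix I x assume x: "x \<in> S"
    have "(\<lambda>x. partial_derivs I U x - partial_derivs I V x) differentiable (at x)"
      using assms(2,3) x by (auto simp: C_infinity_def)
    then obtain D where "((\<lambda>x. partial_derivs I U x - partial_derivs I V x) has_derivative D) (at x)"
      by (auto simp: differentiable_def)
    then have "(partial_derivs I (\<lambda>x. U x - V x) has_derivative D) (at x)"
      by (rule has_derivative_transform_within_open[OF _ assms(1) x]) (simp add: eq)
    then show "partial_derivs I (\<lambda>x. U x - V x) differentiable (at x)"
      by (auto simp: differentiable_def)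
  qed
qed

context warped_ball
begin

section \<open>Existence of the covariant derivatives of Sobolev functions\<close>

lemma nabla_Lp_field:
  assumes "U \<in> smooth_sobolev (eball0 R) metric k p" "j \<le> k"
  shows "Lp_field p j (cov j U)"
  using assms nabla_measurable[of U j] by (auto simp: smooth_sobolev_def Lp_field_def vol_def)

text \<open>The Sobolev norm of U m - U n dominates the L^p norm of the difference of their j-th
  covariant derivatives, which therefore form a Cauchy sequence. Completeness supplies the
  limit.\<close>

lemma ex_has_sobolev_nabla:
  assumes p: "p \<ge> 1" and U: "sobolev_approx (eball0 R) metric k p U (u :: real^'n \<Rightarrow> real)" and j: "j \<le> k"
  shows "\<exists>T. Lp_limit (eball0 R) metric p j (\<lambda>n. cov j (U n)) T"
proof (rule Lp_complete[OF p])
  show "Lp_field p j (cov j (U n))" for n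
    using U j by (intro nabla_Lp_field) (auto simp: sobolev_approx_def)
  fix e :: real assume e: "e > 0"
  then obtain n0 where n0: "\<And>m n. m \<ge> n0 \<Longrightarrow> n \<ge> n0 \<Longrightarrow> sobolev_norm (eball0 R) metric k p (\<lambda>x. U m x - U n x) < e"
    using U unfolding sobolev_approx_def by blast
  have "pnorm p j (\<lambda>x I. cov j (U m) x I - cov j (U n) x I) < e"
    if "m \<ge> n0" "n \<ge> n0" for m n
  proof -
    have C: "U n \<in> C_infinity (eball0 R)" for n
      using U by (auto simp: sobolev_approx_def smooth_sobolev_def)
    have pm: "(\<lambda>x. h x powr p) \<in> borel_measurable vol" if "h \<in> borel_measurable vol" for h :: "real^'n \<Rightarrow> real"
      using that by measurable
    have "(\<lambda>x. tnorm j x (\<lambda>I. cov j (U m) x I - cov j (U n) x I) powr p) \<in> borel_measurable vol"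
      by (intro pm tensor_norm_measurable borel_measurable_diff nabla_measurable C)
    moreover have "(\<lambda>x. tnorm j x (cov j (\<lambda>x. U m x - U n x) x) powr p) \<in> borel_measurable vol"
      by (intro pm tensor_norm_measurable nabla_measurable C_infinity_diff C) simp
    moreover have "AE x in vol. tnorm j x (\<lambda>I. cov j (U m) x I - cov j (U n) x I) powr p
      = tnorm j x (cov j (\<lambda>x. U m x - U n x) x) powr p"
      using AE_vol_punctured
    proof eventually_elim
      case (elim x)
      then show ?case using nabla_diff[OF C C, of x j m n] by (intro arg_cong[of _ _ "\<lambda>y. y powr p"] tensor_norm_cong) simp
    qed
    ultimately have "pnorm p j (\<lambda>x I. cov j (U m) x I - cov j (U n) x I)
      = pnorm p j (cov j (\<lambda>x. U m x - U n x))"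
      unfolding Lp_norm_def vol_def[symmetric]
      by (intro arg_cong[of _ _ "\<lambda>y. y powr (1 / p)"] integral_cong_AE) auto
    also have "\<dots> \<le> sobolev_norm (eball0 R) metric k p (\<lambda>x. U m x - U n x)"
      unfolding sobolev_norm_def using j by (intro member_le_sum) (auto simp: Lp_norm_nonneg)
    also have "\<dots> < e" by (rule n0[OF that])
    finally show ?thesis .
  qed
  then show "\<exists>n0. \<forall>m\<ge>n0. \<forall>n\<ge>n0. pnorm p j
      (\<lambda>x I. cov j (U m) x I - cov j (U n) x I) < e"
    by blast
qed

text \<open>Existence makes the chosen tensor field an actual limit, for an approximating sequence
  that may depend on j.\<close>

lemma sobolev_nabla_works:
  assumes "p \<ge> 1" "u \<in> sobolev_space (eball0 R) metric k p" "j \<le> k"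
  shows "has_sobolev_nabla (eball0 R) metric k p j u (sobolev_nabla (eball0 R) metric k p j u)"
proof -
  obtain U where U: "sobolev_approx (eball0 R) metric k p U u"
    using assms(2) by (auto simp: sobolev_space_def)
  then have "\<exists>T. has_sobolev_nabla (eball0 R) metric k p j u T"
    using ex_has_sobolev_nabla[OF assms(1) U assms(3)] by (auto simp: has_sobolev_nabla_def)
  then show ?thesis unfolding sobolev_nabla_def by (rule someI_ex)
qed

lemma Lp_limit_nn_integral:
  assumes p: "p \<ge> 1" and F: "\<And>n. Lp_field p j (F n)" and lim: "Lp_limit (eball0 R) metric p j F T"
  shows "(\<lambda>n. \<integral>\<^sup>+x. ennreal (tnorm j x (\<lambda>I. F n x I - T x I) powr p) \<partial>vol) \<longlonglongrightarrow> 0"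
proof -
  have T: "Lp_field p j T" and l: "(\<lambda>n. pnorm p j (\<lambda>x I. F n x I - T x I)) \<longlonglongrightarrow> 0"
    using lim by (auto simp: Lp_limit_def Lp_field_iff)
  have "(\<lambda>n. pnorm p j (\<lambda>x I. F n x I - T x I) powr p) \<longlonglongrightarrow> 0 powr p"
    using p by (intro tendsto_powr' l tendsto_const) (auto simp: Lp_norm_nonneg)
  then have "(\<lambda>n. ennreal (pnorm p j (\<lambda>x I. F n x I - T x I) powr p)) \<longlonglongrightarrow> ennreal (0 powr p)"
    by (rule tendsto_ennrealI)
  then show ?thesis
    by (simp add: Lp_field_nn_integral[OF p Lp_field_diff[OF p F T]])
qed

lemma radial_component_measurable:
  assumes "\<And>I. length I = j \<Longrightarrow> (\<lambda>x. T x I) \<in> borel_measurable vol"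
  shows "(\<lambda>x. indicator \<Omega> x * radial_component j (sgn x) (T x)) \<in> borel_measurable lebesgue"
proof -
  have "(\<lambda>x. sgn x $ i) \<in> borel_measurable vol" for i :: 'a
  proof (rule continuous_measurable_vol)
    show "continuous_on \<Omega> (\<lambda>x. sgn x $ i)"
      unfolding sgn_div_norm by (intro continuous_intros) (auto simp: punctured_ball_def)
  qed
  then have "(\<lambda>x. radial_component j (sgn x) (T x)) \<in> borel_measurable vol"
    unfolding radial_component_def using assms
    by (intro borel_measurable_sum borel_measurable_times borel_measurable_prod) auto
  then show ?thesis by (simp only: borel_measurable_vol_iff)
qed

text \<open>The length of \<open>\<nabla>\<^sup>j U\<^sub>n - T\<close> dominates its radial component, so the \<open>L\<^sup>p\<close>-convergence descends to
  almost every ray, where the radial component of \<open>\<nabla>\<^sup>j U\<^sub>n\<close> is an ordinary derivative.\<close>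

lemma AE_ray_has_weak_deriv:
  fixes u :: "real^'n \<Rightarrow> real"
  assumes p: "p \<ge> 1" and approx: "sobolev_approx (eball0 R) metric k p U u" and j: "j \<le> k"
    and lim: "Lp_limit (eball0 R) metric p j (\<lambda>n. cov j (U n)) T"
    and rad: "radial_representation R u v"
  shows "AE x in lborel. has_weak_deriv R j v (\<lambda>r. radial_component j (sgn x) (T (r *\<^sub>R sgn x))) \<and>
    integrable (lebesgue_on (einterval 0 R))
      (\<lambda>r. \<bar>radial_component j (sgn x) (T (r *\<^sub>R sgn x))\<bar> powr p * \<phi> r ^ (CARD('n) - 1))"
proof -
  let ?S = "einterval 0 R"
  let ?N = "CARD('n) - 1"
  define h0 where "h0 = (\<lambda>n x. tnorm 0 x (\<lambda>I. U n x - u x) powr p)"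
  define h1 where "h1 = (\<lambda>n x. tnorm j x (\<lambda>I. cov j (U n) x I - T x I) powr p)"
  \<comment> \<open>The errors of order 0 and order j are added so that a single subsequence serves
    both; the power of \<open>warp_factor\<close> is the volume density.\<close>
  define f where "f = (\<lambda>n x. indicator \<Omega> x * (warp_factor x ^ ?N * (h0 n x + h1 n x)))"
  have UC: "U n \<in> C_infinity (eball0 R)" for n
    using approx by (auto simp: sobolev_approx_def smooth_sobolev_def)
  have N1: "Lp_field p j (cov j (U n))" for n
    using approx j by (intro nabla_Lp_field) (auto simp: sobolev_approx_def)
  have N0: "Lp_field p 0 (\<lambda>x I. U n x)" for n
    using nabla_Lp_field[of "U n" k p 0] approx by (simp add: sobolev_approx_def)
  have T: "Lp_field p j T" using lim by (simp add: Lp_limit_def Lp_field_iff)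
  have u0: "Lp_field p 0 (\<lambda>x I. u x)" using approx by (simp add: sobolev_approx_def Lp_limit_def Lp_field_iff)
  have h0m: "h0 n \<in> borel_measurable vol" and h1m: "h1 n \<in> borel_measurable vol" for n
    using Lp_field_diff[OF p N0 u0] Lp_field_diff[OF p N1 T]
    by (auto simp: h0_def h1_def Lp_field_def dest!: borel_measurable_integrable)
  have wf: "(\<lambda>x. warp_factor x ^ ?N) \<in> borel_measurable vol"
    using warp_factor_measurable by measurable
  have fm: "f n \<in> borel_measurable lebesgue" for n
  proof -
    have "(\<lambda>x. warp_factor x ^ ?N * (h0 n x + h1 n x)) \<in> borel_measurable vol"
      by (intro borel_measurable_times borel_measurable_add wf h0m h1m)
    then show ?thesis unfolding f_def by (simp only: borel_measurable_vol_iff)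
  qed
  have flim: "(\<lambda>n. \<integral>\<^sup>+x. ennreal (f n x) \<partial>lebesgue) \<longlonglongrightarrow> 0"
  proof -
    have "(\<integral>\<^sup>+x. ennreal (f n x) \<partial>lebesgue) = (\<integral>\<^sup>+x. ennreal (h0 n x) \<partial>vol) + (\<integral>\<^sup>+x. ennreal (h1 n x) \<partial>vol)" for n
    proof -
      have m: "(\<lambda>x. ennreal (h0 n x)) \<in> borel_measurable vol" "(\<lambda>x. ennreal (h1 n x)) \<in> borel_measurable vol"
        using h0m h1m by measurable
      have "(\<integral>\<^sup>+x. ennreal (f n x) \<partial>lebesgue)
        = (\<integral>\<^sup>+x. ennreal (warp_factor x ^ ?N) * (ennreal (h0 n x) + ennreal (h1 n x)) * indicator \<Omega> x \<partial>lebesgue)"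
      proof (rule nn_integral_cong)
        fix x :: "real^'n"
        have "0 \<le> h0 n x" "0 \<le> h1 n x" by (auto simp: h0_def h1_def)
        then show "ennreal (f n x) = ennreal (warp_factor x ^ ?N) * (ennreal (h0 n x) + ennreal (h1 n x)) * indicator \<Omega> x"
          using warp_factor_pos[of x] by (auto simp: f_def indicator_def ennreal_mult ennreal_plus)
      qed
      also have "\<dots> = (\<integral>\<^sup>+x. ennreal (h0 n x) + ennreal (h1 n x) \<partial>vol)"
        using m by (subst nn_integral_vol) auto
      also have "\<dots> = (\<integral>\<^sup>+x. ennreal (h0 n x) \<partial>vol) + (\<integral>\<^sup>+x. ennreal (h1 n x) \<partial>vol)"
        using m by (rule nn_integral_add)
      finally show ?thesis .
    qed
    moreover have "(\<lambda>n. \<integral>\<^sup>+x. ennreal (h0 n x) \<partial>vol) \<longlonglongrightarrow> 0"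
      unfolding h0_def using approx
      by (intro Lp_limit_nn_integral[of p 0 "\<lambda>n x I. U n x" "\<lambda>x I. u x"] p N0) (simp add: sobolev_approx_def)
    moreover have "(\<lambda>n. \<integral>\<^sup>+x. ennreal (h1 n x) \<partial>vol) \<longlonglongrightarrow> 0"
      unfolding h1_def by (intro Lp_limit_nn_integral p N1 lim)
    ultimately show ?thesis using tendsto_add[of _ "0::ennreal" sequentially _ 0] by simp
  qed
  obtain s where s: "strict_mono (s :: nat \<Rightarrow> nat)"
    "AE x in lborel. (\<lambda>n. ray_integral lebesgue (\<lambda>y. ennreal (f (s n) y)) x) \<longlonglongrightarrow> 0"
    using AE_ray_tendsto_subseq[of f, OF fm flim] by blast
  \<comment> \<open>Finite ray integrals of this function will give the weighted p-integrability of
    the radial component of T.\<close>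
  define Q where "Q = (\<lambda>x. indicator \<Omega> x * (warp_factor x ^ ?N * tnorm j x (T x) powr p))"
  have fin: "AE x in lborel. ray_integral lebesgue (\<lambda>x. ennreal (Q x)) x < \<infinity>"
  proof (rule AE_ray_nn_integral_finite_lebesgue)
    have tm: "(\<lambda>x. tnorm j x (T x) powr p) \<in> borel_measurable vol"
      using T by (auto simp: Lp_field_def)
    have "(\<lambda>x. warp_factor x ^ ?N * tnorm j x (T x) powr p) \<in> borel_measurable vol"
      by (intro borel_measurable_times wf tm)
    then have "Q \<in> borel_measurable lebesgue"
      by (simp only: borel_measurable_vol_iff Q_def)
    then show "(\<lambda>x. ennreal (Q x)) \<in> borel_measurable lebesgue"
      by (rule measurable_compose[OF _ measurable_ennreal])
    have "(\<integral>\<^sup>+x. ennreal (Q x) \<partial>lebesgue)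
      = (\<integral>\<^sup>+x. ennreal (warp_factor x ^ ?N) * ennreal (tnorm j x (T x) powr p) * indicator \<Omega> x \<partial>lebesgue)"
    proof (rule nn_integral_cong)
      fix x :: "real^'n"
      show "ennreal (Q x)
        = ennreal (warp_factor x ^ ?N) * ennreal (tnorm j x (T x) powr p) * indicator \<Omega> x"
        using warp_factor_pos[of x] by (cases "x \<in> \<Omega>") (auto simp: Q_def ennreal_mult'')
    qed
    also have "\<dots> = (\<integral>\<^sup>+x. ennreal (tnorm j x (T x) powr p) \<partial>vol)"
      using tm by (subst nn_integral_vol) (auto intro: measurable_compose[OF _ measurable_ennreal])
    also have "\<dots> < \<infinity>" by (simp add: Lp_field_nn_integral[OF p T])
    finally show "(\<integral>\<^sup>+x. ennreal (Q x) \<partial>lebesgue) < \<infinity>" .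
  qed
  have um: "(\<lambda>x. indicator \<Omega> x * u x) \<in> borel_measurable lebesgue"
    using u0 by (simp add: Lp_field_def borel_measurable_vol_iff)
  have wm: "(\<lambda>x. indicator \<Omega> x * radial_component j (sgn x) (T x)) \<in> borel_measurable lebesgue"
    using T by (intro radial_component_measurable) (simp add: Lp_field_def)
  have "AE x::real^'n in lborel. x \<noteq> 0" by (rule AE_lborel_singleton)
  then show ?thesis
    using s(2) fin AE_ray_borel_measurable[OF um] AE_ray_borel_measurable[OF wm]
  proof eventually_elim
    case (elim x)
    define \<theta> where "\<theta> = sgn x"
    define w where "w = (\<lambda>r. radial_component j \<theta> (T (r *\<^sub>R \<theta>)))"
    define d where "d = (\<lambda>n i r. radial_component i \<theta> (cov i (U (s n)) (r *\<^sub>R \<theta>)))"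
    have ray: "r *\<^sub>R \<theta> \<in> \<Omega>" if "r \<in> ?S" for r
      using ray_in_punctured_ball[OF elim(1) that] by (simp add: \<theta>_def)
    have sr: "sgn (r *\<^sub>R \<theta>) = \<theta>" if "r > 0" for r
      using elim(1) that by (simp add: \<theta>_def sgn_ray)
    have nr: "norm (r *\<^sub>R \<theta>) = r" if "r > 0" for r
      using that elim(1) by (simp add: \<theta>_def norm_sgn)
    \<comment> \<open>On the ray, the cut-off to the punctured ball and the cut-off to r > 0
      together amount to the cut-off to (0, R).\<close>
    have ind: "indicator {0<..} r * indicator \<Omega> (r *\<^sub>R \<theta>) = (indicator ?S r :: real)" for r
      using nr[of r] ray[of r] punctured_ballD[of "r *\<^sub>R \<theta>" R] by (auto simp: indicator_def einterval_iff)
    have vu: "v r = u (r *\<^sub>R \<theta>)" if "r \<in> ?S" for r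
      using rad ray[OF that] nr[of r] that by (auto simp: radial_representation_def punctured_ball_def einterval_iff)
    have Spos: "r > 0" if "r \<in> ?S" for r using that by (simp add: einterval_iff)
    have Sm: "?S \<in> sets lebesgue" by (simp add: borel_einterval)
    have vm: "v \<in> borel_measurable (lebesgue_on ?S)"
    proof -
      have "(\<lambda>r. indicator {0<..} r * (indicator \<Omega> (r *\<^sub>R \<theta>) * u (r *\<^sub>R \<theta>))) = (\<lambda>r. indicator ?S r *\<^sub>R v r)"
        using ind vu by (auto simp: fun_eq_iff mult.assoc[symmetric] indicator_def)
      then show ?thesis using elim(4) Sm by (subst borel_measurable_restrict_space_iff) (simp_all add: \<theta>_def)
    qed
    have wm': "w \<in> borel_measurable (lebesgue_on ?S)"
    proof -
      have "(\<lambda>r. indicator {0<..} r * (indicator \<Omega> (r *\<^sub>R \<theta>) * radial_component j (sgn (r *\<^sub>R \<theta>)) (T (r *\<^sub>R \<theta>)))) = (\<lambda>r. indicator ?S r *\<^sub>R w r)"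
      proof
        fix r
        show "indicator {0<..} r * (indicator \<Omega> (r *\<^sub>R \<theta>) * radial_component j (sgn (r *\<^sub>R \<theta>)) (T (r *\<^sub>R \<theta>))) = indicator ?S r *\<^sub>R w r"
          using sr[of r] by (cases "r > 0") (auto simp: w_def ind[of r, symmetric])
      qed
      then show ?thesis using elim(5) Sm by (subst borel_measurable_restrict_space_iff) (simp_all add: \<theta>_def)
    qed
    have dc: "continuous_on ?S (d n i)" for n i
      unfolding d_def \<theta>_def by (rule continuous_on_radial_nabla[OF UC elim(1)])
    \<comment> \<open>Polar weight times volume density is the weight of the one-dimensional Sobolev
      space.\<close>
    have weight: "r ^ ?N * warp_factor (r *\<^sub>R \<theta>) ^ ?N = \<phi> r ^ ?N" if "r > 0" for r
      unfolding warp_factor_def nr[OF that] power_mult_distrib[symmetric] using that by simp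
    have bound: "ennreal (c powr p * \<phi> r ^ ?N) * indicator ?S r \<le> ennreal (r ^ ?N) * ennreal (f (s n) (r *\<^sub>R \<theta>)) * indicator {0<..} r"
      if "c powr p \<le> h0 (s n) (r *\<^sub>R \<theta>) + h1 (s n) (r *\<^sub>R \<theta>) \<or> r \<notin> ?S" for c r n
    proof (cases "r \<in> ?S")
      case True
      have "c powr p * \<phi> r ^ ?N \<le> (h0 (s n) (r *\<^sub>R \<theta>) + h1 (s n) (r *\<^sub>R \<theta>)) * \<phi> r ^ ?N"
        using that True phi_pos[OF True] by (intro mult_right_mono) auto
      also have "\<dots> = r ^ ?N * f (s n) (r *\<^sub>R \<theta>)"
        unfolding weight[OF Spos[OF True], symmetric] using ray[OF True] by (simp add: f_def)
      finally have "ennreal (c powr p * \<phi> r ^ ?N) \<le> ennreal (r ^ ?N) * ennreal (f (s n) (r *\<^sub>R \<theta>))"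
        using Spos[OF True] by (simp add: ennreal_leI flip: ennreal_mult')
      then show ?thesis using True Spos[OF True] by simp
    qed simp
    have lims: "(\<lambda>n. \<integral>\<^sup>+r. ennreal (\<bar>g n r\<bar> powr p * \<phi> r ^ ?N) * indicator ?S r \<partial>lebesgue) \<longlonglongrightarrow> 0"
      if "\<And>n r. r \<in> ?S \<Longrightarrow> \<bar>g n r\<bar> powr p \<le> h0 (s n) (r *\<^sub>R \<theta>) + h1 (s n) (r *\<^sub>R \<theta>)" for g :: "nat \<Rightarrow> real \<Rightarrow> real"
    proof (rule tendsto_sandwich[OF _ _ tendsto_const])
      show "\<forall>\<^sub>F n in sequentially. (\<integral>\<^sup>+r. ennreal (\<bar>g n r\<bar> powr p * \<phi> r ^ ?N) * indicator ?S r \<partial>lebesgue)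
        \<le> (\<integral>\<^sup>+r. ennreal (r ^ ?N) * ennreal (f (s n) (r *\<^sub>R \<theta>)) * indicator {0<..} r \<partial>lebesgue)"
        using that by (intro always_eventually allI nn_integral_mono bound) blast
      show "(\<lambda>n. \<integral>\<^sup>+r. ennreal (r ^ ?N) * ennreal (f (s n) (r *\<^sub>R \<theta>)) * indicator {0<..} r \<partial>lebesgue) \<longlonglongrightarrow> 0"
        using elim(2) by (simp add: \<theta>_def)
    qed simp
    have lim0: "(\<lambda>n. \<integral>\<^sup>+r. ennreal (\<bar>d n 0 r - v r\<bar> powr p * \<phi> r ^ ?N) * indicator ?S r \<partial>lebesgue) \<longlonglongrightarrow> 0"
    proof (rule lims)
      fix n r assume r: "r \<in> ?S"
      have "\<bar>d n 0 r - v r\<bar> \<le> tnorm 0 (r *\<^sub>R \<theta>) (\<lambda>I. U (s n) (r *\<^sub>R \<theta>) - u (r *\<^sub>R \<theta>))"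
        using radial_component_le_tensor_norm[OF ray[OF r], of 0 "\<lambda>I. U (s n) (r *\<^sub>R \<theta>) - u (r *\<^sub>R \<theta>)"]
        by (simp add: d_def radial_component_def vu[OF r])
      then have "\<bar>d n 0 r - v r\<bar> powr p \<le> h0 (s n) (r *\<^sub>R \<theta>)"
        unfolding h0_def using p by (intro powr_mono2) auto
      moreover have "h1 (s n) (r *\<^sub>R \<theta>) \<ge> 0" by (simp add: h1_def)
      ultimately show "\<bar>d n 0 r - v r\<bar> powr p \<le> h0 (s n) (r *\<^sub>R \<theta>) + h1 (s n) (r *\<^sub>R \<theta>)" by simp
    qed
    have lim1: "(\<lambda>n. \<integral>\<^sup>+r. ennreal (\<bar>d n j r - w r\<bar> powr p * \<phi> r ^ ?N) * indicator ?S r \<partial>lebesgue) \<longlonglongrightarrow> 0"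
    proof (rule lims)
      fix n r assume r: "r \<in> ?S"
      have "\<bar>d n j r - w r\<bar> \<le> tnorm j (r *\<^sub>R \<theta>) (\<lambda>I. cov j (U (s n)) (r *\<^sub>R \<theta>) I - T (r *\<^sub>R \<theta>) I)"
        using radial_component_le_tensor_norm[OF ray[OF r], of j "\<lambda>I. cov j (U (s n)) (r *\<^sub>R \<theta>) I - T (r *\<^sub>R \<theta>) I"]
        by (simp add: d_def w_def radial_component_def sr[OF Spos[OF r]] right_diff_distrib sum_subtractf)
      then have "\<bar>d n j r - w r\<bar> powr p \<le> h1 (s n) (r *\<^sub>R \<theta>)"
        unfolding h1_def using p by (intro powr_mono2) auto
      moreover have "h0 (s n) (r *\<^sub>R \<theta>) \<ge> 0" by (simp add: h0_def)
      ultimately show "\<bar>d n j r - w r\<bar> powr p \<le> h0 (s n) (r *\<^sub>R \<theta>) + h1 (s n) (r *\<^sub>R \<theta>)" by simp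
    qed
    have dm: "(\<lambda>t. indicator {a..b} t * (d n i t - g t)) \<in> borel_measurable lebesgue"
      if "g \<in> borel_measurable (lebesgue_on ?S)" "{a..b} \<subseteq> ?S" for n i g and a b :: real
      by (rule borel_measurable_times_indicator_subset[OF _ that(2)])
        (intro borel_measurable_diff that(1) continuous_imp_measurable_on_sets_lebesgue dc Sm, simp)
    have "has_weak_deriv R j v w"
    proof (rule has_weak_deriv_L1_limit[OF R_pos])
      fix n i t assume "t \<in> ?S"
      then show "(d n i has_real_derivative d n (Suc i) t) (at t)"
        unfolding d_def \<theta>_def by (rule has_real_derivative_radial_nabla[OF UC elim(1)])
    next
      fix a b :: real assume ab: "0 < a" "a \<le> b" "ereal b < R"
      note sub = Icc_subset_einterval[OF ab(1,3)]
      have c: "continuous_on {a..b} (\<lambda>r. \<phi> r ^ ?N)"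
        by (intro continuous_intros continuous_on_subset[OF continuous_phi sub])
      have ps: "\<phi> t ^ ?N > 0" if "t \<in> {a..b}" for t using phi_pos[of t] sub that by auto
      show "(\<lambda>n. L1_dist_Icc a b (d n 0) v) \<longlonglongrightarrow> 0"
        by (rule tendsto_L1_Icc_of_weighted_Lp[OF p ab(2) sub c ps lim0 dm[OF vm sub]])
      show "(\<lambda>n. L1_dist_Icc a b (d n j) w) \<longlonglongrightarrow> 0"
        by (rule tendsto_L1_Icc_of_weighted_Lp[OF p ab(2) sub c ps lim1 dm[OF wm' sub]])
    qed (use dc vm wm' in auto)
    moreover have "integrable (lebesgue_on ?S) (\<lambda>r. \<bar>w r\<bar> powr p * \<phi> r ^ ?N)"
    proof (rule integrableI_bounded)
      have "\<phi> \<in> borel_measurable (lebesgue_on ?S)"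
        by (rule continuous_imp_measurable_on_sets_lebesgue[OF continuous_phi Sm])
      with wm' show "(\<lambda>r. \<bar>w r\<bar> powr p * \<phi> r ^ ?N) \<in> borel_measurable (lebesgue_on ?S)"
        by measurable
      have "(\<integral>\<^sup>+r. ennreal (norm (\<bar>w r\<bar> powr p * \<phi> r ^ ?N)) \<partial>lebesgue_on ?S)
        = (\<integral>\<^sup>+r. ennreal (norm (\<bar>w r\<bar> powr p * \<phi> r ^ ?N)) * indicator ?S r \<partial>lebesgue)"
        using Sm by (subst nn_integral_restrict_space) auto
      also have "\<dots> \<le> (\<integral>\<^sup>+r. ennreal (r ^ ?N) * ennreal (Q (r *\<^sub>R \<theta>)) * indicator {0<..} r \<partial>lebesgue)"
      proof (rule nn_integral_mono)
        fix r
        show "ennreal (norm (\<bar>w r\<bar> powr p * \<phi> r ^ ?N)) * indicator ?S r \<le> ennreal (r ^ ?N) * ennreal (Q (r *\<^sub>R \<theta>)) * indicator {0<..} r"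
        proof (cases "r \<in> ?S")
          case True
          have "\<bar>w r\<bar> \<le> tnorm j (r *\<^sub>R \<theta>) (T (r *\<^sub>R \<theta>))"
            using radial_component_le_tensor_norm[OF ray[OF True], of j "T (r *\<^sub>R \<theta>)"] by (simp add: w_def sr[OF Spos[OF True]])
          then have "\<bar>w r\<bar> powr p \<le> tnorm j (r *\<^sub>R \<theta>) (T (r *\<^sub>R \<theta>)) powr p"
            using p by (intro powr_mono2) auto
          then have "\<bar>w r\<bar> powr p * \<phi> r ^ ?N \<le> tnorm j (r *\<^sub>R \<theta>) (T (r *\<^sub>R \<theta>)) powr p * \<phi> r ^ ?N"
            using phi_pos[OF True] by (intro mult_right_mono) auto
          also have "\<dots> = r ^ ?N * (warp_factor (r *\<^sub>R \<theta>) ^ ?N * tnorm j (r *\<^sub>R \<theta>) (T (r *\<^sub>R \<theta>)) powr p)"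
            unfolding weight[OF Spos[OF True], symmetric] by simp
          finally have "ennreal (\<bar>w r\<bar> powr p * \<phi> r ^ ?N)
            \<le> ennreal (r ^ ?N) * ennreal (warp_factor (r *\<^sub>R \<theta>) ^ ?N * tnorm j (r *\<^sub>R \<theta>) (T (r *\<^sub>R \<theta>)) powr p)"
            using Spos[OF True] by (simp add: ennreal_leI flip: ennreal_mult')
          moreover have "norm (\<bar>w r\<bar> powr p * \<phi> r ^ ?N) = \<bar>w r\<bar> powr p * \<phi> r ^ ?N"
            using phi_pos[OF True] by simp
          ultimately show ?thesis using True ray[OF True] Spos[OF True] by (simp add: Q_def)
        qed simp
      qed
      also have "\<dots> < \<infinity>" using elim(3) by (simp add: \<theta>_def)
      finally show "(\<integral>\<^sup>+r. ennreal (norm (\<bar>w r\<bar> powr p * \<phi> r ^ ?N)) \<partial>lebesgue_on ?S) < \<infinity>" .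
    qed
    ultimately show ?case by (simp add: w_def \<theta>_def)
  qed
qed

end

text \<open>What holds almost everywhere holds somewhere, because \<open>lborel\<close> is not the
  zero measure.\<close>

lemma AE_lborel_ex:
  assumes "AE x::'a::euclidean_space in lborel. P x"
  shows "\<exists>x. P x"
proof -
  have "ae_filter (lborel :: 'a measure) \<noteq> bot"
    by (simp add: ae_filter_eq_bot_iff)
  then show ?thesis using assms by (rule eventually_happens')
qed

context warped_ball
begin

section \<open>The radial component as the weak derivative of the radial representation\<close>

lemma sobolev_nabla_ray:
  fixes u :: "real^'n \<Rightarrow> real"
  assumes "p \<ge> 1" "u \<in> sobolev_space (eball0 R) metric k p" "j \<le> k" "radial_representation R u v"
  defines "T \<equiv> sobolev_nabla (eball0 R) metric k p j u"
  shows "Lp_field p j T"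
    and "AE x in lborel. has_weak_deriv R j v (\<lambda>r. radial_component j (sgn x) (T (r *\<^sub>R sgn x))) \<and>
    integrable (lebesgue_on (einterval 0 R))
      (\<lambda>r. \<bar>radial_component j (sgn x) (T (r *\<^sub>R sgn x))\<bar> powr p * \<phi> r ^ (CARD('n) - 1))" (is ?ray)
proof -
  obtain U where U: "sobolev_approx (eball0 R) metric k p U u"
    "Lp_limit (eball0 R) metric p j (\<lambda>n. cov j (U n)) T"
    using sobolev_nabla_works[OF assms(1-3)] by (auto simp: has_sobolev_nabla_def T_def)
  show "Lp_field p j T" using U(2) by (simp add: Lp_limit_def Lp_field_iff)
  show ?ray
    by (rule AE_ray_has_weak_deriv[OF assms(1) U(1) assms(3) U(2) assms(4)])
qed

text \<open>On almost every ray the radial component of T is a weak derivative of one and the same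
  v, so it agrees there almost everywhere with the chosen \<open>weak_deriv\<close>. These
  statements are glued by \<open>AE_ray_iff\<close>; as this speaks of Borel sets, both sides are
  first replaced by Borel representatives.\<close>

lemma radial_component_eq_weak_deriv:
  fixes u :: "real^'n \<Rightarrow> real"
  assumes "p \<ge> 1" "u \<in> sobolev_space (eball0 R) metric k p" "j \<le> k" "radial_representation R u v"
  defines "T \<equiv> sobolev_nabla (eball0 R) metric k p j u"
  shows "AE x in lborel. x \<in> \<Omega> \<longrightarrow> radial_component j (sgn x) (T x) = weak_deriv R j v (norm x)"
proof -
  let ?S = "einterval 0 R"
  define f where "f = (\<lambda>x. indicator \<Omega> x * radial_component j (sgn x) (T x))"
  define W where "W = weak_deriv R j v"
  note ray = sobolev_nabla_ray[OF assms(1-4), folded T_def]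
  \<comment> \<open>One good ray supplies a weak derivative, so that the choice in
    \<open>weak_deriv\<close> is an actual weak derivative.\<close>
  have "\<exists>w. has_weak_deriv R j v w" using AE_lborel_ex[OF ray(2)] by blast
  then have W: "has_weak_deriv R j v W" unfolding W_def weak_deriv_def by (rule someI_ex)
  have fm: "f \<in> borel_measurable lebesgue"
    unfolding f_def using ray(1) by (intro radial_component_measurable) (simp add: Lp_field_def)
  obtain f' where f'[measurable]: "f' \<in> borel_measurable borel" and ff': "AE x in lebesgue. f x = f' x"
    using ex_borel_AE_lebesgue[OF fm] by blast
  have "AE x::real^'n in lborel. x \<noteq> 0" by (rule AE_lborel_singleton)
  then have fW: "AE x in lborel. AE r in lebesgue. r > 0 \<longrightarrow> f (r *\<^sub>R sgn x) = indicator ?S r * W r"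
    using ray(2)
  proof eventually_elim
    case (elim x)
    have "AE r in lebesgue. r \<in> ?S \<longrightarrow> radial_component j (sgn x) (T (r *\<^sub>R sgn x)) = W r"
      using has_weak_deriv_unique[OF R_pos] elim(2) W by blast
    then show ?case
    proof eventually_elim
      case (elim r)
      show ?case
      proof
        assume r: "r > 0"
        have s: "sgn (r *\<^sub>R sgn x) = sgn x" using r \<open>x \<noteq> 0\<close> by (rule sgn_ray[rotated])
        have n: "norm (r *\<^sub>R sgn x) = r" using r \<open>x \<noteq> 0\<close> by (simp add: norm_sgn)
        show "f (r *\<^sub>R sgn x) = indicator ?S r * W r"
        proof (cases "r \<in> ?S")
          case True
          then show ?thesis using elim s ray_in_punctured_ball[OF \<open>x \<noteq> 0\<close> True] by (simp add: f_def)
        next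
          case False
          then have "r *\<^sub>R sgn x \<notin> \<Omega>"
            using punctured_ballD[of "r *\<^sub>R sgn x" R] r unfolding n by (auto simp: einterval_iff)
          then show ?thesis using False by (simp add: f_def)
        qed
      qed
    qed
  qed
  \<comment> \<open>As a weak derivative, W comes with local integrability. Its measurability on all
    of (0, R) is read off from one good ray, where it agrees almost everywhere with f.\<close>
  have "AE x in lborel. (\<lambda>r. indicator {0<..} r * f (r *\<^sub>R sgn x)) \<in> borel_measurable lebesgue"
    by (rule AE_ray_borel_measurable[OF fm])
  with fW obtain x where x: "AE r in lebesgue. r > 0 \<longrightarrow> f (r *\<^sub>R sgn x) = indicator ?S r * W r"
      "(\<lambda>r. indicator {0<..} r * f (r *\<^sub>R sgn x)) \<in> borel_measurable lebesgue"
    using AE_lborel_ex[OF AE_conjI] by blast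
  have "AE r in lebesgue. indicator {0<..} r * f (r *\<^sub>R sgn x) = indicator ?S r * W r"
    using x(1) by eventually_elim (auto simp: indicator_def einterval_iff)
  with x(2) have "(\<lambda>r. indicator ?S r * W r) \<in> borel_measurable lebesgue"
    by (rule borel_measurable_lebesgue_cong_AE)
  then obtain W' where W'[measurable]: "W' \<in> borel_measurable borel" and WW': "AE r in lebesgue. indicator ?S r * W r = W' r"
    using ex_borel_AE_lebesgue by blast
  \<comment> \<open>W' is evaluated at the norm of the point on the ray, so that the condition
    becomes one on that point alone, as \<open>AE_ray_iff\<close> demands.\<close>
  have "AE x in lborel. AE r in lborel. r > 0 \<longrightarrow> f' (r *\<^sub>R sgn x) = W' (norm (r *\<^sub>R sgn x))"
  proof -
    have "AE x::real^'n in lborel. x \<noteq> 0" by (rule AE_lborel_singleton)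
    then show ?thesis using fW AE_ray[OF ff']
    proof eventually_elim
      case (elim x)
      have "AE r in lborel. r > 0 \<longrightarrow> f (r *\<^sub>R sgn x) = indicator ?S r * W r"
        "AE r in lborel. indicator ?S r * W r = W' r"
        using elim(2) WW' by (simp_all add: AE_completion_iff)
      then show ?case using elim(3)
        by eventually_elim (use elim(1) in \<open>auto simp: norm_sgn\<close>)
    qed
  qed
  moreover have "{x. f' x = W' (norm x)} \<in> sets borel" by measurable
  ultimately have "AE x in lborel. f' x = W' (norm x)" by (subst (asm) AE_ray_iff) auto
  moreover have "AE x::real^'n in lborel. indicator ?S (norm x) * W (norm x) = W' (norm x)"
    by (rule AE_lebesgue_norm[OF WW'])
  moreover have "AE x in lborel. f x = f' x" using ff' by (simp add: AE_completion_iff)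
  ultimately show ?thesis
  proof eventually_elim
    case (elim x)
    show ?case
    proof
      assume "x \<in> \<Omega>"
      with elim norm_in_einterval[of x] show "radial_component j (sgn x) (T x) = weak_deriv R j v (norm x)"
        by (simp add: f_def W_def)
    qed
  qed
qed

text \<open>As v is the same on all rays, one good ray for each j provides both the weak derivative
  and its weighted integrability.\<close>

theorem radial_sobolev_imp_weighted_sobolev:
  fixes u :: "real^'n \<Rightarrow> real"
  assumes "p \<ge> 1" "u \<in> sobolev_space (eball0 R) metric k p" "radial_representation R u v"
  shows "v \<in> weighted_sobolev_space R (\<lambda>t. \<phi> t ^ (CARD('n) - 1)) k p"
  unfolding weighted_sobolev_space_def
proof (intro CollectI allI impI)
  fix j assume "j \<le> k"
  from AE_lborel_ex[OF sobolev_nabla_ray(2)[OF assms(1,2) this assms(3)]]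
  show "\<exists>w. has_weak_deriv R j v w \<and> integrable (lebesgue_on (einterval 0 R)) (\<lambda>t. \<bar>w t\<bar> powr p * \<phi> t ^ (CARD('n) - 1))"
    by blast
qed

text \<open>At almost every point the weak derivative is the radial component of the tensor, which
  the length of the tensor dominates. There are finitely many orders j, so the exceptional sets
  together form a null set.\<close>

theorem AE_weak_deriv_le_tensor_norm:
  fixes u :: "real^'n \<Rightarrow> real"
  assumes "p \<ge> 1" "u \<in> sobolev_space (eball0 R) metric k p" "radial_representation R u v"
  shows "AE x in riemannian_volume (eball0 R) metric. \<forall>j\<le>k.
    \<bar>weak_deriv R j v (norm x)\<bar> \<le> tnorm j x (sobolev_nabla (eball0 R) metric k p j u x)"
proof -
  have "AE x in vol. \<bar>weak_deriv R j v (norm x)\<bar>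
    \<le> tnorm j x (sobolev_nabla (eball0 R) metric k p j u x)" if "j \<le> k" for j
  proof (rule AE_volI)
    show "AE x in lebesgue. x \<in> \<Omega> \<longrightarrow> \<bar>weak_deriv R j v (norm x)\<bar>
      \<le> tnorm j x (sobolev_nabla (eball0 R) metric k p j u x)"
      using AE_completion[OF radial_component_eq_weak_deriv[OF assms(1,2) that assms(3)]]
      by eventually_elim (metis radial_component_le_tensor_norm)
  qed
  then have "AE x in vol. \<forall>j\<in>{..k}. \<bar>weak_deriv R j v (norm x)\<bar>
    \<le> tnorm j x (sobolev_nabla (eball0 R) metric k p j u x)"
    by (intro AE_finite_allI) auto
  then show ?thesis unfolding vol_def atMost_iff Ball_def .
qed

end

theorem theorem1p1:
  fixes R :: ereal and \<phi> :: "real \<Rightarrow> real" and p :: real and k :: nat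
    and u :: "real^'n::finite \<Rightarrow> real" and v :: "real \<Rightarrow> real"
  assumes "CARD('n) \<ge> 2" and "0 < R" and "warping_function R \<phi>"
    and "p \<ge> 1" and "k \<ge> 1"
    and "u \<in> radial_sobolev_space R \<phi> k p"
    and "radial_representation R u v"
  shows "v \<in> weighted_sobolev_space R (\<lambda>t. \<phi> t ^ (CARD('n) - 1)) k p \<and>
    (AE x in riemannian_volume (eball0 R) (warped_metric \<phi>). \<forall>j\<le>k.
       tensor_norm (warped_metric \<phi>) j x
           (sobolev_nabla (eball0 R) (warped_metric \<phi>) k p j u x)
         \<ge> \<bar>weak_deriv R j v (norm x)\<bar>)"
proof -
  have w: "warped_ball R \<phi>" using assms(2,3) by unfold_locales
  have u: "u \<in> sobolev_space (eball0 R) (warped_metric \<phi>) k p"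
    using assms(6) by (simp add: radial_sobolev_space_def)
  show ?thesis
    using warped_ball.radial_sobolev_imp_weighted_sobolev[OF w assms(4) u assms(7)]
      warped_ball.AE_weak_deriv_le_tensor_norm[OF w assms(4) u assms(7)] by blast
qed

end
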